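(* Let $X$ be a proper Busemann space, and let $a:\mathbb{R}\to X$ be a geodesic with endpoints $\xi=a(+\infty)$ and $\eta=a(-\infty)$, passing through $a(0)=o$. The following conditions are equivalent: 1. $\operatorname{Td}(\xi,\eta)=\pi$; 2. there exist horofunctions $\Phi$ centered in $\xi$ and $\Psi$ centered in $\eta$ for which the intersection of horoballs $\mathcal{HB}(\Phi,o)\cap\mathcal{HB}(\Psi,o)$ is unbounded; 3. $a$ bounds a normed semiplane in $X$.
   Context: Busemann space: a geodesic metric space $X$ (distance written $|xy|$) such that for any two geodesic segments with affine parameterizations $\gamma:[a,b]\to X$, $\gamma':[a',b']\to X$ the function $(t,t')\mapsto|\gamma(t)\gamma'(t')|$ is convex. Proper means closed balls are compact. A ray is a distance-preserving map $c:\mathbb{R}_+=[0,\infty)\to X$; a (complete) geodesic $a:\mathbb{R}\to X$ is a distance-preserving map. Two rays are asymptotic if the Hausdorff distance between their images is finite; $\partial_gX$ (geodesic boundary) is the set of asymptoticity classes of rays, and $c(+\infty)$ denotes the class of $c$. For a geodesic $a:\mathbb{R}\to X$, $a(+\infty)$ is the class of the ray $t\mapsto a(t)$, $t\ge 0$, and $a(-\infty)$ the class of the ray $t\mapsto a(-t)$, $t\ge0$. For each $x\in X$, $\xi\in\partial_gX$ there is a unique ray $[x\xi]$ starting at $x$ in the class $\xi$. Geodesic compactification $\overline{X}_g=X\cup\partial_gX$ with the cone topology: fixing $o\in X$, a sequence $x_i\in\overline{X}_g$ converges to $x\in\overline{X}_g$ iff $|ox_i|\to|ox|$ (with $|ox|=\infty$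 for $x\in\partial_gX$) and the naturally parameterized segments/rays $[ox_i]$ converge to $[ox]$ (uniformly on bounded sets). It is compact and independent of $o$. On $\partial_gX$ a base of neighbourhoods of $\xi$ is given by $\{\eta\in\partial_gX : |c_\xi(K)c_\eta(K)|<1\}$, $K>0$, where $c_\xi=[o\xi]$, $c_\eta=[o\eta]$. Horofunction compactification: let $C(X,\mathbb{R})$ be the continuous functions with the topology of uniform convergence on bounded sets and $C^*(X,\mathbb{R})=C(X,\mathbb{R})/\{\text{constants}\}$; embed $X$ into $C^*(X,\mathbb{R})$ by $x\mapsto$ class of $y\mapsto|xy|$; $\overline{X}_h$ is the closure of the image and $\partial_hX=\overline{X}_h\setminus X$. A horofunction is a function $\Phi:X\to\mathbb{R}$ whose class $[\Phi]$ modulo constants lies in $\partial_hX$. The identity of $X$ extends to a continuous surjection $\pi_{hg}:\overline{X}_h\to\overline{X}_g$, mapping $\partial_hX$ onto $\partial_gX$. A horofunction $\Phi$ is centered in $\xi\in\partial_gX$ if $\pi_{hg}([\Phi])=\xi$. The horoball is $\mathcal{HB}(\Phi,y)=\{x\in X : \Phi(x)\le\Phi(y)\}$. A normed semiplane in $X$ is a subset of $X$ isometric to a half-plane (closed, bounded by a straight line) in a two-dimensional normed space; $a$ bounds the normed semiplane if the image of $a$ is the image of the boundary line of the half-plane under the isometry. For $o\in X$, $\xi,\eta\in\partial_gX$ and $c=[o\xi]$, $d=[o\eta]$, put $\delta_o(\xi,\eta)=\lim_{t\to+\infty}\frac{|c(t)d(t)|}{2t}\le 1$ (the quotient is non-decreasing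 in $t$; the limit is independent of $o$). The symbol $\operatorname{Td}$ is not a metric; it denotes the following binary relations on $\partial_gX$: - $\operatorname{Td}(\xi,\eta)<\pi$ if $\delta_o(\xi,\eta)<1$; - $\operatorname{Td}(\xi,\eta)\le\pi$ if for any neighbourhoods $U$ of $\xi$ and $V$ of $\eta$ in the cone topology there are $\xi'\in U$, $\eta'\in V$ with $\operatorname{Td}(\xi',\eta')<\pi$; - $\operatorname{Td}(\xi,\eta)\ge\pi$ if $\operatorname{Td}(\xi,\eta)<\pi$ does not hold; - $\operatorname{Td}(\xi,\eta)=\pi$ if both $\operatorname{Td}(\xi,\eta)\ge\pi$ and $\operatorname{Td}(\xi,\eta)\le\pi$ hold. *)

theory Defs
  imports "HOL-Analysis.Analysis"
begin

text \<open>The space \<open>X\<close> is the universe of a type of class \<^class>\<open>metric_space\<close>.\<close>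

section \<open>Proper Busemann spaces\<close>

definition distance_preserving_on :: "real set \<Rightarrow> (real \<Rightarrow> 'a::metric_space) \<Rightarrow> bool" where
  "distance_preserving_on S c \<longleftrightarrow> (\<forall>s\<in>S. \<forall>t\<in>S. dist (c s) (c t) = \<bar>s - t\<bar>)"

text \<open>A naturally parameterized segment from \<open>x\<close> to \<open>y\<close>; only the values on
  \<open>[0, |xy|]\<close> are relevant.\<close>

definition segment_between :: "'a::metric_space \<Rightarrow> 'a \<Rightarrow> (real \<Rightarrow> 'a) \<Rightarrow> bool" where
  "segment_between x y \<gamma> \<longleftrightarrow>
     distance_preserving_on {0..dist x y} \<gamma> \<and> \<gamma> 0 = x \<and> \<gamma> (dist x y) = y"

definition geodesic_space :: "'a::metric_space itself \<Rightarrow> bool" where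
  "geodesic_space _ \<longleftrightarrow> (\<forall>x y :: 'a. \<exists>\<gamma>. segment_between x y \<gamma>)"

definition affine_segment :: "real \<Rightarrow> real \<Rightarrow> (real \<Rightarrow> 'a::metric_space) \<Rightarrow> bool" where
  "affine_segment a b \<gamma> \<longleftrightarrow> a \<le> b \<and>
     (\<exists>l\<ge>0. \<forall>s\<in>{a..b}. \<forall>t\<in>{a..b}. dist (\<gamma> s) (\<gamma> t) = l * \<bar>s - t\<bar>)"

definition busemann_space :: "'a::metric_space itself \<Rightarrow> bool" where
  "busemann_space T \<longleftrightarrow> geodesic_space T \<and>
     (\<forall>a b a' b'. \<forall>(\<gamma> :: real \<Rightarrow> 'a) \<gamma>'. affine_segment a b \<gamma> \<longrightarrow> affine_segment a' b' \<gamma>' \<longrightarrow>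
        convex_on ({a..b} \<times> {a'..b'}) (\<lambda>(t, t'). dist (\<gamma> t) (\<gamma>' t')))"

definition proper_space :: "'a::metric_space itself \<Rightarrow> bool" where
  "proper_space _ \<longleftrightarrow> (\<forall>(x :: 'a) r. compact (cball x r))"


section \<open>Rays and the geodesic boundary\<close>

text \<open>Rays are defined on \<open>[0, \<infinity>)\<close>; the values of the representing function at negative
  arguments are arbitrary and never used.\<close>

definition ray :: "(real \<Rightarrow> 'a::metric_space) \<Rightarrow> bool" where
  "ray c \<longleftrightarrow> distance_preserving_on {0..} c"

definition geodesic_line :: "(real \<Rightarrow> 'a::metric_space) \<Rightarrow> bool" where
  "geodesic_line a \<longleftrightarrow> distance_preserving_on UNIV a"

definition hausdorff_distance :: "'a::metric_space set \<Rightarrow> 'a set \<Rightarrow> ennreal" where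
  "hausdorff_distance A B =
     max (SUP x\<in>A. INF y\<in>B. ennreal (dist x y)) (SUP y\<in>B. INF x\<in>A. ennreal (dist x y))"

definition asymptotic :: "(real \<Rightarrow> 'a::metric_space) \<Rightarrow> (real \<Rightarrow> 'a) \<Rightarrow> bool" where
  "asymptotic c d \<longleftrightarrow> hausdorff_distance (c ` {0..}) (d ` {0..}) < \<infinity>"

type_synonym 'a ideal_point = "(real \<Rightarrow> 'a) set"

definition ray_class :: "(real \<Rightarrow> 'a::metric_space) \<Rightarrow> 'a ideal_point" where
  "ray_class c = {d. ray d \<and> asymptotic c d}"

definition geodesic_boundary :: "'a::metric_space ideal_point set" where
  "geodesic_boundary = ray_class ` {c. ray c}"

definition end_plus :: "(real \<Rightarrow> 'a::metric_space) \<Rightarrow> 'a ideal_point" where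
  "end_plus a = ray_class a"

definition end_minus :: "(real \<Rightarrow> 'a::metric_space) \<Rightarrow> 'a ideal_point" where
  "end_minus a = ray_class (\<lambda>t. a (- t))"

text \<open>In a proper Busemann space both choices below are unique on \<open>[0, |xy|]\<close>
  and \<open>[0, \<infinity>)\<close> respectively.\<close>

definition segment_to :: "'a::metric_space \<Rightarrow> 'a \<Rightarrow> real \<Rightarrow> 'a" where
  "segment_to x y = (SOME \<gamma>. segment_between x y \<gamma>)"

definition ray_to :: "'a::metric_space \<Rightarrow> 'a ideal_point \<Rightarrow> real \<Rightarrow> 'a" where
  "ray_to x \<xi> = (SOME c. c \<in> \<xi> \<and> c 0 = x)"


section \<open>The geodesic compactification\<close>

definition geodesic_compactification :: "('a::metric_space + 'a ideal_point) set" where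
  "geodesic_compactification = range Inl \<union> Inr ` geodesic_boundary"

fun cone_radius :: "'a::metric_space \<Rightarrow> 'a + 'a ideal_point \<Rightarrow> ereal" where
  "cone_radius p (Inl x) = ereal (dist p x)"
| "cone_radius p (Inr \<xi>) = \<infinity>"

text \<open>Segments \<open>[px]\<close> are continued by the constant \<open>x\<close> beyond their endpoint, so that segments
  and rays can be compared on bounded subsets of \<open>[0, \<infinity>)\<close>.\<close>

fun cone_path :: "'a::metric_space \<Rightarrow> 'a + 'a ideal_point \<Rightarrow> real \<Rightarrow> 'a" where
  "cone_path p (Inl x) t = segment_to p x (min t (dist p x))"
| "cone_path p (Inr \<xi>) t = ray_to p \<xi> t"

definition cone_converges ::
  "'a::metric_space \<Rightarrow> (nat \<Rightarrow> 'a + 'a ideal_point) \<Rightarrow> 'a + 'a ideal_point \<Rightarrow> bool" where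
  "cone_converges p s x \<longleftrightarrow>
     (\<lambda>i. cone_radius p (s i)) \<longlonglongrightarrow> cone_radius p x \<and>
     (\<forall>R. uniform_limit {0..R} (\<lambda>i. cone_path p (s i)) (cone_path p x) sequentially)"

text \<open>The cone topology is given by its convergent sequences: a set is open iff it is
  sequentially open.\<close>

definition cone_topology :: "'a::metric_space \<Rightarrow> ('a + 'a ideal_point) topology" where
  "cone_topology p = topology (\<lambda>U. U \<subseteq> geodesic_compactification \<and>
     (\<forall>x\<in>U. \<forall>s. range s \<subseteq> geodesic_compactification \<longrightarrow> cone_converges p s x \<longrightarrow>
        (\<forall>\<^sub>F i in sequentially. s i \<in> U)))"

lemma istopology_sequential:
  fixes conv :: "(nat \<Rightarrow> 'b) \<Rightarrow> 'b \<Rightarrow> bool"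
  shows "istopology (\<lambda>U. U \<subseteq> S \<and>
     (\<forall>x\<in>U. \<forall>s. range s \<subseteq> S \<longrightarrow> conv s x \<longrightarrow> (\<forall>\<^sub>F i in sequentially. s i \<in> U)))"
    (is "istopology ?op")
  unfolding istopology_def
proof (intro conjI allI impI)
  fix A B assume A: "?op A" and B: "?op B"
  show "A \<inter> B \<subseteq> S" using A by blast
  show "\<forall>x\<in>A \<inter> B. \<forall>s. range s \<subseteq> S \<longrightarrow> conv s x \<longrightarrow> (\<forall>\<^sub>F i in sequentially. s i \<in> A \<inter> B)"
  proof (intro ballI allI impI)
    fix x s assume x: "x \<in> A \<inter> B" and s: "range s \<subseteq> S" "conv s x"
    have "\<forall>\<^sub>F i in sequentially. s i \<in> A" "\<forall>\<^sub>F i in sequentially. s i \<in> B"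
      using A[THEN conjunct2, rule_format, OF _ s] B[THEN conjunct2, rule_format, OF _ s] x
      by (simp_all only: Int_iff)
    then show "\<forall>\<^sub>F i in sequentially. s i \<in> A \<inter> B"
      by eventually_elim simp
  qed
next
  fix K assume K: "\<forall>U\<in>K. ?op U"
  show "\<Union> K \<subseteq> S" using K by blast
  show "\<forall>x\<in>\<Union> K. \<forall>s. range s \<subseteq> S \<longrightarrow> conv s x \<longrightarrow> (\<forall>\<^sub>F i in sequentially. s i \<in> \<Union> K)"
  proof (intro ballI allI impI)
    fix x s assume "x \<in> \<Union> K" and s: "range s \<subseteq> S" "conv s x"
    then obtain U where U: "U \<in> K" "x \<in> U" by blast
    have "\<forall>\<^sub>F i in sequentially. s i \<in> U" 
      by (rule bspec[OF K U(1), THEN conjunct2, rule_format, OF U(2) s])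
    then show "\<forall>\<^sub>F i in sequentially. s i \<in> \<Union> K"
      by eventually_elim (use U(1) in blast)
  qed
qed

lemma openin_cone_topology:
  "openin (cone_topology p) U \<longleftrightarrow> U \<subseteq> geodesic_compactification \<and>
     (\<forall>x\<in>U. \<forall>s. range s \<subseteq> geodesic_compactification \<longrightarrow> cone_converges p s x \<longrightarrow>
        (\<forall>\<^sub>F i in sequentially. s i \<in> U))"
  using istopology_sequential[of geodesic_compactification "cone_converges p"]
  unfolding cone_topology_def by (simp add: topology_inverse')

lemma topspace_cone_topology: "topspace (cone_topology p) = geodesic_compactification"
proof
  have "openin (cone_topology p) geodesic_compactification"
    unfolding openin_cone_topology by (auto simp: range_subsetD)
  then show "geodesic_compactification \<subseteq> topspace (cone_topology p)"
    by (rule openin_subset)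
next
  show "topspace (cone_topology p) \<subseteq> geodesic_compactification"
    using openin_topspace[of "cone_topology p"] unfolding openin_cone_topology by (rule conjunct1)
qed


section \<open>The horofunction compactification\<close>

definition continuous_functions :: "('a::metric_space \<Rightarrow> real) set" where
  "continuous_functions = {f. continuous_on UNIV f}"

text \<open>The topology of uniform convergence on bounded sets.\<close>

definition bounded_uniform_topology :: "('a::metric_space \<Rightarrow> real) topology" where
  "bounded_uniform_topology = topology (\<lambda>U. U \<subseteq> continuous_functions \<and>
     (\<forall>f\<in>U. \<exists>B e. bounded B \<and> e > 0 \<and>
        {g \<in> continuous_functions. \<forall>x\<in>B. \<bar>g x - f x\<bar> < e} \<subseteq> U))"

lemma openin_bounded_uniform_topology:
  "openin bounded_uniform_topology U \<longleftrightarrow> U \<subseteq> continuous_functions \<and>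
     (\<forall>f\<in>U. \<exists>B e. bounded B \<and> e > 0 \<and>
        {g \<in> continuous_functions. \<forall>x\<in>B. \<bar>g x - f x\<bar> < e} \<subseteq> U)"
proof -
  define nbhd where "nbhd f B e = {g \<in> continuous_functions. \<forall>x\<in>B. \<bar>g x - f x\<bar> < e}"
    for f :: "'a \<Rightarrow> real" and B e
  have "istopology (\<lambda>U. U \<subseteq> continuous_functions \<and>
     (\<forall>f\<in>U. \<exists>B e. bounded B \<and> e > 0 \<and> nbhd f B e \<subseteq> U))" (is "istopology ?op")
    unfolding istopology_def
  proof (intro conjI allI impI)
    fix S T assume S: "?op S" and T: "?op T"
    show "S \<inter> T \<subseteq> continuous_functions" using S by blast
    show "\<forall>f\<in>S \<inter> T. \<exists>B e. bounded B \<and> e > 0 \<and> nbhd f B e \<subseteq> S \<inter> T"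
    proof
      fix f assume f: "f \<in> S \<inter> T"
      obtain B e where 1: "bounded B" "e > 0" "nbhd f B e \<subseteq> S"
        using S f by blast
      obtain B' e' where 2: "bounded B'" "e' > 0" "nbhd f B' e' \<subseteq> T"
        using T f by blast
      have "nbhd f (B \<union> B') (min e e') \<subseteq> nbhd f B e \<inter> nbhd f B' e'"
        unfolding nbhd_def by auto
      then have "nbhd f (B \<union> B') (min e e') \<subseteq> S \<inter> T"
        using 1(3) 2(3) by blast
      moreover have "bounded (B \<union> B')" "min e e' > 0" using 1 2 by auto
      ultimately show "\<exists>B e. bounded B \<and> e > 0 \<and> nbhd f B e \<subseteq> S \<inter> T" by blast
    qed
  next
    fix K assume K: "\<forall>U\<in>K. ?op U"
    show "\<Union> K \<subseteq> continuous_functions" using K by blast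
    show "\<forall>f\<in>\<Union> K. \<exists>B e. bounded B \<and> e > 0 \<and> nbhd f B e \<subseteq> \<Union> K"
    proof
      fix f assume "f \<in> \<Union> K"
      then obtain U where U: "U \<in> K" "f \<in> U" by blast
      then obtain B e where "bounded B" "e > 0" "nbhd f B e \<subseteq> U" using K by metis
      then show "\<exists>B e. bounded B \<and> e > 0 \<and> nbhd f B e \<subseteq> \<Union> K" using U(1) by blast
    qed
  qed
  then show ?thesis
    unfolding bounded_uniform_topology_def nbhd_def by (simp only: topology_inverse')
qed

lemma topspace_bounded_uniform_topology:
  "topspace bounded_uniform_topology = (continuous_functions :: ('a::metric_space \<Rightarrow> real) set)"
proof
  have "openin bounded_uniform_topology (continuous_functions :: ('a \<Rightarrow> real) set)"
    unfolding openin_bounded_uniform_topology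
  proof (intro conjI ballI exI)
    show "bounded ({} :: 'a set)" "(1 :: real) > 0" by simp_all
  qed blast+
  then show "(continuous_functions :: ('a \<Rightarrow> real) set) \<subseteq> topspace bounded_uniform_topology"
    by (rule openin_subset)
next
  show "topspace bounded_uniform_topology \<subseteq> (continuous_functions :: ('a \<Rightarrow> real) set)"
    using openin_topspace[of "bounded_uniform_topology :: ('a \<Rightarrow> real) topology"]
    unfolding openin_bounded_uniform_topology by (rule conjunct1)
qed

definition mod_const :: "('a \<Rightarrow> real) \<Rightarrow> ('a \<Rightarrow> real) set" where
  "mod_const f = {g. \<exists>k. g = (\<lambda>x. f x + k)}"

text \<open>\<open>C\<^sup>*(X, \<real>)\<close> with the quotient topology.\<close>

definition function_classes_topology :: "('a::metric_space \<Rightarrow> real) set topology" where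
  "function_classes_topology = topology (\<lambda>U. U \<subseteq> mod_const ` continuous_functions \<and>
     openin bounded_uniform_topology {f \<in> continuous_functions. mod_const f \<in> U})"

lemma openin_function_classes_topology:
  "openin function_classes_topology U \<longleftrightarrow> U \<subseteq> mod_const ` continuous_functions \<and>
     openin bounded_uniform_topology {f \<in> continuous_functions. mod_const f \<in> U}"
proof -
  have "istopology (\<lambda>U :: ('a \<Rightarrow> real) set set. U \<subseteq> mod_const ` continuous_functions \<and>
     openin bounded_uniform_topology {f \<in> continuous_functions. mod_const f \<in> U})"
    unfolding istopology_def
  proof (intro conjI allI impI)
    fix S T :: "('a \<Rightarrow> real) set set"
    assume S: "S \<subseteq> mod_const ` continuous_functions \<and>
        openin bounded_uniform_topology {f \<in> continuous_functions. mod_const f \<in> S}"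
      and T: "T \<subseteq> mod_const ` continuous_functions \<and>
        openin bounded_uniform_topology {f \<in> continuous_functions. mod_const f \<in> T}"
    show "S \<inter> T \<subseteq> mod_const ` continuous_functions" using S by (simp add: le_infI1)
    have "{f \<in> continuous_functions. mod_const f \<in> S \<inter> T} =
      {f \<in> continuous_functions. mod_const f \<in> S} \<inter> {f \<in> continuous_functions. mod_const f \<in> T}"
      by blast
    then show "openin bounded_uniform_topology {f \<in> continuous_functions. mod_const f \<in> S \<inter> T}"
      using S T by (simp only: openin_Int)
  next
    fix K :: "('a \<Rightarrow> real) set set set"
    assume K: "\<forall>U\<in>K. U \<subseteq> mod_const ` continuous_functions \<and>
        openin bounded_uniform_topology {f \<in> continuous_functions. mod_const f \<in> U}"
    show "\<Union> K \<subseteq> mod_const ` continuous_functions" using K by (simp add: Sup_least)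
    have "{f \<in> continuous_functions. mod_const f \<in> \<Union> K} =
      (\<Union>U\<in>K. {f \<in> continuous_functions. mod_const f \<in> U})"
      by blast
    moreover have "openin bounded_uniform_topology
        (\<Union>U\<in>K. {f \<in> continuous_functions. mod_const f \<in> U})"
      by (rule openin_Union) (use K in blast)
    ultimately show "openin bounded_uniform_topology
        {f \<in> continuous_functions. mod_const f \<in> \<Union> K}"
      by (simp only:)
  qed
  then show ?thesis unfolding function_classes_topology_def by (simp only: topology_inverse')
qed

lemma quotient_map_mod_const:
  "quotient_map bounded_uniform_topology function_classes_topology
     (mod_const :: ('a::metric_space \<Rightarrow> real) \<Rightarrow> _)"
proof -
  have "openin function_classes_topology
      (mod_const ` (continuous_functions :: ('a \<Rightarrow> real) set))"
  proof -
    have "{f \<in> continuous_functions. mod_const f \<in> mod_const ` continuous_functions} =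
      topspace (bounded_uniform_topology :: ('a \<Rightarrow> real) topology)"
      unfolding topspace_bounded_uniform_topology by blast
    then show ?thesis unfolding openin_function_classes_topology by simp
  qed
  then have "mod_const ` (continuous_functions :: ('a \<Rightarrow> real) set) \<subseteq> topspace function_classes_topology"
    by (rule openin_subset)
  moreover have "topspace function_classes_topology \<subseteq>
      mod_const ` (continuous_functions :: ('a \<Rightarrow> real) set)"
    using openin_topspace[of "function_classes_topology :: ('a \<Rightarrow> real) set topology"]
    unfolding openin_function_classes_topology by (rule conjunct1)
  ultimately have "topspace function_classes_topology =
      mod_const ` (continuous_functions :: ('a \<Rightarrow> real) set)"
    by (rule subset_antisym[rotated])
  then show ?thesis
    unfolding quotient_map_def topspace_bounded_uniform_topology openin_function_classes_topology
    by auto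
qed

definition distance_class :: "'a::metric_space \<Rightarrow> ('a \<Rightarrow> real) set" where
  "distance_class x = mod_const (\<lambda>y. dist x y)"

definition horofunction_compactification :: "('a::metric_space \<Rightarrow> real) set set" where
  "horofunction_compactification = function_classes_topology closure_of range distance_class"

definition horofunction_boundary :: "('a::metric_space \<Rightarrow> real) set set" where
  "horofunction_boundary = horofunction_compactification - range distance_class"

definition horofunction :: "('a::metric_space \<Rightarrow> real) \<Rightarrow> bool" where
  "horofunction \<Phi> \<longleftrightarrow> mod_const \<Phi> \<in> horofunction_boundary"

text \<open>The continuous extension of the identity of \<open>X\<close>. It exists when \<open>X\<close> is a proper Busemann
  space, and it is unique on the horofunction compactification, because the image of \<open>X\<close> is dense
  there and the cone topology is then Hausdorff. The point \<open>p\<close> is the base point of the cone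
  topology.\<close>

definition horo_to_geodesic ::
  "'a::metric_space \<Rightarrow> ('a \<Rightarrow> real) set \<Rightarrow> 'a + 'a ideal_point" where
  "horo_to_geodesic p = (SOME h.
     continuous_map (subtopology function_classes_topology horofunction_compactification)
       (cone_topology p) h \<and>
     (\<forall>x. h (distance_class x) = Inl x))"

definition centered_in ::
  "'a::metric_space \<Rightarrow> ('a \<Rightarrow> real) \<Rightarrow> 'a ideal_point \<Rightarrow> bool" where
  "centered_in p \<Phi> \<xi> \<longleftrightarrow> horo_to_geodesic p (mod_const \<Phi>) = Inr \<xi>"

definition horoball :: "('a::metric_space \<Rightarrow> real) \<Rightarrow> 'a \<Rightarrow> 'a set" where
  "horoball \<Phi> y = {x. \<Phi> x \<le> \<Phi> y}"


section \<open>The relations \<open>Td\<close>\<close>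

definition ray_divergence ::
  "'a::metric_space \<Rightarrow> 'a ideal_point \<Rightarrow> 'a ideal_point \<Rightarrow> real" where
  "ray_divergence p \<xi> \<eta> = Lim at_top (\<lambda>t. dist (ray_to p \<xi> t) (ray_to p \<eta> t) / (2 * t))"

definition Td_less_pi :: "'a::metric_space \<Rightarrow> 'a ideal_point \<Rightarrow> 'a ideal_point \<Rightarrow> bool" where
  "Td_less_pi p \<xi> \<eta> \<longleftrightarrow> ray_divergence p \<xi> \<eta> < 1"

definition Td_le_pi :: "'a::metric_space \<Rightarrow> 'a ideal_point \<Rightarrow> 'a ideal_point \<Rightarrow> bool" where
  "Td_le_pi p \<xi> \<eta> \<longleftrightarrow>
     (\<forall>U V. openin (cone_topology p) U \<longrightarrow> openin (cone_topology p) V \<longrightarrow>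
        Inr \<xi> \<in> U \<longrightarrow> Inr \<eta> \<in> V \<longrightarrow>
        (\<exists>\<xi>' \<eta>'. Inr \<xi>' \<in> U \<and> Inr \<eta>' \<in> V \<and> Td_less_pi p \<xi>' \<eta>'))"

definition Td_ge_pi :: "'a::metric_space \<Rightarrow> 'a ideal_point \<Rightarrow> 'a ideal_point \<Rightarrow> bool" where
  "Td_ge_pi p \<xi> \<eta> \<longleftrightarrow> \<not> Td_less_pi p \<xi> \<eta>"

definition Td_eq_pi :: "'a::metric_space \<Rightarrow> 'a ideal_point \<Rightarrow> 'a ideal_point \<Rightarrow> bool" where
  "Td_eq_pi p \<xi> \<eta> \<longleftrightarrow> Td_ge_pi p \<xi> \<eta> \<and> Td_le_pi p \<xi> \<eta>"


section \<open>Normed semiplanes\<close>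

text \<open>A two-dimensional normed space is \<open>\<real>\<^sup>2\<close> with an arbitrary norm \<open>N\<close>. In the half-plane
  \<open>{v. b \<le> u \<bullet> v}\<close> the inner product only serves to write the linear functional; it is
  unrelated to \<open>N\<close>.\<close>

definition is_norm :: "(real^2 \<Rightarrow> real) \<Rightarrow> bool" where
  "is_norm N \<longleftrightarrow>
     (\<forall>v. N v \<ge> 0) \<and> (\<forall>v. N v = 0 \<longleftrightarrow> v = 0) \<and>
     (\<forall>r v. N (r *\<^sub>R v) = \<bar>r\<bar> * N v) \<and> (\<forall>v w. N (v + w) \<le> N v + N w)"

definition semiplane_isometry ::
  "(real^2 \<Rightarrow> real) \<Rightarrow> real^2 \<Rightarrow> real \<Rightarrow> (real^2 \<Rightarrow> 'a::metric_space) \<Rightarrow> 'a set \<Rightarrow> bool" where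
  "semiplane_isometry N u b f S \<longleftrightarrow> is_norm N \<and> u \<noteq> 0 \<and> f ` {v. b \<le> u \<bullet> v} = S \<and>
     (\<forall>v\<in>{v. b \<le> u \<bullet> v}. \<forall>w\<in>{v. b \<le> u \<bullet> v}. dist (f v) (f w) = N (v - w))"

definition normed_semiplane :: "'a::metric_space set \<Rightarrow> bool" where
  "normed_semiplane S \<longleftrightarrow> (\<exists>N u b f. semiplane_isometry N u b f S)"

definition bounds_normed_semiplane :: "(real \<Rightarrow> 'a::metric_space) \<Rightarrow> 'a set \<Rightarrow> bool" where
  "bounds_normed_semiplane a S \<longleftrightarrow>
     (\<exists>N u b f. semiplane_isometry N u b f S \<and> range a = f ` {v. u \<bullet> v = b})"

end

theory Submission
  imports Defs
begin

text \<open>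
  Limits along ultrafilters replace the selection of subsequences throughout. Since distance balls
  in a Busemann space are strictly convex, a horofunction has a unique gradient ray from each point;
  sending a horofunction to the class of its gradient ray from \<open>p\<close> is the continuous extension of
  the identity, and the horofunction is centered in that class.

  (1) implies (2): if \<open>\<xi>\<^sub>n \<rightarrow> \<xi>\<close>, \<open>\<eta>\<^sub>n \<rightarrow> \<eta>\<close> and \<open>\<delta>(\<xi>\<^sub>n, \<eta>\<^sub>n) < 1\<close>, then points \<open>x\<^sub>n\<close>, \<open>y\<^sub>n\<close> at the same large
  distance from \<open>p\<close> on \<open>[p\<xi>\<^sub>n]\<close>, \<open>[p\<eta>\<^sub>n]\<close> have a midpoint far from \<open>p\<close>, which lies in the balls
  around \<open>x\<^sub>n\<close> and \<open>y\<^sub>n\<close> through \<open>p\<close>; the horofunctions are limits of the distances to \<open>x\<^sub>n\<close>, \<open>y\<^sub>n\<close>.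

  (2) implies (3): for a point \<open>z\<close> of both horoballs, follow the gradient rays \<open>z\<^sup>+\<close> of \<open>\<Phi>\<close> and
  \<open>z\<^sup>-\<close> of \<open>\<Psi>\<close> from \<open>z\<close>. Whenever the midpoints of \<open>[z\<^sup>-(t) z\<^sup>+(t)]\<close> stay bounded as \<open>t \<rightarrow> \<infinity>\<close>, where
  \<open>z\<close> may vary with \<open>t\<close>, these segments converge to a line on which \<open>\<Phi>\<close> and \<open>\<Psi>\<close> are affine of slopes
  \<open>-1\<close> and \<open>1\<close>, hence to a parallel of \<open>a\<close>. The midpoint moves continuously from \<open>z\<close>, so it can be kept
  away from \<open>p\<close>, and \<open>a\<close> has parallels at arbitrarily large distance. Two parallels bound a flat
  normed strip, and wide strips converge to a half-plane.

  (3) implies (1): the norm of the half-plane is strictly convex because geodesics are unique, so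
  rays of the half-plane that point slightly inwards satisfy \<open>Td < \<pi>\<close>.
\<close>


section \<open>Ultrafilters\<close>

text \<open>One ultrafilter yields uncountably many limits at once (every parameter of a ray, every
  argument of a horofunction, every vector of a norm), so no diagonal sequences occur. A Busemann
  space offers neither angles nor inner products. What replaces them is that distances between
  geodesics and horofunctions are convex, and that a convex function bounded above on a line is
  constant; this turns the one-sided bounds which survive a limit into exact slopes and constant
  distances. In (2) implies (3) the midpoints belonging to a fixed \<open>z\<close> may drift back
  towards \<open>p\<close>, so the time has to depend on \<open>z\<close>. A second danger is that
  lines far from \<open>p\<close> at parameter 0 approach it elsewhere and the limit of the strip
  norms degenerates; the bound by half of \<open>dist p (\<gamma> 0)\<close> excludes this. For the
  ends of a line the divergence quotient is constantly 1, so \<open>Td_ge_pi\<close> is automatic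
  and the content of (1) is \<open>Td_le_pi\<close>. Since \<open>horo_to_geodesic\<close> is given
  by choice, existence and uniqueness of the extension come first; afterwards centers are handled
  only through \<open>centered_in_iff\<close>.\<close>

definition ultrafilter :: "'b filter \<Rightarrow> bool" where
  "ultrafilter F \<longleftrightarrow> F \<noteq> bot \<and> (\<forall>P. eventually P F \<or> eventually (\<lambda>x. \<not> P x) F)"

lemma ultrafilter_nontrivial: "ultrafilter F \<Longrightarrow> F \<noteq> bot"
  unfolding ultrafilter_def by blast

text \<open>Zorn's lemma for the proper filters below \<open>G\<close>, ordered so that a maximal
  element is a finest filter. A chain is a filter base, hence its infimum is still proper.\<close>

lemma ultrafilter_below:
  assumes "G \<noteq> bot"
  shows "\<exists>F\<le>G. ultrafilter F"
proof -
  let ?A = "{F. F \<noteq> bot \<and> F \<le> G}"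
  have "\<exists>M\<in>?A. \<forall>F\<in>?A. M \<ge> F \<longrightarrow> F = M"
  proof (rule predicate_Zorn)
    show "partial_order_on ?A (relation_of (\<ge>) ?A)"
      by (rule partial_order_on_relation_ofI) auto
    fix C assume C: "C \<in> Chains (relation_of (\<ge>) ?A)"
    have CA: "F \<noteq> bot" "F \<le> G" if "F \<in> C" for F
      using C that unfolding Chains_def relation_of_def by auto
    have total: "F \<le> F' \<or> F' \<le> F" if "F \<in> C" "F' \<in> C" for F F'
      using C that unfolding Chains_def relation_of_def by auto
    show "\<exists>u\<in>?A. \<forall>F\<in>C. F \<ge> u"
    proof (cases "C = {}")
      case True
      then show ?thesis using assms by blast
    next
      case False
      have base: "\<exists>x\<in>C. x \<le> inf F F'" if "F \<in> C" "F' \<in> C" for F F'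
        using total[OF that] that by (metis inf.order_iff inf_commute order_refl)
      have "\<not> eventually (\<lambda>x. False) (Inf C)"
        using eventually_Inf_base[OF False base, of "\<lambda>x. False"] CA(1)
        by (auto simp: trivial_limit_def)
      then have "Inf C \<noteq> bot" by (auto simp: trivial_limit_def)
      moreover have "Inf C \<le> G"
        using False CA(2) by (meson Inf_lower all_not_in_conv order_trans)
      ultimately show ?thesis by (auto intro: Inf_lower)
    qed
  qed
  then obtain M where M: "M \<noteq> bot" "M \<le> G"
    and max: "\<And>F. F \<noteq> bot \<Longrightarrow> F \<le> G \<Longrightarrow> F \<le> M \<Longrightarrow> F = M" by auto
  \<comment> \<open>If the negation of \<open>P\<close> does not hold eventually, adding
    \<open>P\<close> to \<open>M\<close> keeps it proper, and by extremality \<open>M\<close>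
    already contained \<open>P\<close>.\<close>
  have "eventually P M \<or> eventually (\<lambda>x. \<not> P x) M" for P
  proof (rule disjCI)
    assume "\<not> eventually (\<lambda>x. \<not> P x) M"
    then have "inf M (principal {x. P x}) \<noteq> bot"
      by (simp add: trivial_limit_def eventually_inf_principal)
    then have "inf M (principal {x. P x}) = M"
      by (rule max) (use M(2) in \<open>auto intro: le_infI1\<close>)
    moreover have "eventually P (inf M (principal {x. P x}))"
      by (simp add: eventually_inf_principal)
    ultimately show "eventually P M" by simp
  qed
  then show ?thesis using M unfolding ultrafilter_def by blast
qed

text \<open>Compactness supplies a cluster point, and an ultrafilter converges to each of its
  cluster points.\<close>

lemma ultrafilter_compact_limit:
  assumes F: "ultrafilter F" and "compact K" and "\<forall>\<^sub>F n in F. X n \<in> K"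
  shows "\<exists>l\<in>K. (X \<longlongrightarrow> l) F"
proof -
  have "filtermap X F \<noteq> bot"
    using ultrafilter_nontrivial[OF F] by (simp add: filtermap_bot_iff)
  moreover have "eventually (\<lambda>x. x \<in> K) (filtermap X F)"
    using assms(3) by (simp add: eventually_filtermap)
  ultimately obtain l where l: "l \<in> K" "inf (nhds l) (filtermap X F) \<noteq> bot"
    using assms(2) unfolding compact_filter by blast
  have "eventually (\<lambda>n. X n \<in> S) F" if S: "open S" "l \<in> S" for S
  proof (rule ccontr)
    assume "\<not> ?thesis"
    then have "eventually (\<lambda>n. X n \<notin> S) F" using F unfolding ultrafilter_def by blast
    then have "eventually (\<lambda>x. x \<notin> S) (filtermap X F)" by (simp add: eventually_filtermap)
    moreover have "eventually (\<lambda>x. x \<in> S) (nhds l)" using S by (auto simp: eventually_nhds)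
    ultimately have "eventually (\<lambda>x. False) (inf (nhds l) (filtermap X F))"
      unfolding eventually_inf by (metis (mono_tags))
    then show False using l(2) by (simp add: trivial_limit_def)
  qed
  then show ?thesis using l(1) by (auto simp: tendsto_def)
qed

text \<open>The way back from ultrafilters to sequences: if the limit failed at an open
  \<open>S\<close>, some ultrafilter below \<open>G\<close> would live outside
  \<open>S\<close>.\<close>

lemma tendsto_if_ultrafilters:
  assumes "\<And>F. F \<le> G \<Longrightarrow> ultrafilter F \<Longrightarrow> (X \<longlongrightarrow> l) F"
  shows "(X \<longlongrightarrow> l) G"
proof (rule topological_tendstoI, rule ccontr)
  fix S assume S: "open S" "l \<in> S" and not: "\<not> eventually (\<lambda>n. X n \<in> S) G"
  have "inf G (principal {n. X n \<notin> S}) \<noteq> bot"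
    using not by (simp add: trivial_limit_def eventually_inf_principal)
  then obtain F where F: "F \<le> inf G (principal {n. X n \<notin> S})" "ultrafilter F"
    using ultrafilter_below by blast
  have "(X \<longlongrightarrow> l) F" using assms F by auto
  then have "eventually (\<lambda>n. X n \<in> S) F" using S by (rule topological_tendstoD)
  moreover have "eventually (\<lambda>n. X n \<notin> S) F"
    using F(1) by (rule filter_leD) (simp add: eventually_inf_principal)
  ultimately have "eventually (\<lambda>n. False) F" by eventually_elim simp
  then show False using ultrafilter_nontrivial[OF F(2)] by (simp add: trivial_limit_def)
qed

lemma ultrafilter_unbounded:
  fixes r :: "'b \<Rightarrow> real"
  assumes F: "ultrafilter F" and "\<And>R. \<not> (\<forall>\<^sub>F n in F. r n \<le> R)"
  shows "filterlim r at_top F"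
  unfolding filterlim_at_top
proof
  fix R
  have "\<forall>\<^sub>F n in F. \<not> r n \<le> R" using F assms(2) unfolding ultrafilter_def by blast
  then show "\<forall>\<^sub>F n in F. R \<le> r n" by eventually_elim simp
qed


section \<open>Convex functions on the line\<close>

lemma convex_on_real_ineq:
  fixes f :: "real \<Rightarrow> real"
  assumes "convex_on S f" "x \<in> S" "z \<in> S" "x \<le> y" "y \<le> z"
  shows "(z - x) * f y \<le> (z - y) * f x + (y - x) * f z"
proof (cases "x = z")
  case True
  then show ?thesis using assms by simp
next
  case False
  then have xz: "x < z" using assms by simp
  define u where "u = (y - x) / (z - x)"
  have u: "0 \<le> u" "u \<le> 1" using xz assms(4,5) by (auto simp: u_def field_simps)
  have "u * (z - x) = y - x" using xz by (simp add: u_def)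
  then have y: "y = (1 - u) * x + u * z" by (simp add: algebra_simps)
  have "f ((1 - u) *\<^sub>R x + u *\<^sub>R z) \<le> (1 - u) * f x + u * f z"
    by (rule convex_onD[OF assms(1)]) (use u assms in auto)
  then have "f y \<le> (1 - u) * f x + u * f z" by (simp add: y)
  then have "(z - x) * f y \<le> (z - x) * ((1 - u) * f x + u * f z)"
    by (rule mult_left_mono) (use xz in simp)
  also have "\<dots> = (z - x - (z - x) * u) * f x + ((z - x) * u) * f z" by (simp add: algebra_simps)
  also have "(z - x) * u = y - x" using xz by (simp add: u_def)
  finally show ?thesis by (simp add: algebra_simps)
qed

text \<open>A rise of slope \<open>k > 0\<close> between \<open>s\<close> and \<open>t\<close>
  persists by convexity and would exceed \<open>B\<close>.\<close>

lemma convex_bounded_above_antimono: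
  fixes f :: "real \<Rightarrow> real"
  assumes cv: "convex_on {c..} f" and bd: "\<And>t. t \<ge> c \<Longrightarrow> f t \<le> B" and "c \<le> s" "s \<le> t"
  shows "f t \<le> f s"
proof (rule ccontr)
  assume "\<not> f t \<le> f s"
  then have lt: "f s < f t" by simp
  then have st: "s < t" using assms(4) by (cases "s = t") auto
  define k where "k = (f t - f s) / (t - s)"
  have k: "k > 0" using lt st by (simp add: k_def)
  \<comment> \<open>Beyond the point where the line of slope \<open>k\<close> through
    \<open>(s, f s)\<close> reaches height \<open>B\<close>.\<close>
  define u where "u = max t (s + (B - f s) / k + 1)"
  have u: "u \<ge> t" "u \<ge> c" "u > s + (B - f s) / k" using assms st by (auto simp: u_def)
  have "(u - s) * f t \<le> (u - t) * f s + (t - s) * f u"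
    by (rule convex_on_real_ineq[OF cv]) (use assms u in auto)
  then have "(u - s) * (f t - f s) \<le> (t - s) * (f u - f s)" by (simp add: algebra_simps)
  also have "\<dots> \<le> (t - s) * (B - f s)" using bd[OF u(2)] st by (intro mult_left_mono) auto
  finally have "(u - s) * k \<le> B - f s" using st by (simp add: k_def field_simps)
  moreover have "(u - s) * k > B - f s" using u(3) k by (simp add: field_simps)
  ultimately show False by simp
qed

lemma convex_bounded_above_constant:
  fixes f :: "real \<Rightarrow> real"
  assumes cv: "convex_on UNIV f" and bd: "\<And>t. f t \<le> B"
  shows "f s = f t"
proof -
  have *: "f t \<le> f s" if "s \<le> t" for s t
    by (rule convex_bounded_above_antimono[of s f B])
      (use that bd convex_on_subset[OF cv] in auto)
  have **: "f s \<le> f t" if "s \<le> t" for s t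
  proof -
    have "convex_on UNIV (\<lambda>t. f (- t))"
    proof (rule convex_onI)
      fix u x y :: real assume "0 < u" "u < 1"
      then show "f (- ((1 - u) *\<^sub>R x + u *\<^sub>R y)) \<le> (1 - u) * f (- x) + u * f (- y)"
        using convex_onD[OF cv, of u "- x" "- y"] by (simp add: algebra_simps)
    qed simp
    then have "convex_on {- t..} (\<lambda>t. f (- t))" by (rule convex_on_subset) auto
    then have "f (- (- s)) \<le> f (- (- t))"
      by (rule convex_bounded_above_antimono[where B = B]) (use that bd in auto)
    then show ?thesis by simp
  qed
  show ?thesis using *[of s t] **[of s t] *[of t s] **[of t s] by linarith
qed

section \<open>Geodesics in proper Busemann spaces\<close>

text \<open>The parameter is a fraction of the length, so that segments of different lengths can be
  compared at the same \<open>l\<close>; only values in \<open>[0, 1]\<close> are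
  meaningful.\<close>

definition point_at :: "'a::metric_space \<Rightarrow> 'a \<Rightarrow> real \<Rightarrow> 'a" where
  "point_at x y l = segment_to x y (l * dist x y)"

locale proper_busemann =
  fixes T :: "'a::metric_space itself"
  assumes proper: "proper_space TYPE('a)" and busemann: "busemann_space TYPE('a)"
begin

lemma compact_cball: "compact (cball (x :: 'a) r)"
  using proper unfolding proper_space_def by blast

lemma ultrafilter_limit:
  fixes X :: "'b \<Rightarrow> 'a"
  assumes "ultrafilter F" "\<forall>\<^sub>F n in F. dist x (X n) \<le> R"
  shows "\<exists>l. (X \<longlongrightarrow> l) F"
  using ultrafilter_compact_limit[OF assms(1) compact_cball[of x R]] assms(2) by auto

lemma segment_between_segment_to: "segment_between x y (segment_to x (y :: 'a))"
  using busemann unfolding busemann_space_def geodesic_space_def segment_to_def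
  by (metis someI_ex)

lemma point_at_0 [simp]: "point_at x (y :: 'a) 0 = x"
  and point_at_1 [simp]: "point_at x (y :: 'a) 1 = y"
  using segment_between_segment_to[of x y] by (auto simp: segment_between_def point_at_def)

lemma dist_point_at:
  assumes "0 \<le> s" "s \<le> 1" "0 \<le> t" "t \<le> 1"
  shows "dist (point_at x (y :: 'a) s) (point_at x y t) = \<bar>s - t\<bar> * dist x y"
proof -
  have *: "r * dist x y \<in> {0..dist x y}" if "0 \<le> r" "r \<le> 1" for r
    using that by (auto simp: mult_left_le_one_le)
  have "dist (point_at x y s) (point_at x y t) = \<bar>s * dist x y - t * dist x y\<bar>"
    using segment_between_segment_to[of x y] *[of s] *[of t] assms
    unfolding segment_between_def distance_preserving_on_def point_at_def by blast
  also have "\<dots> = \<bar>s - t\<bar> * dist x y"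
    by (simp add: left_diff_distrib[symmetric] abs_mult)
  finally show ?thesis .
qed

lemma dist_point_at_left:
  "0 \<le> s \<Longrightarrow> s \<le> 1 \<Longrightarrow> dist x (point_at x (y :: 'a) s) = s * dist x y"
  using dist_point_at[of 0 s x y] by simp

lemma dist_point_at_right:
  "0 \<le> s \<Longrightarrow> s \<le> 1 \<Longrightarrow> dist (point_at x (y :: 'a) s) y = (1 - s) * dist x y"
  using dist_point_at[of s 1 x y] by simp

lemma point_at_same [simp]: "0 \<le> s \<Longrightarrow> s \<le> 1 \<Longrightarrow> point_at x x s = (x :: 'a)"
  using dist_point_at_left[of s x x] by simp

lemma affine_segment_point_at: "affine_segment 0 1 (point_at x (y :: 'a))"
  unfolding affine_segment_def using dist_point_at
  by (intro conjI exI[of _ "dist x y"]) (auto simp: mult.commute)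

lemma dist_affine_segments_convex:
  fixes \<gamma> \<gamma>' :: "real \<Rightarrow> 'a"
  assumes "affine_segment a b \<gamma>" "affine_segment a b \<gamma>'" "a \<le> s" "s \<le> t" "t \<le> b" "0 \<le> l" "l \<le> 1"
  shows "dist (\<gamma> ((1 - l) * s + l * t)) (\<gamma>' ((1 - l) * s + l * t))
    \<le> (1 - l) * dist (\<gamma> s) (\<gamma>' s) + l * dist (\<gamma> t) (\<gamma>' t)"
proof -
  have "convex_on ({a..b} \<times> {a..b}) (\<lambda>(t, t'). dist (\<gamma> t) (\<gamma>' t'))"
    using busemann assms(1,2) unfolding busemann_space_def by blast
  from convex_onD[OF this, of l "(s, s)" "(t, t)"] assms(3-) show ?thesis by simp
qed

text \<open>The Busemann condition on the diagonal of the parameter square; nearly all later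
  estimates use it in this form.\<close>

lemma point_at_contract:
  assumes "0 \<le> l" "l \<le> 1"
  shows "dist (point_at x y l) (point_at x' y' l) \<le> (1 - l) * dist x x' + l * dist y (y' :: 'a)"
  using dist_affine_segments_convex[OF affine_segment_point_at[of x y]
      affine_segment_point_at[of x' y'], of 0 1 l] assms by simp

lemma dist_point_at_convex:
  assumes "0 \<le> l" "l \<le> 1"
  shows "dist (point_at x y l) z \<le> (1 - l) * dist x z + l * dist y (z :: 'a)"
  using point_at_contract[OF assms, of x y z z] assms by simp

lemma affine_segments_unique:
  fixes \<gamma> \<gamma>' :: "real \<Rightarrow> 'a"
  assumes "affine_segment 0 1 \<gamma>" "affine_segment 0 1 \<gamma>'" "\<gamma> 0 = \<gamma>' 0" "\<gamma> 1 = \<gamma>' 1" "0 \<le> l" "l \<le> 1"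
  shows "\<gamma> l = \<gamma>' l"
  using dist_affine_segments_convex[OF assms(1,2), of 0 1 l] assms(3-) by simp

text \<open>The triangle inequality turns both bounds into equalities, so \<open>[xq]\<close>
  followed by \<open>[qy]\<close> is a geodesic from \<open>x\<close> to \<open>y\<close>, and
  geodesics are unique. Bounds are assumed because estimates deliver only bounds.\<close>

lemma point_at_unique:
  assumes l: "0 \<le> l" "l \<le> 1" and xq: "dist x q \<le> l * dist x y" and qy: "dist q y \<le> (1 - l) * dist x y"
  shows "q = point_at x (y :: 'a) l"
proof (cases "l = 0 \<or> l = 1")
  case True
  then show ?thesis using xq qy by auto
next
  case False
  then have l: "0 < l" "l < 1" using l by auto
  define d where "d = dist x y"
  have d: "d \<le> dist x q + dist q y" using dist_triangle[of x y q] by (simp add: d_def)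
  have eq: "dist x q = l * d" "dist q y = (1 - l) * d"
    using xq qy d by (auto simp: d_def algebra_simps)
  define \<gamma> where "\<gamma> t = (if t \<le> l then point_at x q (t / l) else point_at q y ((t - l) / (1 - l)))" for t
  have x\<gamma>: "dist x (\<gamma> t) \<le> t * d" if t: "0 \<le> t" "t \<le> 1" for t
  proof (cases "t \<le> l")
    case True
    then show ?thesis using t l eq dist_point_at_left[of "t / l" x q] by (simp add: \<gamma>_def)
  next
    case False
    then have "dist q (\<gamma> t) = (t - l) * d"
      using t l eq dist_point_at_left[of "(t - l) / (1 - l)" q y] by (simp add: \<gamma>_def)
    then show ?thesis using dist_triangle[of x "\<gamma> t" q] eq by (simp add: algebra_simps)
  qed
  have \<gamma>y: "dist (\<gamma> t) y \<le> (1 - t) * d" if t: "0 \<le> t" "t \<le> 1" for t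
  proof (cases "t \<le> l")
    case True
    then have "dist (\<gamma> t) q = (1 - t / l) * (l * d)"
      using t l eq dist_point_at_right[of "t / l" x q] by (simp add: \<gamma>_def)
    also have "\<dots> = (l - t) * d" using l by (simp add: field_simps)
    finally show ?thesis using dist_triangle[of "\<gamma> t" y q] eq by (simp add: algebra_simps)
  next
    case False
    then have "dist (\<gamma> t) y = (1 - (t - l) / (1 - l)) * ((1 - l) * d)"
      using t l eq dist_point_at_right[of "(t - l) / (1 - l)" q y] by (simp add: \<gamma>_def)
    also have "\<dots> = (1 - t) * d" using l by (simp add: field_simps)
    finally show ?thesis by simp
  qed
  have upper: "dist (\<gamma> s) (\<gamma> t) \<le> (t - s) * d" if st: "0 \<le> s" "s \<le> t" "t \<le> 1" for s t
  proof -
    consider "t \<le> l" | "s \<le> l" "l < t" | "l < s" by linarith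
    then show ?thesis
    proof cases
      case 1
      then have "dist (\<gamma> s) (\<gamma> t) = \<bar>s / l - t / l\<bar> * (l * d)"
        using st l eq dist_point_at[of "s / l" "t / l" x q] by (simp add: \<gamma>_def)
      also have "\<bar>s / l - t / l\<bar> = (t - s) / l" using st l by (simp add: field_simps)
      finally show ?thesis using l by simp
    next
      case 2
      have "dist (\<gamma> s) q = (1 - s / l) * (l * d)"
        using 2 st l eq dist_point_at_right[of "s / l" x q] by (simp add: \<gamma>_def)
      also have "\<dots> = (l - s) * d" using l by (simp add: field_simps)
      finally have 3: "dist (\<gamma> s) q = (l - s) * d" .
      have "dist q (\<gamma> t) = (t - l) * d"
        using 2 st l eq dist_point_at_left[of "(t - l) / (1 - l)" q y] by (simp add: \<gamma>_def)
      then show ?thesis using 3 dist_triangle[of "\<gamma> s" "\<gamma> t" q] by (simp add: algebra_simps)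
    next
      case 3
      then have "dist (\<gamma> s) (\<gamma> t) = \<bar>(s - l) / (1 - l) - (t - l) / (1 - l)\<bar> * ((1 - l) * d)"
        using st l eq dist_point_at[of "(s - l) / (1 - l)" "(t - l) / (1 - l)" q y] by (simp add: \<gamma>_def)
      also have "\<bar>(s - l) / (1 - l) - (t - l) / (1 - l)\<bar> = (t - s) / (1 - l)"
        using st l by (simp add: diff_divide_distrib[symmetric])
      finally show ?thesis using l by simp
    qed
  qed
  \<comment> \<open>The upper bounds for the pieces from \<open>x\<close> over
    \<open>\<gamma> s\<close> and \<open>\<gamma> t\<close> to \<open>y\<close> add up to
    \<open>d\<close>, so none of them is strict.\<close>
  have exact: "dist (\<gamma> s) (\<gamma> t) = (t - s) * d" if st: "0 \<le> s" "s \<le> t" "t \<le> 1" for s t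
  proof -
    have "d \<le> dist x (\<gamma> s) + dist (\<gamma> s) (\<gamma> t) + dist (\<gamma> t) y"
      unfolding d_def using dist_triangle[of x y "\<gamma> s"] dist_triangle[of "\<gamma> s" y "\<gamma> t"] by linarith
    then show ?thesis
      using upper[OF st] x\<gamma>[of s] \<gamma>y[of t] st by (simp add: algebra_simps)
  qed
  have "affine_segment 0 1 \<gamma>"
    unfolding affine_segment_def
  proof (intro conjI exI[of _ d] ballI)
    fix s t :: real assume "s \<in> {0..1}" "t \<in> {0..1}"
    then show "dist (\<gamma> s) (\<gamma> t) = d * \<bar>s - t\<bar>"
      using exact[of s t] exact[of t s] by (cases "s \<le> t") (auto simp: dist_commute mult.commute)
  qed (auto simp: d_def)
  moreover have "\<gamma> 0 = x" "\<gamma> 1 = y" "\<gamma> l = q" using l by (auto simp: \<gamma>_def)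
  ultimately show ?thesis
    using affine_segments_unique[OF _ affine_segment_point_at[of x y], of \<gamma> l] l by auto
qed

lemma point_at_swap: "0 \<le> l \<Longrightarrow> l \<le> 1 \<Longrightarrow> point_at y x (1 - l) = point_at x (y :: 'a) l"
  by (rule point_at_unique)
    (auto simp: dist_commute[of x] dist_point_at_right[of "1 - l" y x, simplified]
      dist_point_at_left[of "1 - l" y x, simplified] dist_commute[of _ y])

lemma distance_preserving_point_at:
  fixes c :: "real \<Rightarrow> 'a"
  assumes c: "distance_preserving_on S c" and "s \<in> S" "t \<in> S" "(1 - l) * s + l * t \<in> S" "0 \<le> l" "l \<le> 1"
  shows "c ((1 - l) * s + l * t) = point_at (c s) (c t) l"
proof (rule point_at_unique)
  have d: "dist (c x) (c y) = \<bar>x - y\<bar>" if "x \<in> S" "y \<in> S" for x y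
    using c that unfolding distance_preserving_on_def by blast
  have "s - ((1 - l) * s + l * t) = l * (s - t)" by (simp add: algebra_simps)
  then have "\<bar>s - ((1 - l) * s + l * t)\<bar> = l * \<bar>s - t\<bar>"
    using assms(5) by (simp add: abs_mult)
  then show "dist (c s) (c ((1 - l) * s + l * t)) \<le> l * dist (c s) (c t)"
    using d assms by simp
  have "(1 - l) * s + l * t - t = (1 - l) * (s - t)" by (simp add: algebra_simps)
  then have "\<bar>(1 - l) * s + l * t - t\<bar> = (1 - l) * \<bar>s - t\<bar>"
    using assms(6) by (simp add: abs_mult)
  then show "dist (c ((1 - l) * s + l * t)) (c t) \<le> (1 - l) * dist (c s) (c t)"
    using d assms by simp
qed (use assms in auto)

lemma convex_on_dist_distance_preserving:
  fixes c d :: "real \<Rightarrow> 'a"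
  assumes "distance_preserving_on S c" "distance_preserving_on S d" "convex S"
  shows "convex_on S (\<lambda>t. dist (c t) (d t))"
proof (rule convex_onI)
  fix u x y :: real assume u: "0 < u" "u < 1" and xy: "x \<in> S" "y \<in> S"
  have m: "(1 - u) * x + u * y \<in> S"
    using convexD_alt[OF assms(3) xy, of u] u by simp
  show "dist (c ((1 - u) *\<^sub>R x + u *\<^sub>R y)) (d ((1 - u) *\<^sub>R x + u *\<^sub>R y))
      \<le> (1 - u) * dist (c x) (d x) + u * dist (c y) (d y)"
    using point_at_contract[of u "c x" "c y" "d x" "d y"] u
      distance_preserving_point_at[OF assms(1) xy m] distance_preserving_point_at[OF assms(2) xy m]
    by simp
qed (fact assms(3))

text \<open>If the midpoint \<open>m\<close> of \<open>[yz]\<close> were at the same distance from \<open>p\<close> as \<open>y\<close> and \<open>z\<close>,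
  then \<open>[py]\<close>, \<open>[pm]\<close> and \<open>[pz]\<close> would share their midpoint, which could replace \<open>p\<close>.\<close>

lemma strictly_convex_ball:
  assumes "dist p y \<le> r" "dist p z \<le> r" "r \<le> dist p (point_at y z (1/2))"
  shows "y = (z :: 'a)"
proof -
  have "dist y z \<le> 2 * r / 2 ^ n"
    if "dist p y \<le> r" "dist p z \<le> r" "r \<le> dist p (point_at y z (1/2))" for n p r
    using that
  proof (induction n arbitrary: p r)
    case 0
    then show ?case using dist_triangle[of y z p] by (simp add: dist_commute)
  next
    case (Suc n)
    let ?m = "point_at y z (1/2)"
    have pm: "dist p ?m = r"
      using dist_point_at_convex[of "1/2" y z p] Suc.prems by (simp add: dist_commute)
    have mid: "point_at p y' (1/2) = point_at p ?m (1/2) \<and> dist (point_at p ?m (1/2)) y' \<le> r / 2"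
      if y': "dist p y' \<le> r" "dist p z' \<le> r" "?m = point_at y' z' (1/2)" for y' z'
    proof -
      let ?q = "point_at p y' (1/2)"
      have "?q = point_at y' p (1/2)" using point_at_swap[of "1/2" y' p] by simp
      then have "dist ?q ?m \<le> 1/2 * dist p z'"
        using point_at_contract[of "1/2" y' p y' z'] y'(3) by simp
      then have "?q = point_at p ?m (1/2)"
        by (intro point_at_unique) (use y' pm in \<open>simp_all add: dist_point_at_left\<close>)
      moreover have "dist ?q y' \<le> r / 2" using y' by (simp add: dist_point_at_right)
      ultimately show ?thesis by simp
    qed
    have 1: "dist (point_at p ?m (1/2)) y \<le> r / 2"
      using mid[of y z] Suc.prems by simp
    have 2: "dist (point_at p ?m (1/2)) z \<le> r / 2"
      using mid[of z y] Suc.prems point_at_swap[of "1/2" y z] by simp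
    have "r / 2 \<le> dist (point_at p ?m (1/2)) ?m"
      using pm by (simp add: dist_point_at_right)
    from Suc.IH[OF 1 2 this] show ?case by simp
  qed
  then have *: "dist y z \<le> 2 * r / 2 ^ n" for n using assms by blast
  have "(\<lambda>n. 2 * r / 2 ^ n) \<longlonglongrightarrow> 0"
    using tendsto_mult_right_zero[OF LIMSEQ_realpow_zero[of "1/2"], of "2 * r"]
    by (simp add: power_divide)
  then have "dist y z \<le> 0" by (rule LIMSEQ_le_const) (use * in auto)
  then show ?thesis by simp
qed

end

section \<open>Rays and asymptoticity\<close>

lemma ray_dist: "ray c \<Longrightarrow> 0 \<le> s \<Longrightarrow> 0 \<le> t \<Longrightarrow> dist (c s) (c t) = \<bar>s - t\<bar>"
  unfolding ray_def distance_preserving_on_def by auto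

lemma ray_dist_0: "ray c \<Longrightarrow> 0 \<le> t \<Longrightarrow> dist (c 0) (c t) = t"
  using ray_dist[of c 0 t] by simp

text \<open>Hausdorff closeness pairs \<open>c t\<close> with some \<open>d s\<close>. Both
  parameters measure distances from the starting points, so \<open>\<bar>s - t\<bar>\<close> is
  bounded and \<open>d s\<close> may be replaced by \<open>d t\<close>.\<close>

lemma asymptotic_iff_bounded:
  fixes c d :: "real \<Rightarrow> 'a::metric_space"
  assumes c: "ray c" and d: "ray d"
  shows "asymptotic c d \<longleftrightarrow> (\<exists>B. \<forall>t\<ge>0. dist (c t) (d t) \<le> B)"
proof
  assume "asymptotic c d"
  then have "hausdorff_distance (c ` {0..}) (d ` {0..}) < top" unfolding asymptotic_def by simp
  then obtain B where B: "0 \<le> B" "hausdorff_distance (c ` {0..}) (d ` {0..}) = ennreal B"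
    using less_top_ennreal by blast
  have "dist (c t) (d t) \<le> 2 * (B + 1) + dist (c 0) (d 0)" if t: "t \<ge> 0" for t
  proof -
    have "(INF y\<in>d ` {0..}. ennreal (dist (c t) y)) \<le> hausdorff_distance (c ` {0..}) (d ` {0..})"
      unfolding hausdorff_distance_def using t by (intro max.coboundedI1 SUP_upper) auto
    also have "\<dots> < ennreal (B + 1)" using B by (simp add: ennreal_less_iff)
    finally obtain s where s: "s \<ge> 0" "ennreal (dist (c t) (d s)) < ennreal (B + 1)"
      unfolding INF_less_iff by auto
    then have cs: "dist (c t) (d s) < B + 1" by (simp add: ennreal_less_iff)
    have "\<bar>s - t\<bar> \<le> B + 1 + dist (c 0) (d 0)"
      using dist_triangle[of "c 0" "c t" "d 0"] dist_triangle[of "d 0" "c t" "d s"]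
        dist_triangle[of "d 0" "d s" "c 0"] dist_triangle[of "c 0" "d s" "c t"]
        ray_dist_0[OF c t] ray_dist_0[OF d s(1)] cs
      by (simp add: dist_commute)
    then have "dist (d s) (d t) \<le> B + 1 + dist (c 0) (d 0)" using ray_dist[OF d s(1) t] by simp
    then show ?thesis using dist_triangle[of "c t" "d t" "d s"] cs by (simp add: algebra_simps)
  qed
  then show "\<exists>B. \<forall>t\<ge>0. dist (c t) (d t) \<le> B" by blast
next
  assume "\<exists>B. \<forall>t\<ge>0. dist (c t) (d t) \<le> B"
  then obtain B where B: "\<And>t. t \<ge> 0 \<Longrightarrow> dist (c t) (d t) \<le> B" by blast
  have "(INF y\<in>d ` {0..}. ennreal (dist x y)) \<le> ennreal B" if "x \<in> c ` {0..}" for x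
    using that B by (auto intro!: INF_lower2 ennreal_leI)
  moreover have "(INF x\<in>c ` {0..}. ennreal (dist x y)) \<le> ennreal B" if "y \<in> d ` {0..}" for y
    using that B by (auto intro!: INF_lower2 ennreal_leI)
  ultimately have "hausdorff_distance (c ` {0..}) (d ` {0..}) \<le> ennreal B"
    unfolding hausdorff_distance_def by (simp add: SUP_le_iff)
  then show "asymptotic c d"
    unfolding asymptotic_def using le_less_trans ennreal_less_top by (metis infinity_ennreal_def)
qed

lemma ray_class_eq_iff:
  fixes c d :: "real \<Rightarrow> 'a::metric_space"
  assumes c: "ray c" and d: "ray d"
  shows "ray_class c = ray_class d \<longleftrightarrow> asymptotic c d"
proof
  have "asymptotic d d" using asymptotic_iff_bounded[OF d d] by auto
  moreover assume "ray_class c = ray_class d"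
  ultimately show "asymptotic c d" using d unfolding ray_class_def by blast
next
  assume "asymptotic c d"
  then obtain B where B: "\<And>t. t \<ge> 0 \<Longrightarrow> dist (c t) (d t) \<le> B"
    using asymptotic_iff_bounded[OF c d] by blast
  have "asymptotic c e \<longleftrightarrow> asymptotic d e" if e: "ray e" for e
  proof -
    have "dist (d t) (e t) \<le> B + C" if "t \<ge> 0" "dist (c t) (e t) \<le> C" for t C
      using that B[of t] dist_triangle[of "d t" "e t" "c t"] by (simp add: dist_commute)
    moreover have "dist (c t) (e t) \<le> B + C" if "t \<ge> 0" "dist (d t) (e t) \<le> C" for t C
      using that B[of t] dist_triangle[of "c t" "e t" "d t"] by simp
    ultimately show ?thesis
      unfolding asymptotic_iff_bounded[OF c e] asymptotic_iff_bounded[OF d e] by blast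
  qed
  then show "ray_class c = ray_class d" unfolding ray_class_def by blast
qed

lemma filterlim_dist_at_top:
  fixes X :: "'b \<Rightarrow> 'a::metric_space"
  assumes "filterlim (\<lambda>n. dist z (X n)) at_top F"
  shows "filterlim (\<lambda>n. dist y (X n)) at_top F"
proof (rule filterlim_at_top_mono)
  show "filterlim (\<lambda>n. - dist y z + dist z (X n)) at_top F"
    by (rule filterlim_tendsto_add_at_top[OF tendsto_const assms])
  show "\<forall>\<^sub>F n in F. - dist y z + dist z (X n) \<le> dist y (X n)"
  proof (intro always_eventually allI)
    fix n show "- dist y z + dist z (X n) \<le> dist y (X n)"
      using dist_triangle[of z "X n" y] by (simp add: dist_commute)
  qed
qed

context proper_busemann
begin

text \<open>The segments from \<open>c 0\<close> to \<open>X n\<close> are read at arc length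
  \<open>t\<close>. The fraction is at most 1 as soon as \<open>X n\<close> is farther away than
  \<open>t\<close>.\<close>

definition ray_limit :: "'b filter \<Rightarrow> ('b \<Rightarrow> 'a) \<Rightarrow> (real \<Rightarrow> 'a) \<Rightarrow> bool" where
  "ray_limit F X c \<longleftrightarrow>
     (\<forall>t\<ge>0. ((\<lambda>n. point_at (c 0) (X n) (t / dist (c 0) (X n))) \<longlongrightarrow> c t) F)"

lemma ray_limit_exists:
  assumes F: "ultrafilter F" and X: "filterlim (\<lambda>n. dist z (X n)) at_top F"
  shows "\<exists>c. ray c \<and> c 0 = z \<and> ray_limit F X c"
proof -
  let ?f = "\<lambda>t n. point_at z (X n) (t / dist z (X n))"
  have ev: "\<forall>\<^sub>F n in F. dist z (X n) > 0 \<and> t \<le> dist z (X n)" for t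
    using filterlim_at_top_dense[THEN iffD1, OF X, rule_format, of "max 0 t"]
    by (rule eventually_mono) auto
  have "\<exists>l. (?f t \<longlongrightarrow> l) F" if "t \<ge> 0" for t
  proof (rule ultrafilter_limit[OF F, of z _ t])
    show "\<forall>\<^sub>F n in F. dist z (?f t n) \<le> t"
      using ev[of t] by eventually_elim (use that in \<open>simp add: dist_point_at_left\<close>)
  qed
  then obtain c where c: "\<And>t. t \<ge> 0 \<Longrightarrow> (?f t \<longlongrightarrow> c t) F" by metis
  have "dist (c s) (c t) = \<bar>s - t\<bar>" if "s \<ge> 0" "t \<ge> 0" for s t
  proof (rule tendsto_unique[OF ultrafilter_nontrivial[OF F]])
    show "((\<lambda>n. dist (?f s n) (?f t n)) \<longlongrightarrow> dist (c s) (c t)) F"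
      using c that by (intro tendsto_dist) auto
    have "\<forall>\<^sub>F n in F. \<bar>s - t\<bar> = dist (?f s n) (?f t n)"
      using ev[of "max s t"]
    proof eventually_elim
      case (elim n)
      then have "dist (?f s n) (?f t n) = \<bar>s / dist z (X n) - t / dist z (X n)\<bar> * dist z (X n)"
        using that by (intro dist_point_at) auto
      also have "s / dist z (X n) - t / dist z (X n) = (s - t) / dist z (X n)"
        by (simp add: diff_divide_distrib)
      finally show ?case using elim by (simp add: abs_divide)
    qed
    then show "((\<lambda>n. dist (?f s n) (?f t n)) \<longlongrightarrow> \<bar>s - t\<bar>) F"
      by (rule Lim_transform_eventually[OF tendsto_const])
  qed
  moreover have "(?f 0 \<longlongrightarrow> z) F" by simp
  then have "c 0 = z" using tendsto_unique[OF ultrafilter_nontrivial[OF F] c[of 0]] by simp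
  ultimately show ?thesis
    using c unfolding ray_def distance_preserving_on_def ray_limit_def
    by (intro exI[of _ c]) auto
qed

text \<open>First the same fraction on both segments is compared, then the same arc length on the
  second one. Either move costs at most \<open>dist (c 0) (d 0)\<close>, whence the factor 2, which
  \<open>bounded_rays_close\<close> removes later.\<close>

lemma ray_limits_close:
  assumes F: "ultrafilter F" and X: "filterlim (\<lambda>n. dist (c 0) (X n)) at_top F"
    and c: "ray_limit F X c" and d: "ray_limit F X d" and t: "t \<ge> 0"
  shows "dist (c t) (d t) \<le> 2 * dist (c 0) (d 0)"
proof (rule tendsto_le[OF ultrafilter_nontrivial[OF F] tendsto_const])
  let ?f = "\<lambda>c n. point_at (c 0) (X n) (t / dist (c 0) (X n))"
  show "((\<lambda>n. dist (?f c n) (?f d n)) \<longlongrightarrow> dist (c t) (d t)) F"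
    using c d t unfolding ray_limit_def by (intro tendsto_dist) auto
  have X': "filterlim (\<lambda>n. dist (d 0) (X n)) at_top F" by (rule filterlim_dist_at_top[OF X])
  have "\<forall>\<^sub>F n in F. max 0 t < dist (c 0) (X n)" "\<forall>\<^sub>F n in F. max 0 t < dist (d 0) (X n)"
    using X X' unfolding filterlim_at_top_dense by blast+
  then show "\<forall>\<^sub>F n in F. dist (?f c n) (?f d n) \<le> 2 * dist (c 0) (d 0)"
  proof eventually_elim
    case (elim n)
    let ?L = "dist (c 0) (X n)" and ?L' = "dist (d 0) (X n)"
    have L: "?L > 0" "?L' > 0" using elim t by linarith+
    have q: "0 \<le> t / ?L" "t / ?L \<le> 1" "0 \<le> t / ?L'" "t / ?L' \<le> 1"
      using L elim t by (simp_all only: divide_le_eq_1_pos divide_nonneg_pos max_less_iff_conj less_imp_le)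
    have 1: "dist (?f c n) (point_at (d 0) (X n) (t / ?L)) \<le> (1 - t / ?L) * dist (c 0) (d 0)"
      using point_at_contract[OF q(1,2), of "c 0" "X n" "d 0" "X n"] by simp
    also have "\<dots> \<le> 1 * dist (c 0) (d 0)" using elim t by (intro mult_right_mono) auto
    finally have 1: "dist (?f c n) (point_at (d 0) (X n) (t / ?L)) \<le> dist (c 0) (d 0)" by simp
    have "dist (point_at (d 0) (X n) (t / ?L)) (?f d n) = \<bar>t / ?L - t / ?L'\<bar> * ?L'"
      by (rule dist_point_at[OF q])
    also have "\<dots> = \<bar>(t / ?L - t / ?L') * ?L'\<bar>" using elim by (simp add: abs_mult)
    also have "(t / ?L - t / ?L') * ?L' = t / ?L * (?L' - ?L)" using elim by (simp add: field_simps)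
    also have "\<bar>t / ?L * (?L' - ?L)\<bar> = t / ?L * \<bar>?L' - ?L\<bar>" using elim t by (simp add: abs_mult)
    also have "\<dots> \<le> 1 * \<bar>?L' - ?L\<bar>" by (rule mult_right_mono[OF q(2)]) simp
    also have "\<dots> \<le> dist (c 0) (d 0)"
      using dist_triangle[of "c 0" "X n" "d 0"] dist_triangle[of "d 0" "X n" "c 0"]
      by (simp add: dist_commute)
    finally show ?case
      using 1 dist_triangle[of "?f c n" "?f d n" "point_at (d 0) (X n) (t / ?L)"] by linarith
  qed
qed

text \<open>A convex function bounded above on a half-line does not increase, so any bound improves
  to the initial distance.\<close>

lemma bounded_rays_close:
  fixes c d :: "real \<Rightarrow> 'a"
  assumes "ray c" "ray d" "\<And>t. t \<ge> 0 \<Longrightarrow> dist (c t) (d t) \<le> B" "t \<ge> 0"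
  shows "dist (c t) (d t) \<le> dist (c 0) (d 0)"
proof (rule convex_bounded_above_antimono[where c = 0 and s = 0 and f = "\<lambda>t. dist (c t) (d t)"])
  show "convex_on {0..} (\<lambda>t. dist (c t) (d t))"
    using convex_on_dist_distance_preserving assms(1,2) unfolding ray_def by simp
qed (use assms in auto)

lemma asymptotic_rays_unique:
  fixes c d :: "real \<Rightarrow> 'a"
  assumes "ray c" "ray d" "asymptotic c d" "c 0 = d 0" "t \<ge> 0"
  shows "c t = d t"
proof -
  obtain B where "\<And>t. t \<ge> 0 \<Longrightarrow> dist (c t) (d t) \<le> B"
    using assms(1-3) asymptotic_iff_bounded by blast
  from bounded_rays_close[OF assms(1,2) this assms(5)] assms(4) show ?thesis by simp
qed

text \<open>Segments from \<open>p\<close> to points of \<open>d\<close> converge along an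
  ultrafilter. As \<open>d\<close> is also the limit of the segments to its own points,
  \<open>ray_limits_close\<close> compares the two.\<close>

lemma asymptotic_ray_exists:
  fixes d :: "real \<Rightarrow> 'a"
  assumes d: "ray d"
  shows "\<exists>c. ray c \<and> c 0 = p \<and> asymptotic c d"
proof -
  obtain F where F: "F \<le> at_top" "ultrafilter (F :: real filter)"
    using ultrafilter_below[of "at_top :: real filter"] by auto
  have ev: "\<forall>\<^sub>F n in F. n \<ge> t" for t using eventually_ge_at_top F(1) by (rule filter_leD[rotated])
  have "filterlim (\<lambda>n. dist (d 0) (d n)) at_top F"
    unfolding filterlim_at_top
  proof
    fix Z show "\<forall>\<^sub>F n in F. Z \<le> dist (d 0) (d n)"
      using ev[of "max 0 Z"] by eventually_elim (simp add: ray_dist_0[OF d])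
  qed
  then have X: "filterlim (\<lambda>n. dist y (d n)) at_top F" for y by (rule filterlim_dist_at_top)
  obtain c where c: "ray c" "c 0 = p" "ray_limit F d c"
    using ray_limit_exists[OF F(2) X[of p]] by blast
  have "ray_limit F d d"
    unfolding ray_limit_def
  proof (intro allI impI)
    fix t :: real assume t: "t \<ge> 0"
    have "\<forall>\<^sub>F n in F. d t = point_at (d 0) (d n) (t / dist (d 0) (d n))"
      using ev[of "t + 1"]
    proof eventually_elim
      case (elim n)
      then show ?case
        using distance_preserving_point_at[OF d[unfolded ray_def], of 0 n "t / n"] t
        by (simp add: ray_dist_0[OF d])
    qed
    then show "((\<lambda>n. point_at (d 0) (d n) (t / dist (d 0) (d n))) \<longlongrightarrow> d t) F"
      by (rule Lim_transform_eventually[OF tendsto_const])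
  qed
  then have "asymptotic c d"
    using ray_limits_close[OF F(2) X c(3)] asymptotic_iff_bounded[OF c(1) d] by blast
  then show ?thesis using c by blast
qed

lemma geodesic_boundary_ray_to:
  fixes \<xi> :: "'a ideal_point"
  assumes "\<xi> \<in> geodesic_boundary"
  shows "ray (ray_to p \<xi>)" "ray_to p \<xi> 0 = p" "ray_class (ray_to p \<xi>) = \<xi>"
proof -
  obtain d where d: "ray d" "\<xi> = ray_class d" using assms unfolding geodesic_boundary_def by auto
  obtain c where "ray c" "c 0 = p" "asymptotic c d" using asymptotic_ray_exists[OF d(1)] by blast
  moreover have "asymptotic d c" using calculation ray_class_eq_iff d(1) by metis
  ultimately have "c \<in> \<xi> \<and> c 0 = p" unfolding d(2) ray_class_def by blast
  then have "ray_to p \<xi> \<in> \<xi> \<and> ray_to p \<xi> 0 = p" 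
    unfolding ray_to_def by (rule someI[of "\<lambda>c. c \<in> \<xi> \<and> c 0 = p"])
  then show "ray (ray_to p \<xi>)" "ray_to p \<xi> 0 = p" "ray_class (ray_to p \<xi>) = \<xi>"
    unfolding d(2) using ray_class_eq_iff[OF d(1)] by (auto simp: ray_class_def[of d])
qed

lemma ray_class_in_boundary: "ray c \<Longrightarrow> ray_class c \<in> geodesic_boundary"
  unfolding geodesic_boundary_def by blast

lemma ray_to_ray_class:
  fixes c :: "real \<Rightarrow> 'a"
  assumes "ray c" "t \<ge> 0"
  shows "ray_to (c 0) (ray_class c) t = c t"
proof -
  note r = geodesic_boundary_ray_to[OF ray_class_in_boundary[OF assms(1)], of "c 0"]
  have "asymptotic (ray_to (c 0) (ray_class c)) c" using ray_class_eq_iff r assms by blast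
  then show ?thesis using asymptotic_rays_unique r assms by blast
qed


section \<open>Limits of normalized distance functions\<close>

text \<open>Only differences of values enter, so adding a constant to \<open>\<Phi>\<close> changes
  nothing. The escape of \<open>X\<close> is what distinguishes such a limit from a distance
  function.\<close>

definition horo_limit :: "'b filter \<Rightarrow> ('b \<Rightarrow> 'a) \<Rightarrow> ('a \<Rightarrow> real) \<Rightarrow> bool" where
  "horo_limit F X \<Phi> \<longleftrightarrow> ultrafilter F \<and> (\<forall>y. filterlim (\<lambda>n. dist y (X n)) at_top F) \<and>
     (\<forall>y z. ((\<lambda>n. dist y (X n) - dist z (X n)) \<longlongrightarrow> \<Phi> y - \<Phi> z) F)"

definition gradient_ray :: "('a \<Rightarrow> real) \<Rightarrow> (real \<Rightarrow> 'a) \<Rightarrow> bool" where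
  "gradient_ray \<Phi> c \<longleftrightarrow> ray c \<and> (\<forall>t\<ge>0. \<Phi> (c t) = \<Phi> (c 0) - t)"

lemma gradient_ray_ray: "gradient_ray \<Phi> c \<Longrightarrow> ray c"
  unfolding gradient_ray_def by blast

lemma gradient_rayD: "gradient_ray \<Phi> c \<Longrightarrow> t \<ge> 0 \<Longrightarrow> \<Phi> (c t) = \<Phi> (c 0) - t"
  unfolding gradient_ray_def by blast

lemma horo_limit_exists:
  assumes F: "ultrafilter F" and X: "filterlim (\<lambda>n. dist p (X n)) at_top F"
  shows "\<exists>\<Phi>. horo_limit F X \<Phi> \<and> \<Phi> p = 0"
proof -
  have "\<exists>l. ((\<lambda>n. dist y (X n) - dist p (X n)) \<longlongrightarrow> l) F" for y
  proof -
    have "dist y (X n) - dist p (X n) \<in> cball 0 (dist y p)" for n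
      using dist_triangle[of y "X n" p] dist_triangle[of p "X n" y]
      by (simp add: dist_norm[of 0] dist_commute abs_le_iff)
    then show ?thesis
      using ultrafilter_compact_limit[OF F Elementary_Metric_Spaces.compact_cball, of "\<lambda>n. dist y (X n) - dist p (X n)" 0 "dist y p"]
      by auto
  qed
  then obtain \<Phi> where \<Phi>: "\<And>y. ((\<lambda>n. dist y (X n) - dist p (X n)) \<longlongrightarrow> \<Phi> y) F" by metis
  have "((\<lambda>n. dist y (X n) - dist z (X n)) \<longlongrightarrow> \<Phi> y - \<Phi> z) F" for y z
    using tendsto_diff[OF \<Phi>[of y] \<Phi>[of z]] by simp
  moreover have "\<Phi> p = 0"
    using tendsto_unique[OF ultrafilter_nontrivial[OF F] \<Phi>[of p], of 0] by simp
  ultimately show ?thesis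
    using F filterlim_dist_at_top[OF X] unfolding horo_limit_def by blast
qed

lemma horo_limit_lipschitz:
  assumes "horo_limit F X \<Phi>"
  shows "\<Phi> y - \<Phi> z \<le> dist y z"
proof (rule tendsto_upperbound)
  show "((\<lambda>n. dist y (X n) - dist z (X n)) \<longlongrightarrow> \<Phi> y - \<Phi> z) F" "F \<noteq> bot"
    using assms ultrafilter_nontrivial unfolding horo_limit_def by blast+
  show "\<forall>\<^sub>F n in F. dist y (X n) - dist z (X n) \<le> dist y z"
  proof (intro always_eventually allI)
    fix n show "dist y (X n) - dist z (X n) \<le> dist y z"
      using dist_triangle[of y "X n" z] by simp
  qed
qed

lemma horo_limit_continuous:
  assumes "horo_limit F X \<Phi>"
  shows "continuous_on UNIV \<Phi>"
proof -
  have "\<bar>\<Phi> y - \<Phi> z\<bar> \<le> dist y z" for y z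
    using horo_limit_lipschitz[OF assms, of y z] horo_limit_lipschitz[OF assms, of z y]
    by (simp add: dist_commute abs_le_iff)
  then show ?thesis
    unfolding continuous_on_iff by (metis UNIV_I dist_real_def le_less_trans)
qed

lemma horo_limit_tendsto:
  assumes "horo_limit F X \<Phi>" "(Y \<longlongrightarrow> y) G"
  shows "((\<lambda>n. \<Phi> (Y n)) \<longlongrightarrow> \<Phi> y) G"
  using continuous_on_tendsto_compose[OF horo_limit_continuous[OF assms(1)] assms(2)] by simp

lemma horo_limit_convex:
  assumes "horo_limit F X \<Phi>" and l: "0 \<le> l" "l \<le> 1"
  shows "\<Phi> (point_at y z l) \<le> (1 - l) * \<Phi> y + l * \<Phi> z"
proof -
  let ?m = "point_at y z l"
  have lim: "((\<lambda>n. dist y (X n) - dist z (X n)) \<longlongrightarrow> \<Phi> y - \<Phi> z) F" for y z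
    using assms unfolding horo_limit_def by blast
  have "0 \<le> (1 - l) * (\<Phi> y - \<Phi> ?m) + l * (\<Phi> z - \<Phi> ?m)"
  proof (rule tendsto_lowerbound)
    show "((\<lambda>n. (1 - l) * (dist y (X n) - dist ?m (X n)) + l * (dist z (X n) - dist ?m (X n)))
      \<longlongrightarrow> (1 - l) * (\<Phi> y - \<Phi> ?m) + l * (\<Phi> z - \<Phi> ?m)) F"
      by (intro tendsto_intros lim)
    show "\<forall>\<^sub>F n in F. 0 \<le> (1 - l) * (dist y (X n) - dist ?m (X n)) + l * (dist z (X n) - dist ?m (X n))"
    proof (intro always_eventually allI)
      fix n show "0 \<le> (1 - l) * (dist y (X n) - dist ?m (X n)) + l * (dist z (X n) - dist ?m (X n))"
        using dist_point_at_convex[OF l, of y z "X n"] by (simp add: algebra_simps)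
    qed
    show "F \<noteq> bot" using assms ultrafilter_nontrivial unfolding horo_limit_def by blast
  qed
  then show ?thesis by (simp add: algebra_simps)
qed

text \<open>By convexity the midpoint of \<open>y\<close> and \<open>z\<close> has descended by
  \<open>t\<close> as well, so the Lipschitz bound keeps it at distance at least \<open>t\<close>
  from \<open>x\<close>, against strict convexity of the ball unless \<open>y = z\<close>.\<close>

lemma horo_limit_descent_unique:
  assumes \<Phi>: "horo_limit F X \<Phi>" and "dist x y \<le> t" "dist x z \<le> t" "\<Phi> y \<le> \<Phi> x - t" "\<Phi> z \<le> \<Phi> x - t"
  shows "y = z"
proof (rule strictly_convex_ball[of x y t])
  show "t \<le> dist x (point_at y z (1/2))"
    using horo_limit_convex[OF \<Phi>, of "1/2" y z] horo_limit_lipschitz[OF \<Phi>, of x "point_at y z (1/2)"]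
      assms(4,5) by simp
qed (use assms in auto)

text \<open>On a segment from \<open>z\<close> to \<open>X n\<close> the distance to
  \<open>X n\<close> drops at unit speed. The limit ray inherits this as an upper bound for
  \<open>\<Phi>\<close>; the Lipschitz property gives the lower one.\<close>

lemma gradient_ray_exists:
  assumes \<Phi>: "horo_limit F X \<Phi>"
  shows "\<exists>c. gradient_ray \<Phi> c \<and> c 0 = z \<and> ray_limit F X c"
proof -
  have F: "ultrafilter F" and X: "filterlim (\<lambda>n. dist z (X n)) at_top F"
    and lim: "\<And>y z. ((\<lambda>n. dist y (X n) - dist z (X n)) \<longlongrightarrow> \<Phi> y - \<Phi> z) F"
    using \<Phi> unfolding horo_limit_def by blast+
  obtain c where c: "ray c" "c 0 = z" "ray_limit F X c" using ray_limit_exists[OF F X] by blast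
  have "\<Phi> (c t) = \<Phi> z - t" if t: "t \<ge> 0" for t
  proof -
    let ?q = "\<lambda>n. point_at z (X n) (t / dist z (X n))"
    have "(?q \<longlongrightarrow> c t) F" using c(3) t unfolding ray_limit_def c(2) by simp
    then have "((\<lambda>n. dist (?q n) (c t)) \<longlongrightarrow> 0) F" by (rule tendsto_dist_iff[THEN iffD1])
    then have q: "((\<lambda>n. dist (c t) (?q n)) \<longlongrightarrow> 0) F" by (simp only: dist_commute[of "c t"])
    have "\<Phi> (c t) - \<Phi> z \<le> 0 - t"
    proof (rule tendsto_le[OF ultrafilter_nontrivial[OF F]])
      show "((\<lambda>n. dist (c t) (?q n) - t) \<longlongrightarrow> 0 - t) F" by (intro tendsto_intros q)
      have "\<forall>\<^sub>F n in F. max 0 t < dist z (X n)"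
        using X unfolding filterlim_at_top_dense by blast
      then show "\<forall>\<^sub>F n in F. dist (c t) (X n) - dist z (X n) \<le> dist (c t) (?q n) - t"
      proof eventually_elim
        case (elim n)
        then have "0 \<le> t / dist z (X n)" "t / dist z (X n) \<le> 1"
          using t by (simp_all only: divide_le_eq_1_pos divide_nonneg_pos max_less_iff_conj less_imp_le)
        then have "dist (?q n) (X n) = (1 - t / dist z (X n)) * dist z (X n)"
          by (rule dist_point_at_right)
        also have "\<dots> = dist z (X n) - t" using elim by (simp add: field_simps)
        finally show ?case using dist_triangle[of "c t" "X n" "?q n"] by simp
      qed
    qed (rule lim)
    moreover have "\<Phi> z - \<Phi> (c t) \<le> t"
      using horo_limit_lipschitz[OF \<Phi>, of z "c t"] ray_dist_0[OF c(1) t] c(2) by simp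
    ultimately show ?thesis by simp
  qed
  then show ?thesis using c unfolding gradient_ray_def by blast
qed

lemma gradient_ray_unique:
  assumes \<Phi>: "horo_limit F X \<Phi>" and c: "gradient_ray \<Phi> c" and d: "gradient_ray \<Phi> d"
    and "c 0 = d 0" "t \<ge> 0"
  shows "c t = d t"
proof (rule horo_limit_descent_unique[OF \<Phi>])
  show "dist (c 0) (c t) \<le> t" "dist (c 0) (d t) \<le> t"
    using ray_dist_0[OF gradient_ray_ray[OF c]] ray_dist_0[OF gradient_ray_ray[OF d]] assms(4,5)
    by auto
  show "\<Phi> (c t) \<le> \<Phi> (c 0) - t" "\<Phi> (d t) \<le> \<Phi> (c 0) - t"
    using gradient_rayD[OF c assms(5)] gradient_rayD[OF d assms(5)] assms(4) by auto
qed

lemma gradient_ray_limit: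
  assumes \<Phi>: "horo_limit F X \<Phi>" and c: "gradient_ray \<Phi> c"
  shows "ray_limit F X c"
proof -
  obtain d where d: "gradient_ray \<Phi> d" "d 0 = c 0" "ray_limit F X d"
    using gradient_ray_exists[OF \<Phi>] by blast
  have "d t = c t" if "t \<ge> 0" for t using gradient_ray_unique[OF \<Phi> d(1) c d(2) that] .
  then show ?thesis using d(3) unfolding ray_limit_def by simp
qed

lemma gradient_rays_close:
  assumes \<Phi>: "horo_limit F X \<Phi>" and c: "gradient_ray \<Phi> c" and d: "gradient_ray \<Phi> d" and t: "t \<ge> 0"
  shows "dist (c t) (d t) \<le> dist (c 0) (d 0)"
proof (rule bounded_rays_close)
  show "ray c" "ray d" using c d unfolding gradient_ray_def by auto
  show "dist (c t) (d t) \<le> 2 * dist (c 0) (d 0)" if "t \<ge> 0" for t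
    using ray_limits_close[OF _ _ gradient_ray_limit[OF \<Phi> c] gradient_ray_limit[OF \<Phi> d] that] \<Phi>
    unfolding horo_limit_def by blast
qed (rule t)

end

section \<open>Lines parallel to a given line\<close>

lemma geodesic_line_dist: "geodesic_line c \<Longrightarrow> dist (c s) (c t) = \<bar>s - t\<bar>"
  unfolding geodesic_line_def distance_preserving_on_def by auto

lemma geodesic_line_ray: "geodesic_line c \<Longrightarrow> ray c"
  unfolding geodesic_line_def ray_def distance_preserving_on_def by auto

lemma geodesic_line_reverse: "geodesic_line c \<Longrightarrow> geodesic_line (\<lambda>t. c (- t))"
  unfolding geodesic_line_def distance_preserving_on_def by auto

lemma geodesic_line_shift: "geodesic_line c \<Longrightarrow> geodesic_line (\<lambda>t. c (t + u))"
  unfolding geodesic_line_def distance_preserving_on_def by auto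

context proper_busemann
begin

lemma geodesic_line_point_at:
  fixes c :: "real \<Rightarrow> 'a"
  assumes "geodesic_line c" "0 \<le> l" "l \<le> 1"
  shows "point_at (c s) (c t) l = c ((1 - l) * s + l * t)"
  using distance_preserving_point_at[OF assms(1)[unfolded geodesic_line_def]] assms(2,3) by simp

lemma horo_limit_affine_on_line:
  assumes \<Phi>: "horo_limit F X \<Phi>" and c: "geodesic_line c" and bd: "\<And>t. \<Phi> (c t) \<le> B + k * t"
  shows "\<Phi> (c t) = \<Phi> (c 0) + k * t"
proof -
  have "convex_on UNIV (\<lambda>t. \<Phi> (c t) - k * t)"
  proof (rule convex_onI)
    fix u x y :: real assume "0 < u" "u < 1"
    then show "\<Phi> (c ((1 - u) *\<^sub>R x + u *\<^sub>R y)) - k * ((1 - u) *\<^sub>R x + u *\<^sub>R y)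
        \<le> (1 - u) * (\<Phi> (c x) - k * x) + u * (\<Phi> (c y) - k * y)"
      using horo_limit_convex[OF \<Phi>, of u "c x" "c y"] geodesic_line_point_at[OF c, of u x y]
      by (simp add: algebra_simps)
  qed simp
  moreover have "\<Phi> (c t) - k * t \<le> B" for t using bd[of t] by simp
  ultimately have "\<Phi> (c t) - k * t = \<Phi> (c 0) - k * 0" by (rule convex_bounded_above_constant)
  then show ?thesis by simp
qed

text \<open>A midpoint within \<open>V\<close> of \<open>p\<close> has value at least
  \<open>- V\<close>, so convexity forces \<open>\<Phi> Q\<close> to be large and the segment to be
  nearly as long as its bound \<open>2 * t\<close>. In the second claim \<open>\<tau>\<close> is arc
  length from the midpoint towards \<open>P\<close>.\<close>

lemma horo_limit_segment_bounds:
  assumes \<Phi>: "horo_limit F X \<Phi>" and "\<Phi> p = 0" and P: "\<Phi> P \<le> - t" and l: "dist Q P \<le> 2 * t"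
    and m: "dist p (point_at Q P (1/2)) \<le> V"
  shows "2 * t - 2 * V \<le> dist Q P"
    and "dist Q P > 0 \<Longrightarrow> \<bar>\<tau>\<bar> \<le> dist Q P / 2 \<Longrightarrow> \<Phi> (point_at Q P (1/2 + \<tau> / dist Q P)) \<le> - \<tau>"
proof -
  have "- V \<le> \<Phi> (point_at Q P (1/2))"
    using horo_limit_lipschitz[OF \<Phi>, of p "point_at Q P (1/2)"] m assms(2) by simp
  also have "\<dots> \<le> 1/2 * \<Phi> Q + 1/2 * \<Phi> P" using horo_limit_convex[OF \<Phi>, of "1/2" Q P] by simp
  finally show "2 * t - 2 * V \<le> dist Q P"
    using P horo_limit_lipschitz[OF \<Phi>, of Q P] by simp
  assume L: "dist Q P > 0" and \<tau>: "\<bar>\<tau>\<bar> \<le> dist Q P / 2"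
  let ?l = "1/2 + \<tau> / dist Q P"
  have "\<bar>\<tau> / dist Q P\<bar> \<le> 1/2" using L \<tau> by (simp add: field_simps)
  then have l01: "0 \<le> ?l" "?l \<le> 1" by linarith+
  have "dist (point_at Q P ?l) P = (1 - ?l) * dist Q P" using l01 by (rule dist_point_at_right)
  also have "\<dots> = dist Q P / 2 - \<tau>" using L by (simp add: field_simps)
  finally show "\<Phi> (point_at Q P ?l) \<le> - \<tau>"
    using horo_limit_lipschitz[OF \<Phi>, of "point_at Q P ?l" P] P l by simp
qed

text \<open>The segments are parameterized by arc length from their midpoints, which stay bounded.
  The limit gives only the upper bounds \<open>- \<tau>\<close> and \<open>\<tau>\<close> for
  \<open>\<Phi>\<close> and \<open>\<Psi>\<close>; convexity along the whole line makes both
  functions affine.\<close>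

lemma limit_line:
  fixes P Q :: "'b \<Rightarrow> 'a"
  assumes F: "ultrafilter F" and \<Phi>: "horo_limit G X \<Phi>" "\<Phi> p = 0" and \<Psi>: "horo_limit H Y \<Psi>" "\<Psi> p = 0"
    and t: "filterlim t at_top F"
    and ev: "\<forall>\<^sub>F n in F. \<Phi> (P n) \<le> - t n \<and> \<Psi> (Q n) \<le> - t n \<and> dist (Q n) (P n) \<le> 2 * t n \<and>
      dist p (point_at (Q n) (P n) (1/2)) \<le> V"
  shows "\<exists>\<gamma>. geodesic_line \<gamma> \<and> ((\<lambda>n. point_at (Q n) (P n) (1/2)) \<longlongrightarrow> \<gamma> 0) F \<and>
    (\<forall>\<tau>. \<Phi> (\<gamma> \<tau>) = \<Phi> (\<gamma> 0) - \<tau>) \<and> (\<forall>\<tau>. \<Psi> (\<gamma> \<tau>) = \<Psi> (\<gamma> 0) + \<tau>) \<and> \<Phi> (\<gamma> 0) \<le> 0 \<and> \<Psi> (\<gamma> 0) \<le> 0"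
proof -
  note F_nt = ultrafilter_nontrivial[OF F]
  let ?L = "\<lambda>n. dist (Q n) (P n)"
  let ?f = "\<lambda>\<tau> n. point_at (Q n) (P n) (1/2 + \<tau> / ?L n)"
  have big: "\<forall>\<^sub>F n in F. ?L n > 0 \<and> \<bar>\<tau>\<bar> \<le> ?L n / 2" for \<tau>
    using ev filterlim_at_top_dense[THEN iffD1, OF t, rule_format, of "V + \<bar>\<tau>\<bar>"]
  proof eventually_elim
    case (elim n)
    then have "2 * t n - 2 * V \<le> ?L n" using horo_limit_segment_bounds(1)[OF \<Phi>] by blast
    then show ?case using elim by linarith
  qed
  have l01: "0 \<le> 1/2 + \<tau> / L \<and> 1/2 + \<tau> / L \<le> 1" if "L > 0" "\<bar>\<tau>\<bar> \<le> L / 2" for \<tau> L :: real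
  proof -
    have "\<bar>\<tau> / L\<bar> \<le> 1/2" using that by (simp add: field_simps)
    then show ?thesis by linarith
  qed
  have f_dist: "dist (?f \<sigma> n) (?f \<tau> n) = \<bar>\<sigma> - \<tau>\<bar>"
    if "?L n > 0" "\<bar>\<sigma>\<bar> \<le> ?L n / 2" "\<bar>\<tau>\<bar> \<le> ?L n / 2" for \<sigma> \<tau> n
  proof -
    have "dist (?f \<sigma> n) (?f \<tau> n) = \<bar>(1/2 + \<sigma> / ?L n) - (1/2 + \<tau> / ?L n)\<bar> * ?L n"
      using l01 that by (intro dist_point_at) auto
    also have "(1/2 + \<sigma> / ?L n) - (1/2 + \<tau> / ?L n) = (\<sigma> - \<tau>) / ?L n"
      by (simp add: diff_divide_distrib)
    finally show ?thesis using that(1) by (simp add: abs_divide)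
  qed
  have "\<exists>l. (?f \<tau> \<longlongrightarrow> l) F" for \<tau>
  proof (rule ultrafilter_limit[OF F])
    show "\<forall>\<^sub>F n in F. dist p (?f \<tau> n) \<le> V + \<bar>\<tau>\<bar>"
      using ev big[of \<tau>]
    proof eventually_elim
      case (elim n)
      then show ?case using f_dist[of n 0 \<tau>] dist_triangle[of p "?f \<tau> n" "?f 0 n"] by simp
    qed
  qed
  then obtain \<gamma> where \<gamma>: "\<And>\<tau>. (?f \<tau> \<longlongrightarrow> \<gamma> \<tau>) F" by metis
  have "dist (\<gamma> \<sigma>) (\<gamma> \<tau>) = \<bar>\<sigma> - \<tau>\<bar>" for \<sigma> \<tau>
  proof (rule tendsto_unique[OF F_nt tendsto_dist[OF \<gamma> \<gamma>]])
    have "\<forall>\<^sub>F n in F. \<bar>\<sigma> - \<tau>\<bar> = dist (?f \<sigma> n) (?f \<tau> n)"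
      using big[of \<sigma>] big[of \<tau>] by eventually_elim (use f_dist in simp)
    then show "((\<lambda>n. dist (?f \<sigma> n) (?f \<tau> n)) \<longlongrightarrow> \<bar>\<sigma> - \<tau>\<bar>) F"
      by (rule Lim_transform_eventually[OF tendsto_const])
  qed
  then have line: "geodesic_line \<gamma>" unfolding geodesic_line_def distance_preserving_on_def by blast
  have \<Phi>_le: "\<Phi> (\<gamma> \<tau>) \<le> - \<tau>" for \<tau>
  proof (rule tendsto_upperbound[OF horo_limit_tendsto[OF \<Phi>(1) \<gamma>] _ F_nt])
    show "\<forall>\<^sub>F n in F. \<Phi> (?f \<tau> n) \<le> - \<tau>"
      using ev big[of \<tau>] by eventually_elim (use horo_limit_segment_bounds(2)[OF \<Phi>] in blast)
  qed
  have \<Psi>_le: "\<Psi> (\<gamma> \<tau>) \<le> \<tau>" for \<tau>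
  proof (rule tendsto_upperbound[OF horo_limit_tendsto[OF \<Psi>(1) \<gamma>] _ F_nt])
    show "\<forall>\<^sub>F n in F. \<Psi> (?f \<tau> n) \<le> \<tau>"
      using ev big[of \<tau>]
    proof eventually_elim
      case (elim n)
      have swap: "point_at (P n) (Q n) (1 - l) = point_at (Q n) (P n) l" if "0 \<le> l" "l \<le> 1" for l
        using point_at_swap[OF that] .
      \<comment> \<open>\<open>\<Psi>\<close> decreases towards \<open>Q n\<close>, so the estimate
        is applied to the reversed segment at \<open>- \<tau>\<close>.\<close>
      have "\<Psi> (point_at (P n) (Q n) (1/2 + (- \<tau>) / dist (P n) (Q n))) \<le> - (- \<tau>)"
        by (rule horo_limit_segment_bounds(2)[OF \<Psi>, where t = "t n" and V = V])
          (use elim swap[of "1/2"] in \<open>auto simp: dist_commute\<close>)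
      moreover have "1/2 + (- \<tau>) / dist (P n) (Q n) = 1 - (1/2 + \<tau> / ?L n)"
        by (simp add: dist_commute)
      ultimately have "\<Psi> (point_at (P n) (Q n) (1 - (1/2 + \<tau> / ?L n))) \<le> \<tau>"
        by (simp only: minus_minus)
      then show ?case using swap[of "1/2 + \<tau> / ?L n"] l01[of "?L n" \<tau>] elim by (simp only:)
    qed
  qed
  have "\<Phi> (\<gamma> \<tau>) = \<Phi> (\<gamma> 0) - \<tau>" for \<tau>
    using horo_limit_affine_on_line[OF \<Phi>(1) line, of 0 "- 1" \<tau>] \<Phi>_le by simp
  moreover have "\<Psi> (\<gamma> \<tau>) = \<Psi> (\<gamma> 0) + \<tau>" for \<tau>
    using horo_limit_affine_on_line[OF \<Psi>(1) line, of 0 1 \<tau>] \<Psi>_le by simp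
  moreover have "((\<lambda>n. point_at (Q n) (P n) (1/2)) \<longlongrightarrow> \<gamma> 0) F" using \<gamma>[of 0] by simp
  moreover have "\<Phi> (\<gamma> 0) \<le> 0" "\<Psi> (\<gamma> 0) \<le> 0" using \<Phi>_le[of 0] \<Psi>_le[of 0] by simp_all
  ultimately show ?thesis using line by blast
qed

text \<open>Constancy is required for every offset \<open>u\<close>: as a function of
  \<open>u\<close>, this distance determines the norm of the strip.\<close>

definition parallel :: "(real \<Rightarrow> 'a) \<Rightarrow> (real \<Rightarrow> 'a) \<Rightarrow> bool" where
  "parallel \<alpha> \<beta> \<longleftrightarrow> geodesic_line \<alpha> \<and> geodesic_line \<beta> \<and>
     (\<forall>t u. dist (\<alpha> t) (\<beta> (t + u)) = dist (\<alpha> 0) (\<beta> u))"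

lemma parallel_dist: "parallel \<alpha> \<beta> \<Longrightarrow> dist (\<alpha> t) (\<beta> s) = dist (\<alpha> 0) (\<beta> (s - t))"
  unfolding parallel_def by (metis add.commute diff_add_cancel)

text \<open>Forwards the lines are gradient rays of \<open>\<Phi>\<close>, backwards of
  \<open>\<Psi>\<close>, so their distance never exceeds its initial value and is constant by
  convexity. Shifting \<open>\<beta>\<close> by \<open>u\<close> preserves the slopes, which covers
  all offsets.\<close>

lemma gradient_lines_parallel:
  assumes \<Phi>: "horo_limit F X \<Phi>" and \<Psi>: "horo_limit G Y \<Psi>"
    and \<alpha>: "geodesic_line \<alpha>" "\<And>t. \<Phi> (\<alpha> t) = \<Phi> (\<alpha> 0) - t" "\<And>t. \<Psi> (\<alpha> t) = \<Psi> (\<alpha> 0) + t"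
    and \<beta>: "geodesic_line \<beta>" "\<And>t. \<Phi> (\<beta> t) = \<Phi> (\<beta> 0) - t" "\<And>t. \<Psi> (\<beta> t) = \<Psi> (\<beta> 0) + t"
  shows "parallel \<alpha> \<beta>"
proof -
  have "dist (\<alpha> t) (\<beta> (t + u)) = dist (\<alpha> 0) (\<beta> (0 + u))" for t u
  proof (rule convex_bounded_above_constant[where f = "\<lambda>t. dist (\<alpha> t) (\<beta> (t + u))"])
    let ?b = "\<lambda>t. \<beta> (t + u)"
    have b: "geodesic_line ?b" using \<beta>(1) by (rule geodesic_line_shift)
    show "convex_on UNIV (\<lambda>t. dist (\<alpha> t) (?b t))"
      using \<alpha>(1) b unfolding geodesic_line_def by (intro convex_on_dist_distance_preserving) auto
    have "\<Phi> (?b t) = \<Phi> (?b 0) - t" for t using \<beta>(2)[of u] \<beta>(2)[of "t + u"] by simp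
    then have r: "gradient_ray \<Phi> \<alpha>" "gradient_ray \<Phi> ?b"
      unfolding gradient_ray_def using \<alpha>(1,2) b geodesic_line_ray by blast+
    have r': "gradient_ray \<Psi> (\<lambda>t. \<alpha> (- t))" "gradient_ray \<Psi> (\<lambda>t. ?b (- t))"
    proof -
      have "ray (\<lambda>t. \<alpha> (- t))" "ray (\<lambda>t. ?b (- t))"
        using geodesic_line_ray[OF geodesic_line_reverse] \<alpha>(1) b by blast+
      moreover have "\<Psi> (\<alpha> (- t)) = \<Psi> (\<alpha> (- 0)) - t" "\<Psi> (?b (- t)) = \<Psi> (?b (- 0)) - t" for t
        using \<alpha>(3)[of "- t"] \<beta>(3)[of u] \<beta>(3)[of "- t + u"] by simp_all
      ultimately show "gradient_ray \<Psi> (\<lambda>t. \<alpha> (- t))" "gradient_ray \<Psi> (\<lambda>t. ?b (- t))"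
        unfolding gradient_ray_def by blast+
    qed
    show "dist (\<alpha> t) (?b t) \<le> dist (\<alpha> 0) (?b 0)" for t
      using gradient_rays_close[OF \<Phi> r, of t] gradient_rays_close[OF \<Psi> r', of "- t"]
      by (cases "t \<ge> 0") auto
  qed
  then show ?thesis using \<alpha>(1) \<beta>(1) unfolding parallel_def by simp
qed

lemma far_parallel_line:
  assumes \<Phi>: "horo_limit F X \<Phi>" "\<Phi> p = 0" and \<Psi>: "horo_limit G Y \<Psi>" "\<Psi> p = 0"
    and a: "geodesic_line a" "a 0 = p" "\<And>t. \<Phi> (a t) = - t" "\<And>t. \<Psi> (a t) = t"
    and z: "\<And>s. \<exists>z. \<Phi> z \<le> 0 \<and> \<Psi> z \<le> 0 \<and> s \<le> dist p z"
  shows "\<exists>\<gamma>. parallel a \<gamma> \<and> v \<le> dist p (\<gamma> 0) \<and> (\<forall>u. dist p (\<gamma> 0) / 2 \<le> dist p (\<gamma> u))"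
proof -
  \<comment> \<open>Since \<open>m n t\<close> is within \<open>t\<close> of \<open>z n\<close>, the
    extra \<open>real n\<close> forces any time at which it is at distance \<open>v\<close> from
    \<open>p\<close> to be at least \<open>n\<close>.\<close>
  obtain z where z: "\<And>n. \<Phi> (z n) \<le> 0" "\<And>n. \<Psi> (z n) \<le> 0" "\<And>n :: nat. v + real n \<le> dist p (z n)"
  proof -
    have "\<forall>n :: nat. \<exists>z. \<Phi> z \<le> 0 \<and> \<Psi> z \<le> 0 \<and> v + real n \<le> dist p z" using z by blast
    then show ?thesis using that by metis
  qed
  have "\<forall>n. \<exists>c. gradient_ray \<Phi> c \<and> c 0 = z n" "\<forall>n. \<exists>c. gradient_ray \<Psi> c \<and> c 0 = z n"
    using gradient_ray_exists[OF \<Phi>(1)] gradient_ray_exists[OF \<Psi>(1)] by metis+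
  then obtain c d where c: "\<And>n. gradient_ray \<Phi> (c n)" "\<And>n. c n 0 = z n"
    and d: "\<And>n. gradient_ray \<Psi> (d n)" "\<And>n. d n 0 = z n" by metis
  define m where "m n t = point_at (d n t) (c n t) (1/2)" for n t
  have ends: "\<Phi> (c n t) \<le> - t" "\<Psi> (d n t) \<le> - t" "dist (d n t) (c n t) \<le> 2 * t" "dist (z n) (m n t) \<le> t"
    if "t \<ge> 0" for n t
  proof -
    have *: "dist (z n) (c n t) = t" "dist (z n) (d n t) = t"
      using ray_dist_0[OF gradient_ray_ray[OF c(1)] that] ray_dist_0[OF gradient_ray_ray[OF d(1)] that]
        c(2) d(2) by metis+
    show "\<Phi> (c n t) \<le> - t" "\<Psi> (d n t) \<le> - t"
      using gradient_rayD[OF c(1) that, of n] gradient_rayD[OF d(1) that, of n] c(2)[of n] d(2)[of n] z by auto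
    show "dist (d n t) (c n t) \<le> 2 * t"
      using * dist_triangle[of "d n t" "c n t" "z n"] by (simp add: dist_commute)
    show "dist (z n) (m n t) \<le> t"
      using dist_point_at_convex[of "1/2" "d n t" "c n t" "z n"] * by (simp add: m_def dist_commute)
  qed
  \<comment> \<open>Comparison with \<open>[a(-t) a(t)]\<close>, whose midpoint is \<open>p\<close>:
    corresponding endpoints lie on gradient rays of the same function and stay within
    \<open>dist p (z n)\<close> of each other.\<close>
  have m_bound: "dist p (m n t) \<le> dist p (z n)" if "t \<ge> 0" for n t
  proof -
    have ga: "gradient_ray \<Phi> a" "gradient_ray \<Psi> (\<lambda>t. a (- t))"
      unfolding gradient_ray_def using a geodesic_line_ray geodesic_line_reverse by auto
    have "p = point_at (a (- t)) (a t) (1/2)" using geodesic_line_point_at[OF a(1), of "1/2" "- t" t] a(2) by simp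
    then have "dist p (m n t) \<le> 1/2 * dist (a (- t)) (d n t) + 1/2 * dist (a t) (c n t)"
      unfolding m_def using point_at_contract[of "1/2" "a (- t)" "a t" "d n t" "c n t"] by simp
    also have "\<dots> \<le> 1/2 * dist p (z n) + 1/2 * dist p (z n)"
      using gradient_rays_close[OF \<Phi>(1) ga(1) c(1) that, of n]
        gradient_rays_close[OF \<Psi>(1) ga(2) d(1) that, of n] a(2) c(2)[of n] d(2)[of n]
      by (intro add_mono mult_left_mono) auto
    finally show ?thesis by simp
  qed
  have "\<exists>\<gamma>. geodesic_line \<gamma> \<and> v \<le> dist p (\<gamma> 0) \<and>
    (\<forall>\<tau>. \<Phi> (\<gamma> \<tau>) = \<Phi> (\<gamma> 0) - \<tau>) \<and> (\<forall>\<tau>. \<Psi> (\<gamma> \<tau>) = \<Psi> (\<gamma> 0) + \<tau>) \<and> \<Phi> (\<gamma> 0) \<le> 0 \<and> \<Psi> (\<gamma> 0) \<le> 0"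
  \<comment> \<open>Either some fixed \<open>z n\<close> keeps its midpoints at distance at least
    \<open>v\<close>, and the time tends to infinity; or for every \<open>n\<close> the intermediate
    value theorem gives a time with distance exactly \<open>v\<close>, and \<open>n\<close> tends to
    infinity.\<close>
  proof (cases "\<exists>n. \<forall>t\<ge>0. v \<le> dist p (m n t)")
    case True
    then obtain n where n: "\<And>t. t \<ge> 0 \<Longrightarrow> v \<le> dist p (m n t)" by blast
    obtain U where U: "U \<le> at_top" "ultrafilter (U :: real filter)"
      using ultrafilter_below[of "at_top :: real filter"] by auto
    have pos: "\<forall>\<^sub>F t in U. t \<ge> (0 :: real)" using eventually_ge_at_top U(1) by (rule filter_leD[rotated])
    have "\<forall>\<^sub>F t in U. \<Phi> (c n t) \<le> - t \<and> \<Psi> (d n t) \<le> - t \<and> dist (d n t) (c n t) \<le> 2 * t \<and>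
        dist p (point_at (d n t) (c n t) (1/2)) \<le> dist p (z n)"
      using pos by eventually_elim (use ends m_bound in \<open>auto simp: m_def\<close>)
    from limit_line[OF U(2) \<Phi> \<Psi> filterlim_mono[OF filterlim_ident order_refl U(1)] this]
    obtain \<gamma> where \<gamma>: "geodesic_line \<gamma>" "((\<lambda>t. m n t) \<longlongrightarrow> \<gamma> 0) U"
      "\<forall>\<tau>. \<Phi> (\<gamma> \<tau>) = \<Phi> (\<gamma> 0) - \<tau>" "\<forall>\<tau>. \<Psi> (\<gamma> \<tau>) = \<Psi> (\<gamma> 0) + \<tau>" "\<Phi> (\<gamma> 0) \<le> 0" "\<Psi> (\<gamma> 0) \<le> 0"
      unfolding m_def by blast
    have "v \<le> dist p (\<gamma> 0)"
    proof (rule tendsto_lowerbound[OF tendsto_dist[OF tendsto_const \<gamma>(2)] _ ultrafilter_nontrivial[OF U(2)]])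
      show "\<forall>\<^sub>F t in U. v \<le> dist p (m n t)" using pos by eventually_elim (rule n)
    qed
    then show ?thesis using \<gamma> by blast
  next
    case False
    have "\<exists>t\<ge>0. dist p (m n t) = v" for n
    proof -
      obtain t where t: "t \<ge> 0" "dist p (m n t) \<le> v" using False by (meson linear)
      have lip: "dist (m n x) (m n y) \<le> \<bar>x - y\<bar>" if "x \<ge> 0" "y \<ge> 0" for x y
        using point_at_contract[of "1/2" "d n x" "c n x" "d n y" "c n y"]
          ray_dist[OF gradient_ray_ray[OF c(1)] that, of n] ray_dist[OF gradient_ray_ray[OF d(1)] that, of n]
        by (simp add: m_def)
      have "continuous_on {0..t} (m n)"
        unfolding continuous_on_iff
      proof (intro ballI allI impI)
        fix x and e :: real assume "x \<in> {0..t}" "0 < e"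
        then show "\<exists>d>0. \<forall>x'\<in>{0..t}. dist x' x < d \<longrightarrow> dist (m n x') (m n x) < e"
          using lip by (intro exI[of _ e]) (force simp: dist_real_def)
      qed
      then have "continuous_on {0..t} (\<lambda>x. dist p (m n x))" by (intro continuous_intros)
      moreover have "v \<le> dist p (m n 0)" using z(3)[of n] c(2) d(2) by (simp add: m_def)
      ultimately show ?thesis using IVT2'[of "\<lambda>x. dist p (m n x)" t v 0] t by auto
    qed
    then obtain t where t: "\<And>n. t n \<ge> 0" "\<And>n. dist p (m n (t n)) = v" by metis
    obtain U where U: "U \<le> sequentially" "ultrafilter U"
      using ultrafilter_below[of sequentially] by auto
    have "real n \<le> t n" for n
      using z(3)[of n] t(2)[of n] ends(4)[OF t(1)[of n], of n] dist_triangle[of p "z n" "m n (t n)"]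
      by (simp add: dist_commute)
    then have "filterlim t at_top sequentially"
      by (intro filterlim_at_top_mono[OF filterlim_real_sequentially]) auto
    then have lim: "filterlim t at_top U" using U(1) by (rule filterlim_mono[OF _ order_refl])
    have "\<forall>\<^sub>F n in U. \<Phi> (c n (t n)) \<le> - t n \<and> \<Psi> (d n (t n)) \<le> - t n \<and>
        dist (d n (t n)) (c n (t n)) \<le> 2 * t n \<and> dist p (point_at (d n (t n)) (c n (t n)) (1/2)) \<le> v"
      using ends t by (intro always_eventually) (auto simp: m_def)
    from limit_line[OF U(2) \<Phi> \<Psi> lim this]
    obtain \<gamma> where \<gamma>: "geodesic_line \<gamma>" "((\<lambda>n. m n (t n)) \<longlongrightarrow> \<gamma> 0) U"
      "\<forall>\<tau>. \<Phi> (\<gamma> \<tau>) = \<Phi> (\<gamma> 0) - \<tau>" "\<forall>\<tau>. \<Psi> (\<gamma> \<tau>) = \<Psi> (\<gamma> 0) + \<tau>" "\<Phi> (\<gamma> 0) \<le> 0" "\<Psi> (\<gamma> 0) \<le> 0"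
      unfolding m_def by blast
    have "v \<le> dist p (\<gamma> 0)"
      by (rule tendsto_lowerbound[OF tendsto_dist[OF tendsto_const \<gamma>(2)] _ ultrafilter_nontrivial[OF U(2)]])
        (simp add: t(2))
    then show ?thesis using \<gamma> by blast
  qed
  then obtain \<gamma> where \<gamma>: "geodesic_line \<gamma>" "v \<le> dist p (\<gamma> 0)" "\<And>\<tau>. \<Phi> (\<gamma> \<tau>) = \<Phi> (\<gamma> 0) - \<tau>"
    "\<And>\<tau>. \<Psi> (\<gamma> \<tau>) = \<Psi> (\<gamma> 0) + \<tau>" "\<Phi> (\<gamma> 0) \<le> 0" "\<Psi> (\<gamma> 0) \<le> 0" by blast
  have "parallel a \<gamma>"
    by (rule gradient_lines_parallel[OF \<Phi>(1) \<Psi>(1) a(1) _ _ \<gamma>(1,3,4)]) (simp_all add: a \<Phi>(2) \<Psi>(2))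
  moreover have "dist p (\<gamma> 0) / 2 \<le> dist p (\<gamma> u)" for u
  proof -
    \<comment> \<open>At \<open>\<gamma> u\<close> the functions \<open>\<Phi>\<close> and
      \<open>\<Psi>\<close> are at most \<open>- u\<close> and \<open>u\<close>, while both vanish
      at \<open>p\<close>.\<close>
    have "\<bar>u\<bar> \<le> dist p (\<gamma> u)"
      using horo_limit_lipschitz[OF \<Phi>(1), of p "\<gamma> u"] horo_limit_lipschitz[OF \<Psi>(1), of p "\<gamma> u"]
        \<Phi>(2) \<Psi>(2) \<gamma>(3)[of u] \<gamma>(4)[of u] \<gamma>(5,6) by linarith
    moreover have "dist p (\<gamma> 0) \<le> dist p (\<gamma> u) + \<bar>u\<bar>"
      using dist_triangle[of p "\<gamma> 0" "\<gamma> u"] geodesic_line_dist[OF \<gamma>(1), of u 0] by simp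
    ultimately show ?thesis by simp
  qed
  ultimately show ?thesis using \<gamma>(2) by blast
qed

end

section \<open>Flat strips and half-planes\<close>

text \<open>The norm of the strip between parallel lines \<open>\<alpha>\<close>, \<open>\<beta>\<close>, in the basis formed by the direction of
  \<open>\<alpha>\<close> and the direction of the segment from \<open>\<alpha> 0\<close> to \<open>\<beta> 0\<close>.\<close>

definition strip_norm :: "(real \<Rightarrow> 'a::metric_space) \<Rightarrow> (real \<Rightarrow> 'a) \<Rightarrow> real \<Rightarrow> real \<Rightarrow> real" where
  "strip_norm \<alpha> \<beta> x y = (if y = 0 then \<bar>x\<bar>
     else \<bar>y\<bar> / dist (\<alpha> 0) (\<beta> 0) * dist (\<alpha> 0) (\<beta> (x * dist (\<alpha> 0) (\<beta> 0) / y)))"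

definition strip_point :: "(real \<Rightarrow> 'a::metric_space) \<Rightarrow> (real \<Rightarrow> 'a) \<Rightarrow> real \<Rightarrow> real \<Rightarrow> 'a" where
  "strip_point \<alpha> \<beta> x y = point_at (\<alpha> x) (\<beta> x) (y / dist (\<alpha> 0) (\<beta> 0))"

lemma strip_norm_scale: "strip_norm \<alpha> \<beta> (r * x) (r * y) = \<bar>r\<bar> * strip_norm \<alpha> \<beta> x y"
  by (cases "r = 0") (auto simp: strip_norm_def abs_mult)

context proper_busemann
begin

lemma parallelD:
  assumes "parallel \<alpha> \<beta>"
  shows "geodesic_line \<alpha>" "geodesic_line \<beta>" "dist (\<alpha> t) (\<beta> t) = dist (\<alpha> 0) (\<beta> 0)"
  using assms parallel_dist[OF assms, of t t] unfolding parallel_def by auto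

text \<open>The point at fraction \<open>l\<close> of \<open>[\<alpha>(t)\<beta>(t')]\<close> is compared with \<open>\<alpha>(\<mu>)\<close> by contraction towards
  \<open>\<alpha>(t)\<close> and with \<open>\<beta>(\<mu>)\<close> by contraction towards \<open>\<beta>(t')\<close>; the two upper bounds add up to
  \<open>|\<alpha>(\<mu>)\<beta>(\<mu>)|\<close>.\<close>

lemma parallel_point_at:
  assumes par: "parallel \<alpha> \<beta>" and l: "0 \<le> l" "l \<le> 1"
  defines "\<mu> \<equiv> \<lambda>t t'. (1 - l) * t + l * t'"
  shows "point_at (\<alpha> t) (\<beta> t') l = point_at (\<alpha> (\<mu> t t')) (\<beta> (\<mu> t t')) l"
proof (rule point_at_unique[OF l])
  note lines = parallelD(1,2)[OF par]
  let ?d = "dist (\<alpha> 0) (\<beta> 0)"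
  have "dist (point_at (\<alpha> t) (\<alpha> t') l) (point_at (\<alpha> t) (\<beta> t') l) \<le> l * ?d"
    using point_at_contract[OF l, of "\<alpha> t" "\<alpha> t'" "\<alpha> t" "\<beta> t'"] parallelD(3)[OF par, of t'] by simp
  then show "dist (\<alpha> (\<mu> t t')) (point_at (\<alpha> t) (\<beta> t') l) \<le> l * dist (\<alpha> (\<mu> t t')) (\<beta> (\<mu> t t'))"
    using parallelD(3)[OF par, of "\<mu> t t'"] unfolding \<mu>_def geodesic_line_point_at[OF lines(1) l] by simp
  have "dist (point_at (\<alpha> t) (\<beta> t') l) (point_at (\<beta> t) (\<beta> t') l) \<le> (1 - l) * ?d"
    using point_at_contract[OF l, of "\<alpha> t" "\<beta> t'" "\<beta> t" "\<beta> t'"] parallelD(3)[OF par, of t] by simp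
  then show "dist (point_at (\<alpha> t) (\<beta> t') l) (\<beta> (\<mu> t t')) \<le> (1 - l) * dist (\<alpha> (\<mu> t t')) (\<beta> (\<mu> t t'))"
    using parallelD(3)[OF par, of "\<mu> t t'"] unfolding \<mu>_def geodesic_line_point_at[OF lines(2) l] by simp
qed

text \<open>Both points lie on one slanted segment from \<open>\<alpha> t\<close> to
  \<open>\<beta> (t + k)\<close>, where \<open>k\<close> is their horizontal difference extrapolated
  to the full height of the strip. Their distance is a fraction of its length.\<close>

lemma parallel_dist_point_at:
  assumes par: "parallel \<alpha> \<beta>" and l: "0 \<le> l" "l \<le> 1" "0 \<le> l'" "l' \<le> 1" "l \<noteq> l'"
  shows "dist (point_at (\<alpha> x) (\<beta> x) l) (point_at (\<alpha> x') (\<beta> x') l') =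
    \<bar>l' - l\<bar> * dist (\<alpha> 0) (\<beta> ((x' - x) / (l' - l)))"
proof -
  define k where "k = (x' - x) / (l' - l)"
  have k: "k * (l' - l) = x' - x" using l(5) by (simp add: k_def)
  define t where "t = x - l * k"
  have *: "(1 - l) * t + l * (t + k) = x" "(1 - l') * t + l' * (t + k) = x'"
    using k by (auto simp: t_def algebra_simps)
  have "dist (point_at (\<alpha> x) (\<beta> x) l) (point_at (\<alpha> x') (\<beta> x') l') = \<bar>l - l'\<bar> * dist (\<alpha> t) (\<beta> (t + k))"
    using parallel_point_at[OF par l(1,2), of t "t + k"] parallel_point_at[OF par l(3,4), of t "t + k"]
      dist_point_at[OF l(1-4), of "\<alpha> t" "\<beta> (t + k)"] * by simp
  also have "dist (\<alpha> t) (\<beta> (t + k)) = dist (\<alpha> 0) (\<beta> k)" using parallel_dist[OF par, of t "t + k"] by simp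
  finally show ?thesis by (simp add: k_def abs_minus_commute)
qed

text \<open>Slanted segments do not join points of equal level. For the lower bound one point is
  moved to a slightly different level, with an arbitrarily small error.\<close>

lemma parallel_dist_point_at_level:
  assumes par: "parallel \<alpha> \<beta>" and l: "0 \<le> l" "l \<le> 1"
  shows "dist (point_at (\<alpha> x) (\<beta> x) l) (point_at (\<alpha> x') (\<beta> x') l) = \<bar>x - x'\<bar>"
proof (rule antisym)
  note lines = parallelD(1,2)[OF par]
  let ?g = "dist (\<alpha> 0) (\<beta> 0)" and ?f = "\<lambda>x l. point_at (\<alpha> x) (\<beta> x) l"
  show "dist (?f x l) (?f x' l) \<le> \<bar>x - x'\<bar>"
    using point_at_contract[OF l, of "\<alpha> x" "\<beta> x" "\<alpha> x'" "\<beta> x'"]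
      geodesic_line_dist[OF lines(1), of x x'] geodesic_line_dist[OF lines(2), of x x']
    by (simp add: algebra_simps)
  show "\<bar>x - x'\<bar> \<le> dist (?f x l) (?f x' l)"
  proof (rule field_le_epsilon)
    fix e :: real assume e: "e > 0"
    \<comment> \<open>The bound \<open>1/2\<close> keeps \<open>l'\<close> in \<open>[0, 1]\<close>.
      The other term makes the error \<open>2 * h * ?g\<close> at most \<open>e\<close>: one
      \<open>h * ?g\<close> comes from estimating \<open>dist (\<alpha> 0) (\<beta> k)\<close>, one
      from the change of level.\<close>
    define h where "h = min (1/2) (e / (2 * ?g + 1))"
    have "h \<le> 1/2" unfolding h_def by (rule min.cobounded1)
    then have h: "h > 0" "h \<le> 1/2" using e by (auto simp: h_def add_nonneg_pos)
    have "h * (2 * ?g + 1) \<le> e / (2 * ?g + 1) * (2 * ?g + 1)"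
      by (rule mult_right_mono) (auto simp: h_def)
    also have "\<dots> = e" by (simp add: add_nonneg_eq_0_iff)
    finally have he: "2 * h * ?g \<le> e" using h by (simp add: algebra_simps)
    define l' where "l' = (if l \<le> 1/2 then l + h else l - h)"
    have l': "0 \<le> l'" "l' \<le> 1" "l \<noteq> l'" "\<bar>l' - l\<bar> = h" using l h by (auto simp: l'_def)
    define k where "k = (x' - x) / (l' - l)"
    have hk: "h * \<bar>k\<bar> = \<bar>x - x'\<bar>" using l'(3,4) by (simp add: k_def abs_divide abs_minus_commute)
    have "dist (\<alpha> 0) (\<beta> k) \<ge> \<bar>k\<bar> - ?g"
      using dist_triangle[of "\<beta> 0" "\<beta> k" "\<alpha> 0"] geodesic_line_dist[OF lines(2), of 0 k]
      by (simp add: dist_commute)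
    then have "h * (\<bar>k\<bar> - ?g) \<le> h * dist (\<alpha> 0) (\<beta> k)" using h by (intro mult_left_mono) auto
    then have "\<bar>x - x'\<bar> - h * ?g \<le> h * dist (\<alpha> 0) (\<beta> k)" using hk by (simp add: algebra_simps)
    also have "\<dots> = dist (?f x l) (?f x' l')"
      using parallel_dist_point_at[OF par l l'(1-3)] l'(4) by (simp add: k_def)
    also have "\<dots> \<le> dist (?f x l) (?f x' l) + dist (?f x' l) (?f x' l')" by (rule dist_triangle)
    also have "dist (?f x' l) (?f x' l') = h * ?g"
      using dist_point_at[OF l l'(1,2)] l'(4) parallelD(3)[OF par, of x'] by (simp add: abs_minus_commute)
    finally show "\<bar>x - x'\<bar> \<le> dist (?f x l) (?f x' l) + e" using he by simp
  qed
qed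

lemma strip_point_dist:
  assumes par: "parallel \<alpha> \<beta>" and d: "dist (\<alpha> 0) (\<beta> 0) > 0"
    and y: "0 \<le> y" "y \<le> dist (\<alpha> 0) (\<beta> 0)" "0 \<le> y'" "y' \<le> dist (\<alpha> 0) (\<beta> 0)"
  shows "dist (strip_point \<alpha> \<beta> x y) (strip_point \<alpha> \<beta> x' y') = strip_norm \<alpha> \<beta> (x' - x) (y' - y)"
proof -
  let ?d = "dist (\<alpha> 0) (\<beta> 0)"
  have l: "0 \<le> y / ?d" "y / ?d \<le> 1" "0 \<le> y' / ?d" "y' / ?d \<le> 1" using y d by auto
  show ?thesis
  proof (cases "y = y'")
    case True
    then show ?thesis
      using parallel_dist_point_at_level[OF par l(1,2), of x x']
      by (simp add: strip_point_def strip_norm_def abs_minus_commute)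
  next
    case False
    then have ne: "y / ?d \<noteq> y' / ?d" using d by simp
    have "(x' - x) / (y' / ?d - y / ?d) = (x' - x) * ?d / (y' - y)"
      by (simp add: diff_divide_distrib[symmetric])
    moreover have "\<bar>y' / ?d - y / ?d\<bar> = \<bar>y' - y\<bar> / ?d"
      using d by (simp add: diff_divide_distrib[symmetric] abs_divide)
    ultimately show ?thesis
      using parallel_dist_point_at[OF par l ne, of x x'] False
      by (simp add: strip_point_def strip_norm_def)
  qed
qed

text \<open>The scaled triangle inequality for \<open>\<alpha> 0\<close>, \<open>\<beta> 0\<close>,
  \<open>\<beta> ?k\<close>. The bounds do not depend on the strip, so they allow a limit and pass
  to it.\<close>

lemma strip_norm_bounds:
  assumes par: "parallel \<alpha> \<beta>" and d: "dist (\<alpha> 0) (\<beta> 0) > 0"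
  shows "\<bar>x\<bar> - \<bar>y\<bar> \<le> strip_norm \<alpha> \<beta> x y" "strip_norm \<alpha> \<beta> x y \<le> \<bar>x\<bar> + \<bar>y\<bar>"
proof -
  let ?d = "dist (\<alpha> 0) (\<beta> 0)"
  let ?k = "x * ?d / y"
  have "\<bar>?k\<bar> - ?d \<le> dist (\<alpha> 0) (\<beta> ?k)" "dist (\<alpha> 0) (\<beta> ?k) \<le> \<bar>?k\<bar> + ?d"
    using dist_triangle[of "\<beta> 0" "\<beta> ?k" "\<alpha> 0"] dist_triangle[of "\<alpha> 0" "\<beta> ?k" "\<beta> 0"]
      geodesic_line_dist[OF parallelD(2)[OF par], of 0 ?k]
    by (simp_all add: dist_commute)
  then have "\<bar>y\<bar> / ?d * (\<bar>?k\<bar> - ?d) \<le> \<bar>y\<bar> / ?d * dist (\<alpha> 0) (\<beta> ?k)"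
    "\<bar>y\<bar> / ?d * dist (\<alpha> 0) (\<beta> ?k) \<le> \<bar>y\<bar> / ?d * (\<bar>?k\<bar> + ?d)"
    by (intro mult_left_mono; simp)+
  moreover have "\<bar>y\<bar> / ?d * (\<bar>?k\<bar> - ?d) = \<bar>x\<bar> - \<bar>y\<bar>" "\<bar>y\<bar> / ?d * (\<bar>?k\<bar> + ?d) = \<bar>x\<bar> + \<bar>y\<bar>"
    if "y \<noteq> 0" using that d by (auto simp: field_simps abs_mult)
  ultimately show "\<bar>x\<bar> - \<bar>y\<bar> \<le> strip_norm \<alpha> \<beta> x y" "strip_norm \<alpha> \<beta> x y \<le> \<bar>x\<bar> + \<bar>y\<bar>"
    by (auto simp: strip_norm_def)
qed

text \<open>Scaled by a small \<open>r\<close>, both vectors can be laid end to end from half height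
  without leaving the strip, where the norm is the distance in the space.\<close>

lemma strip_norm_triangle:
  assumes par: "parallel \<alpha> \<beta>" and d: "dist (\<alpha> 0) (\<beta> 0) > 0"
  shows "strip_norm \<alpha> \<beta> (x + x') (y + y') \<le> strip_norm \<alpha> \<beta> x y + strip_norm \<alpha> \<beta> x' y'"
proof -
  let ?d = "dist (\<alpha> 0) (\<beta> 0)"
  define r where "r = ?d / 2 / (\<bar>y\<bar> + \<bar>y'\<bar> + 1)"
  have r: "r > 0" using d by (simp add: r_def)
  have "\<bar>y\<bar> + \<bar>y'\<bar> + 1 \<noteq> 0" by linarith
  then have "r * (\<bar>y\<bar> + \<bar>y'\<bar> + 1) = ?d / 2" unfolding r_def by (rule nonzero_eq_divide_eq[THEN iffD1]) simp
  then have "r * \<bar>y\<bar> + r * \<bar>y'\<bar> \<le> ?d / 2" using r by (simp add: algebra_simps)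
  then have ry: "\<bar>r * y\<bar> + \<bar>r * y'\<bar> \<le> ?d / 2" using r by (simp add: abs_mult)
  let ?f = "strip_point \<alpha> \<beta>" and ?h = "?d / 2"
  have b: "0 \<le> ?h" "?h \<le> ?d" "0 \<le> ?h + r * y" "?h + r * y \<le> ?d" "0 \<le> ?h + r * y + r * y'" "?h + r * y + r * y' \<le> ?d"
    using ry d by linarith+
  have "dist (?f 0 ?h) (?f (r * x + r * x') (?h + r * y + r * y')) \<le>
      dist (?f 0 ?h) (?f (r * x) (?h + r * y)) + dist (?f (r * x) (?h + r * y)) (?f (r * x + r * x') (?h + r * y + r * y'))"
    by (rule dist_triangle)
  then have "strip_norm \<alpha> \<beta> (r * (x + x')) (r * (y + y')) \<le> strip_norm \<alpha> \<beta> (r * x) (r * y) + strip_norm \<alpha> \<beta> (r * x') (r * y')"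
    using strip_point_dist[OF par d b(1,2,5,6)] strip_point_dist[OF par d b(1,2,3,4)] strip_point_dist[OF par d b(3-6)]
    by (simp add: algebra_simps)
  then have "\<bar>r\<bar> * strip_norm \<alpha> \<beta> (x + x') (y + y') \<le> \<bar>r\<bar> * strip_norm \<alpha> \<beta> x y + \<bar>r\<bar> * strip_norm \<alpha> \<beta> x' y'"
    unfolding strip_norm_scale .
  then have "r * strip_norm \<alpha> \<beta> (x + x') (y + y') \<le> r * (strip_norm \<alpha> \<beta> x y + strip_norm \<alpha> \<beta> x' y')"
    using r by (simp only: distrib_left abs_of_pos)
  then show ?thesis using r by simp
qed

lemma strip_norm_lower:
  assumes "dist (\<alpha> 0) (\<beta> 0) > 0" "\<And>u. dist (\<alpha> 0) (\<beta> 0) / 2 \<le> dist (\<alpha> 0) (\<beta> u)"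
  shows "\<bar>y\<bar> / 2 \<le> strip_norm \<alpha> \<beta> x y"
proof (cases "y = 0")
  case False
  let ?d = "dist (\<alpha> 0) (\<beta> 0)"
  have "\<bar>y\<bar> / 2 = \<bar>y\<bar> / ?d * (?d / 2)" using assms(1) by simp
  also have "\<dots> \<le> \<bar>y\<bar> / ?d * dist (\<alpha> 0) (\<beta> (x * ?d / y))"
    by (rule mult_left_mono[OF assms(2)]) simp
  finally show ?thesis using False by (simp add: strip_norm_def)
qed (simp add: strip_norm_def)

text \<open>Norms and strip coordinates converge along one ultrafilter; as the widths tend to
  infinity, each \<open>(x, y)\<close> with \<open>y \<ge> 0\<close> eventually lies in the strips.
  The uniform lower bounds \<open>\<bar>y\<bar> / 2\<close> and
  \<open>\<bar>x\<bar> - \<bar>y\<bar>\<close> make the limit definite.\<close>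

lemma half_plane_limit:
  assumes par: "\<And>n. parallel a (\<gamma> n)" and far: "\<And>n. real n < dist (a 0) (\<gamma> n 0)"
    and near: "\<And>n u. dist (a 0) (\<gamma> n 0) / 2 \<le> dist (a 0) (\<gamma> n u)"
  shows "\<exists>S. normed_semiplane S \<and> bounds_normed_semiplane a S"
proof -
  obtain F where F: "F \<le> sequentially" "ultrafilter F" using ultrafilter_below[of sequentially] by auto
  note F_nt = ultrafilter_nontrivial[OF F(2)]
  let ?d = "\<lambda>n. dist (a 0) (\<gamma> n 0)"
  have d: "?d n > 0" for n using far[of n] by linarith
  have big: "\<forall>\<^sub>F n in F. y \<le> ?d n" for y
  proof (rule filter_leD[OF F(1)])
    obtain N where N: "y \<le> real N" using real_arch_simple by blast
    show "\<forall>\<^sub>F n in sequentially. y \<le> ?d n"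
      using eventually_ge_at_top[of N]
    proof eventually_elim
      case (elim n)
      then show ?case using N far[of n] by linarith
    qed
  qed
  have "\<exists>l. ((\<lambda>n. strip_norm a (\<gamma> n) x y) \<longlongrightarrow> l) F" for x y
  proof -
    have "strip_norm a (\<gamma> n) x y \<in> {- \<bar>y\<bar> .. \<bar>x\<bar> + \<bar>y\<bar>}" for n
      using strip_norm_bounds[OF par[of n] d[of n], of x y] by simp
    then show ?thesis
      using ultrafilter_compact_limit[OF F(2) compact_Icc, of "\<lambda>n. strip_norm a (\<gamma> n) x y" "- \<bar>y\<bar>" "\<bar>x\<bar> + \<bar>y\<bar>"]
      by (auto intro: always_eventually)
  qed
  then obtain N where N: "\<And>x y. ((\<lambda>n. strip_norm a (\<gamma> n) x y) \<longlongrightarrow> N x y) F" by metis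
  have ex: "\<exists>l. ((\<lambda>n. strip_point a (\<gamma> n) x y) \<longlongrightarrow> l) F" if "y \<ge> 0" for x y
  proof (rule ultrafilter_limit[OF F(2)])
    \<comment> \<open>The reference point is \<open>a 0\<close>, which has coordinates
      \<open>(0, 0)\<close> in every strip.\<close>
    show "\<forall>\<^sub>F n in F. dist (strip_point a (\<gamma> 0) 0 0) (strip_point a (\<gamma> n) x y) \<le> \<bar>x\<bar> + \<bar>y\<bar>"
      using big[of y]
    proof eventually_elim
      case (elim n)
      have "strip_point a (\<gamma> 0) 0 0 = strip_point a (\<gamma> n) 0 0" by (simp add: strip_point_def)
      then have "dist (strip_point a (\<gamma> 0) 0 0) (strip_point a (\<gamma> n) x y) = strip_norm a (\<gamma> n) x y"
        using strip_point_dist[OF par[of n] d[of n], of 0 y 0 x] that elim by simp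
      then show ?case using strip_norm_bounds[OF par[of n] d[of n]] by simp
    qed
  qed
  define f where "f x y = (SOME l. ((\<lambda>n. strip_point a (\<gamma> n) x y) \<longlongrightarrow> l) F)" for x y
  have f: "((\<lambda>n. strip_point a (\<gamma> n) x y) \<longlongrightarrow> f x y) F" if "y \<ge> 0" for x y
    unfolding f_def by (rule someI_ex[OF ex[OF that]])
  have f_dist: "dist (f x y) (f x' y') = N (x' - x) (y' - y)" if y: "y \<ge> 0" "y' \<ge> 0" for x y x' y'
  proof (rule tendsto_unique[OF F_nt tendsto_dist[OF f[OF y(1)] f[OF y(2)]]])
    have "\<forall>\<^sub>F n in F. strip_norm a (\<gamma> n) (x' - x) (y' - y) = dist (strip_point a (\<gamma> n) x y) (strip_point a (\<gamma> n) x' y')"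
      using big[of y] big[of y']
    proof eventually_elim
      case (elim n)
      then show ?case using strip_point_dist[OF par[of n] d[of n] y(1) _ y(2), of x x'] by simp
    qed
    then show "((\<lambda>n. dist (strip_point a (\<gamma> n) x y) (strip_point a (\<gamma> n) x' y')) \<longlongrightarrow> N (x' - x) (y' - y)) F"
      by (rule Lim_transform_eventually[OF N])
  qed
  have f_0: "f x 0 = a x" for x
    using tendsto_unique[OF F_nt f[OF order_refl, of x], of "a x"] by (simp add: strip_point_def)
  have N_lower: "\<bar>y\<bar> / 2 \<le> N x y" "\<bar>x\<bar> - \<bar>y\<bar> \<le> N x y" for x y
  proof -
    have "\<bar>y\<bar> / 2 \<le> strip_norm a (\<gamma> n) x y" "\<bar>x\<bar> - \<bar>y\<bar> \<le> strip_norm a (\<gamma> n) x y" for n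
      using strip_norm_lower[of a "\<gamma> n", OF d[of n] near[of n]] strip_norm_bounds(1)[OF par[of n] d[of n]]
      by blast+
    then show "\<bar>y\<bar> / 2 \<le> N x y" "\<bar>x\<bar> - \<bar>y\<bar> \<le> N x y"
      using tendsto_lowerbound[OF N[of x y] always_eventually F_nt] by blast+
  qed
  have N_scale: "N (r * x) (r * y) = \<bar>r\<bar> * N x y" for r x y
    using tendsto_unique[OF F_nt N[of "r * x" "r * y"]] tendsto_mult_left[OF N[of x y], of "\<bar>r\<bar>"]
    unfolding strip_norm_scale by blast
  have N_triangle: "N (x + x') (y + y') \<le> N x y + N x' y'" for x x' y y'
    by (rule tendsto_le[OF F_nt tendsto_add[OF N N] N]) (simp add: strip_norm_triangle[OF par d])
  have N_pos: "N x y \<ge> 0" for x y using N_lower(1)[of y x] by linarith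
  have N_0: "N x y = 0 \<longleftrightarrow> x = 0 \<and> y = 0" for x y
    using N_lower[of y x] N_lower[of x y] N_scale[of 0 x y] by auto
  define u :: "real^2" where "u = axis 2 1"
  have u: "u \<bullet> v = v $ 2" for v by (simp add: u_def inner_axis')
  let ?N = "\<lambda>v :: real^2. N (v $ 1) (v $ 2)" and ?f = "\<lambda>v :: real^2. f (v $ 1) (v $ 2)"
  have "is_norm ?N"
    unfolding is_norm_def using N_pos N_0 N_scale N_triangle by (auto simp: vec_eq_iff forall_2)
  moreover have "u \<noteq> 0" by (simp add: u_def)
  moreover have "dist (?f v) (?f w) = ?N (v - w)" if "0 \<le> u \<bullet> v" "0 \<le> u \<bullet> w" for v w
    using f_dist[of "w $ 2" "v $ 2" "w $ 1" "v $ 1"] that by (simp add: u dist_commute)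
  ultimately have iso: "semiplane_isometry ?N u 0 ?f (?f ` {v. 0 \<le> u \<bullet> v})"
    unfolding semiplane_isometry_def by blast
  have "range a = ?f ` {v. u \<bullet> v = 0}"
  proof
    show "range a \<subseteq> ?f ` {v. u \<bullet> v = 0}"
    proof
      fix q assume "q \<in> range a"
      then obtain x where "q = a x" by blast
      then have "q = ?f (vector [x, 0])" "u \<bullet> (vector [x, 0] :: real^2) = 0" by (simp_all add: f_0 u)
      then show "q \<in> ?f ` {v. u \<bullet> v = 0}" by blast
    qed
  qed (auto simp: u f_0)
  then show ?thesis
    using iso unfolding normed_semiplane_def bounds_normed_semiplane_def by blast
qed

text \<open>\<open>\<Phi>\<close> is prescribed only on the half-line \<open>t \<ge> 0\<close> of
  \<open>a\<close>. On the other half the Lipschitz property still gives at most \<open>- t\<close>,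
  and a convex function with such a linear bound on the whole line is affine; likewise for
  \<open>\<Psi>\<close>.\<close>

lemma half_plane_if_horoballs_meet_unboundedly:
  assumes \<Phi>: "horo_limit F X \<Phi>" "\<Phi> p = 0" and \<Psi>: "horo_limit G Y \<Psi>" "\<Psi> p = 0"
    and a: "geodesic_line a" "a 0 = p" "\<And>t. t \<ge> 0 \<Longrightarrow> \<Phi> (a t) = - t" "\<And>t. t \<ge> 0 \<Longrightarrow> \<Psi> (a (- t)) = - t"
    and unb: "\<not> bounded {z. \<Phi> z \<le> 0 \<and> \<Psi> z \<le> 0}"
  shows "\<exists>S. normed_semiplane S \<and> bounds_normed_semiplane a S"
proof -
  have z: "\<exists>z. \<Phi> z \<le> 0 \<and> \<Psi> z \<le> 0 \<and> s \<le> dist p z" for s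
  proof (rule ccontr)
    assume "\<not> ?thesis"
    then have "\<forall>z\<in>{z. \<Phi> z \<le> 0 \<and> \<Psi> z \<le> 0}. dist p z \<le> s" by auto
    then show False using unb unfolding bounded_def by blast
  qed
  have a': "\<Phi> (a t) = - t" "\<Psi> (a t) = t" for t
  proof -
    have up: "\<Phi> (a t) \<le> \<bar>t\<bar>" "\<Psi> (a t) \<le> \<bar>t\<bar>" for t
      using horo_limit_lipschitz[OF \<Phi>(1), of "a t" p] horo_limit_lipschitz[OF \<Psi>(1), of "a t" p]
        \<Phi>(2) \<Psi>(2) geodesic_line_dist[OF a(1), of t 0] a(2) by simp_all
    have 1: "\<Phi> (a t) \<le> 0 + (- 1) * t" for t using up(1)[of t] a(3)[of t] by (cases "t \<ge> 0") auto
    have 2: "\<Psi> (a t) \<le> 0 + 1 * t" for t using up(2)[of t] a(4)[of "- t"] by (cases "t \<ge> 0") auto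
    show "\<Phi> (a t) = - t" "\<Psi> (a t) = t"
      using horo_limit_affine_on_line[OF \<Phi>(1) a(1) 1, of t] horo_limit_affine_on_line[OF \<Psi>(1) a(1) 2, of t]
        a(2) \<Phi>(2) \<Psi>(2) by simp_all
  qed
  have "\<forall>n. \<exists>\<gamma>. parallel a \<gamma> \<and> real n + 1 \<le> dist p (\<gamma> 0) \<and> (\<forall>u. dist p (\<gamma> 0) / 2 \<le> dist p (\<gamma> u))"
    using far_parallel_line[OF \<Phi> \<Psi> a(1,2) a' z] by blast
  then obtain \<gamma> where \<gamma>: "\<And>n :: nat. parallel a (\<gamma> n)" "\<And>n. real n + 1 \<le> dist p (\<gamma> n 0)"
    "\<And>n u. dist p (\<gamma> n 0) / 2 \<le> dist p (\<gamma> n u)" by metis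
  have "real n < dist p (\<gamma> n 0)" for n using \<gamma>(2)[of n] by simp
  then show ?thesis using half_plane_limit[of a \<gamma>] \<gamma>(1,3) a(2) by simp
qed

end

section \<open>Horofunctions and their centers\<close>

text \<open>Pointwise convergence on a finite \<open>e/3\<close>-net suffices, because the common
  Lipschitz constant controls the rest.\<close>

lemma lipschitz_uniform_limit:
  fixes f :: "'n \<Rightarrow> 'b::metric_space \<Rightarrow> 'c::metric_space"
  assumes S: "compact S" and f: "\<And>n x y. x \<in> S \<Longrightarrow> y \<in> S \<Longrightarrow> dist (f n x) (f n y) \<le> dist x y"
    and l: "\<And>x y. x \<in> S \<Longrightarrow> y \<in> S \<Longrightarrow> dist (l x) (l y) \<le> dist x y"
    and lim: "\<And>x. x \<in> S \<Longrightarrow> ((\<lambda>n. f n x) \<longlongrightarrow> l x) F"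
  shows "uniform_limit S f l F"
proof (rule uniform_limitI)
  fix e :: real assume e: "e > 0"
  have cover: "S \<subseteq> (\<Union>x\<in>S. ball x (e/3))" using e by auto
  obtain D where D: "D \<subseteq> S" "finite D" "S \<subseteq> (\<Union>x\<in>D. ball x (e/3))"
    using compactE_image[OF S _ cover] by auto
  have "\<forall>\<^sub>F n in F. \<forall>x\<in>D. dist (f n x) (l x) < e/3"
  proof (intro eventually_ball_finite D(2) ballI)
    fix x assume "x \<in> D"
    then show "\<forall>\<^sub>F n in F. dist (f n x) (l x) < e/3" using lim[of x] D(1) e by (intro tendstoD) auto
  qed
  then show "\<forall>\<^sub>F n in F. \<forall>x\<in>S. dist (f n x) (l x) < e"
  proof eventually_elim
    case (elim n)
    show ?case
    proof
      fix y assume y: "y \<in> S"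
      then obtain x where x: "x \<in> D" "dist x y < e/3" using D(3) by auto
      then have "dist (f n y) (f n x) < e/3" "dist (l x) (l y) < e/3"
        using f[of y x n] l[of x y] y D(1) by (auto simp: dist_commute)
      moreover have "dist (f n x) (l x) < e/3" using elim x by blast
      ultimately show "dist (f n y) (l y) < e"
        using dist_triangle[of "f n y" "l y" "f n x"] dist_triangle[of "f n x" "l y" "l x"] by linarith
    qed
  qed
qed

section \<open>Functions modulo constants and their sequential approximation\<close>

lemma mod_const_eq_iff: "mod_const f = mod_const g \<longleftrightarrow> (\<exists>k. g = (\<lambda>x. f x + k))"
proof
  have "g \<in> mod_const g" unfolding mod_const_def by (auto intro: exI[of _ 0])
  moreover assume "mod_const f = mod_const g"
  ultimately show "\<exists>k. g = (\<lambda>x. f x + k)" unfolding mod_const_def by blast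
next
  assume "\<exists>k. g = (\<lambda>x. f x + k)"
  then obtain k where k: "g = (\<lambda>x. f x + k)" ..
  have "\<exists>j'. (\<lambda>x. f x + j) = (\<lambda>x. f x + k + j')" for j by (rule exI[of _ "j - k"]) simp
  moreover have "\<exists>j'. (\<lambda>x. f x + k + j) = (\<lambda>x. f x + j')" for j by (rule exI[of _ "k + j"]) (simp add: add.assoc)
  ultimately show "mod_const f = mod_const g" unfolding mod_const_def k by auto
qed

lemma distance_class_eq_iff:
  "mod_const \<Phi> = distance_class x \<longleftrightarrow> (\<forall>y z. \<Phi> y - \<Phi> z = dist x y - dist x z)"
proof
  assume "mod_const \<Phi> = distance_class x"
  then obtain k where k: "(\<lambda>y. dist x y) = (\<lambda>y. \<Phi> y + k)" unfolding distance_class_def mod_const_eq_iff by blast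
  have "dist x y = \<Phi> y + k" for y using fun_cong[OF k, of y] .
  then show "\<forall>y z. \<Phi> y - \<Phi> z = dist x y - dist x z" by simp
next
  assume *: "\<forall>y z. \<Phi> y - \<Phi> z = dist x y - dist x z"
  have "dist x y = \<Phi> y + (dist x x - \<Phi> x)" for y using *[rule_format, of y x] by simp
  then show "mod_const \<Phi> = distance_class x" unfolding distance_class_def mod_const_eq_iff by blast
qed

lemma distance_class_inject: "distance_class x = distance_class y \<longleftrightarrow> x = y"
proof
  assume "distance_class x = distance_class y"
  then have "\<forall>z w. dist x z - dist x w = dist y z - dist y w"
    unfolding distance_class_eq_iff[symmetric] distance_class_def[of x] .
  from this[rule_format, of x y] show "x = y" by (simp add: dist_commute)
qed simp

lemma topspace_function_classes_topology:
  "topspace function_classes_topology = mod_const ` (continuous_functions :: ('a::metric_space \<Rightarrow> real) set)"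
  using quotient_imp_surjective_map[OF quotient_map_mod_const] topspace_bounded_uniform_topology
  by metis

text \<open>The uniform margin \<open>e\<close> strictly below the tolerance makes these sets open
  in any metric space. Radius and tolerance both depend on \<open>n\<close>, so a countable family
  replaces a base of neighbourhoods.\<close>

definition class_nbhd :: "'a::metric_space \<Rightarrow> ('a \<Rightarrow> real) \<Rightarrow> nat \<Rightarrow> ('a \<Rightarrow> real) set set" where
  "class_nbhd p \<Phi> n = {mod_const g |g. g \<in> continuous_functions \<and>
     (\<exists>e<1 / real (Suc n). \<forall>x\<in>cball p (real n). \<bar>g x - \<Phi> x\<bar> \<le> e)}"

lemma openin_class_nbhd: "openin function_classes_topology (class_nbhd p \<Phi> n)"
  unfolding openin_function_classes_topology openin_bounded_uniform_topology
proof (intro conjI ballI)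
  show "class_nbhd p \<Phi> n \<subseteq> mod_const ` continuous_functions" unfolding class_nbhd_def by blast
  show "{f \<in> continuous_functions. mod_const f \<in> class_nbhd p \<Phi> n} \<subseteq> continuous_functions" by blast
  fix f assume "f \<in> {f \<in> continuous_functions. mod_const f \<in> class_nbhd p \<Phi> n}"
  then obtain g e where g: "mod_const f = mod_const g" "g \<in> continuous_functions" "e < 1 / real (Suc n)"
    "\<And>x. x \<in> cball p (real n) \<Longrightarrow> \<bar>g x - \<Phi> x\<bar> \<le> e" unfolding class_nbhd_def by blast
  obtain k where k: "g = (\<lambda>x. f x + k)" using g(1) mod_const_eq_iff by blast
  obtain m where m: "e < m" "m < 1 / real (Suc n)" using dense[OF g(3)] by blast
  define d where "d = m - e"
  have d: "d > 0" "e + d < 1 / real (Suc n)" using m by (simp_all add: d_def)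
  have "mod_const h \<in> class_nbhd p \<Phi> n"
    if h: "h \<in> continuous_functions" "\<And>x. x \<in> cball p (real n) \<Longrightarrow> \<bar>h x - f x\<bar> < d" for h
  proof -
    have "(\<lambda>x. h x + k) \<in> continuous_functions"
      using h(1) unfolding continuous_functions_def by (auto intro: continuous_intros)
    moreover have "\<bar>(h x + k) - \<Phi> x\<bar> \<le> e + d" if "x \<in> cball p (real n)" for x
      using h(2)[OF that] g(4)[OF that] by (simp add: k)
    moreover have "mod_const h = mod_const (\<lambda>x. h x + k)" unfolding mod_const_eq_iff by blast
    ultimately show ?thesis unfolding class_nbhd_def using d(2) by blast
  qed
  then show "\<exists>B e. bounded B \<and> e > 0 \<and> {g \<in> continuous_functions. \<forall>x\<in>B. \<bar>g x - f x\<bar> < e} \<subseteq>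
      {f \<in> continuous_functions. mod_const f \<in> class_nbhd p \<Phi> n}"
    using d(1) by (intro exI[of _ "cball p (real n)"] exI[of _ d]) auto
qed

lemma mod_const_in_class_nbhd: "\<Phi> \<in> continuous_functions \<Longrightarrow> mod_const \<Phi> \<in> class_nbhd p \<Phi> n"
  unfolding class_nbhd_def by (auto intro!: exI[of _ \<Phi>] exI[of _ 0])

lemma class_nbhd_sequence:
  assumes "\<And>n. K n \<in> class_nbhd p \<Phi> n"
  shows "\<exists>g. (\<forall>n. K n = mod_const (g n)) \<and> (\<forall>r. uniform_limit (cball p r) g \<Phi> sequentially)"
proof -
  have "\<forall>n. \<exists>g. K n = mod_const g \<and> (\<forall>x\<in>cball p (real n). \<bar>g x - \<Phi> x\<bar> < 1 / real (Suc n))"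
    using assms unfolding class_nbhd_def by (force intro: le_less_trans)
  then obtain g where g: "\<And>n. K n = mod_const (g n)"
    "\<And>n x. x \<in> cball p (real n) \<Longrightarrow> \<bar>g n x - \<Phi> x\<bar> < 1 / real (Suc n)" by metis
  have "uniform_limit (cball p r) g \<Phi> sequentially" for r
  proof (rule uniform_limitI)
    fix e :: real assume e: "e > 0"
    obtain N where N: "r \<le> real N" using real_arch_simple by blast
    have "\<forall>\<^sub>F n in sequentially. 1 / real (Suc n) < e"
      using order_tendstoD(2)[OF LIMSEQ_Suc[OF lim_1_over_n] e] by simp
    then show "\<forall>\<^sub>F n in sequentially. \<forall>x\<in>cball p r. dist (g n x) (\<Phi> x) < e"
      using eventually_ge_at_top[of N]
    proof eventually_elim
      case (elim n)
      show ?case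
      proof
        fix x assume "x \<in> cball p r"
        then have "x \<in> cball p (real n)" using N elim(2) by auto
        then show "dist (g n x) (\<Phi> x) < e" using g(2)[of x n] elim(1) by (simp add: dist_real_def)
      qed
    qed
  qed
  then show ?thesis using g(1) by blast
qed

lemma compactification_representative:
  assumes "K \<in> horofunction_compactification"
  obtains \<Phi> where "K = mod_const \<Phi>" "\<Phi> \<in> continuous_functions"
  using assms closure_of_subset_topspace[of function_classes_topology "range distance_class"]
  unfolding horofunction_compactification_def topspace_function_classes_topology by blast

lemma mod_const_continuous:
  assumes "mod_const \<Phi> \<in> horofunction_compactification"
  shows "\<Phi> \<in> continuous_functions"
proof -
  obtain g where g: "mod_const g = mod_const \<Phi>" "g \<in> continuous_functions"
    using compactification_representative[OF assms] by metis
  then obtain k where "\<Phi> = (\<lambda>x. g x + k)" unfolding mod_const_eq_iff by blast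
  then show ?thesis using g(2) unfolding continuous_functions_def by (auto intro: continuous_intros)
qed

lemma compactification_sequence:
  assumes "mod_const \<Phi> \<in> horofunction_compactification"
  shows "\<exists>x :: nat \<Rightarrow> 'a::metric_space. \<forall>y z. (\<lambda>n. dist y (x n) - dist z (x n)) \<longlonglongrightarrow> \<Phi> y - \<Phi> z"
proof -
  have "\<exists>x. distance_class x \<in> class_nbhd p \<Phi> n" for p n
    using assms mod_const_in_class_nbhd[OF mod_const_continuous[OF assms], of p n] openin_class_nbhd[of p \<Phi> n]
    unfolding horofunction_compactification_def in_closure_of by blast
  \<comment> \<open>\<open>undefined\<close> is merely some base point of the balls.\<close>
  then obtain x where x: "\<And>n. distance_class (x n) \<in> class_nbhd undefined \<Phi> n" by metis
  obtain g where g: "\<And>n. distance_class (x n) = mod_const (g n)"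
    "\<And>r. uniform_limit (cball undefined r) g \<Phi> sequentially"
    using class_nbhd_sequence[OF x] by blast
  have lim: "(\<lambda>n. g n y) \<longlonglongrightarrow> \<Phi> y" for y
    by (rule tendsto_uniform_limitI[OF g(2)[of "dist undefined y"]]) simp
  have "g n y - g n z = dist y (x n) - dist z (x n)" for n y z
    using g(1)[of n, symmetric] unfolding distance_class_eq_iff by (simp add: dist_commute)
  then have "(\<lambda>n. dist y (x n) - dist z (x n)) \<longlonglongrightarrow> \<Phi> y - \<Phi> z" for y z
    using tendsto_diff[OF lim[of y] lim[of z]] by simp
  then show ?thesis by blast
qed

section \<open>Horofunctions as limits of distance functions along escaping points\<close>

context proper_busemann
begin

lemma bounded_distance_limit:
  assumes F: "ultrafilter F" and bd: "\<forall>\<^sub>F n in F. dist p (x n) \<le> R"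
    and lim: "\<And>y z. ((\<lambda>n. dist y (x n) - dist z (x n)) \<longlongrightarrow> \<Phi> y - \<Phi> z) F"
  shows "\<exists>w. (x \<longlongrightarrow> w) F \<and> mod_const \<Phi> = distance_class (w :: 'a)"
proof -
  obtain w where w: "(x \<longlongrightarrow> w) F" using ultrafilter_limit[OF F bd] by blast
  have "\<Phi> y - \<Phi> z = dist w y - dist w z" for y z
  proof (rule tendsto_unique[OF ultrafilter_nontrivial[OF F] lim])
    show "((\<lambda>n. dist y (x n) - dist z (x n)) \<longlongrightarrow> dist w y - dist w z) F"
      unfolding dist_commute[of w] by (intro tendsto_intros w)
  qed
  then show ?thesis using w distance_class_eq_iff by blast
qed

text \<open>Approximating points that stayed bounded along \<open>F\<close> would converge by
  properness, and the class of \<open>\<Phi>\<close> would be a distance class. Hence they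
  escape.\<close>

lemma horofunction_horo_limit:
  assumes "horofunction (\<Phi> :: 'a \<Rightarrow> real)"
  shows "\<exists>F (x :: nat \<Rightarrow> 'a). horo_limit F x \<Phi>"
proof -
  have K: "mod_const \<Phi> \<in> horofunction_compactification" "\<And>w. mod_const \<Phi> \<noteq> distance_class w"
    using assms unfolding horofunction_def horofunction_boundary_def by blast+
  obtain F where F: "F \<le> sequentially" "ultrafilter F" using ultrafilter_below[of sequentially] by auto
  obtain x where x: "\<And>y z. (\<lambda>n. dist y (x n) - dist z (x n)) \<longlonglongrightarrow> \<Phi> y - \<Phi> z"
    using compactification_sequence[OF K(1)] by blast
  have lim: "((\<lambda>n. dist y (x n) - dist z (x n)) \<longlongrightarrow> \<Phi> y - \<Phi> z) F" for y z
    using F(1) x by (rule tendsto_mono)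
  have "filterlim (\<lambda>n. dist y (x n)) at_top F" for y
  proof (rule ultrafilter_unbounded[OF F(2)])
    show "\<not> (\<forall>\<^sub>F n in F. dist y (x n) \<le> R)" for R
      using bounded_distance_limit[OF F(2) _ lim] K(2) by blast
  qed
  then show ?thesis using F(2) lim unfolding horo_limit_def by blast
qed

text \<open>A gradient ray from \<open>w\<close> descends below \<open>\<Phi> w\<close>, where a
  distance function from \<open>w\<close> has its minimum. Membership in the closure follows because
  pointwise limits of 1-Lipschitz functions are uniform on balls.\<close>

lemma horo_limit_horofunction:
  fixes \<Phi> :: "'a \<Rightarrow> real"
  assumes \<Phi>: "horo_limit F X \<Phi>"
  shows "horofunction \<Phi>"
proof -
  have F: "ultrafilter F" and lim: "\<And>y z. ((\<lambda>n. dist y (X n) - dist z (X n)) \<longlongrightarrow> \<Phi> y - \<Phi> z) F"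
    using \<Phi> unfolding horo_limit_def by blast+
  have cont: "\<Phi> \<in> continuous_functions"
    using horo_limit_continuous[OF \<Phi>] unfolding continuous_functions_def by blast
  have "mod_const \<Phi> \<noteq> distance_class w" for w
  proof
    assume "mod_const \<Phi> = distance_class w"
    then have *: "\<Phi> y - \<Phi> w = dist w y" for y unfolding distance_class_eq_iff by simp
    obtain c where c: "gradient_ray \<Phi> c" "c 0 = w" using gradient_ray_exists[OF \<Phi>] by blast
    then have "\<Phi> (c 1) = \<Phi> w - 1" using gradient_rayD[OF c(1), of 1] by simp
    then show False using *[of "c 1"] zero_le_dist[of w "c 1"] by linarith
  qed
  moreover have "mod_const \<Phi> \<in> horofunction_compactification"
    unfolding horofunction_compactification_def in_closure_of topspace_function_classes_topology
  proof (intro conjI allI impI)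
    show "mod_const \<Phi> \<in> mod_const ` continuous_functions" using cont by blast
    fix U assume U: "mod_const \<Phi> \<in> U \<and> openin function_classes_topology U"
    then obtain B e where B: "bounded B" "e > 0"
      "{g \<in> continuous_functions. \<forall>x\<in>B. \<bar>g x - \<Phi> x\<bar> < e} \<subseteq> {f \<in> continuous_functions. mod_const f \<in> U}"
      using cont unfolding openin_function_classes_topology openin_bounded_uniform_topology by blast
    obtain p r where r: "B \<subseteq> cball p r" using B(1) by (meson bounded_subset_cball)
    define g where "g n y = dist y (X n) - dist p (X n) + \<Phi> p" for n y
    have "uniform_limit (cball p r) g \<Phi> F"
    proof (rule lipschitz_uniform_limit[OF compact_cball])
      show "dist (g n y) (g n z) \<le> dist y z" for n y z
        using dist_triangle[of y "X n" z] dist_triangle[of z "X n" y]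
        by (simp add: g_def dist_real_def abs_le_iff dist_commute)
      show "dist (\<Phi> y) (\<Phi> z) \<le> dist y z" for y z
        using horo_limit_lipschitz[OF \<Phi>, of y z] horo_limit_lipschitz[OF \<Phi>, of z y]
        by (simp add: dist_real_def abs_le_iff dist_commute)
      show "((\<lambda>n. g n y) \<longlongrightarrow> \<Phi> y) F" for y
        using tendsto_add[OF lim[of y p] tendsto_const[of "\<Phi> p"]] by (simp add: g_def)
    qed
    then have "\<forall>\<^sub>F n in F. \<forall>y\<in>cball p r. dist (g n y) (\<Phi> y) < e" using B(2) by (rule uniform_limitD)
    then obtain n where n: "\<And>y. y \<in> cball p r \<Longrightarrow> dist (g n y) (\<Phi> y) < e"
      using eventually_happens'[OF ultrafilter_nontrivial[OF F]] by blast
    have "g n \<in> continuous_functions"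
      unfolding continuous_functions_def g_def by (auto intro!: continuous_intros)
    moreover have "\<forall>y\<in>B. \<bar>g n y - \<Phi> y\<bar> < e" using n r by (auto simp: dist_real_def)
    ultimately have "mod_const (g n) \<in> U" using B(3) by blast
    moreover have "mod_const (g n) = distance_class (X n)"
      unfolding distance_class_eq_iff by (simp add: g_def dist_commute)
    ultimately show "\<exists>y. y \<in> range distance_class \<and> y \<in> U" by auto
  qed
  ultimately show ?thesis unfolding horofunction_def horofunction_boundary_def by blast
qed

end

section \<open>Separation in the cone topology\<close>

lemma openin_cone_topology_radius:
  fixes p :: "'a::metric_space"
  shows "openin (cone_topology p) {z \<in> geodesic_compactification. cone_radius p z < r}"
    and "openin (cone_topology p) {z \<in> geodesic_compactification. r < cone_radius p z}"
proof -
  have *: "\<forall>\<^sub>F i in sequentially. s i \<in> geodesic_compactification"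
    if "range s \<subseteq> geodesic_compactification" for s :: "nat \<Rightarrow> 'a + 'a ideal_point"
    by (intro always_eventually allI) (use that in blast)
  show "openin (cone_topology p) {z \<in> geodesic_compactification. cone_radius p z < r}"
    unfolding openin_cone_topology
  proof (intro conjI ballI allI impI)
    fix z s assume z: "z \<in> {z \<in> geodesic_compactification. cone_radius p z < r}"
      and s: "range s \<subseteq> geodesic_compactification" "cone_converges p s z"
    have "\<forall>\<^sub>F i in sequentially. cone_radius p (s i) < r"
      using s(2) z unfolding cone_converges_def by (auto intro: order_tendstoD(2))
    then show "\<forall>\<^sub>F i in sequentially. s i \<in> {z \<in> geodesic_compactification. cone_radius p z < r}"
      using *[OF s(1)] by eventually_elim simp
  qed auto
  show "openin (cone_topology p) {z \<in> geodesic_compactification. r < cone_radius p z}"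
    unfolding openin_cone_topology
  proof (intro conjI ballI allI impI)
    fix z s assume z: "z \<in> {z \<in> geodesic_compactification. r < cone_radius p z}"
      and s: "range s \<subseteq> geodesic_compactification" "cone_converges p s z"
    have "\<forall>\<^sub>F i in sequentially. r < cone_radius p (s i)"
      using s(2) z unfolding cone_converges_def by (auto intro: order_tendstoD(1))
    then show "\<forall>\<^sub>F i in sequentially. s i \<in> {z \<in> geodesic_compactification. r < cone_radius p z}"
      using *[OF s(1)] by eventually_elim simp
  qed auto
qed

lemma openin_cone_topology_path:
  assumes "t \<ge> 0"
  shows "openin (cone_topology p) {z \<in> geodesic_compactification. dist (cone_path p z t) y < e}"
  unfolding openin_cone_topology
proof (intro conjI ballI allI impI)
  fix z s assume z: "z \<in> {z \<in> geodesic_compactification. dist (cone_path p z t) y < e}"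
    and s: "range s \<subseteq> geodesic_compactification" "cone_converges p s z"
  have "uniform_limit {0..t} (\<lambda>i. cone_path p (s i)) (cone_path p z) sequentially"
    using s(2) unfolding cone_converges_def by blast
  then have "(\<lambda>i. cone_path p (s i) t) \<longlonglongrightarrow> cone_path p z t"
    by (rule tendsto_uniform_limitI) (use assms in simp)
  then have "(\<lambda>i. dist (cone_path p (s i) t) y) \<longlonglongrightarrow> dist (cone_path p z t) y"
    by (intro tendsto_intros)
  then have "\<forall>\<^sub>F i in sequentially. dist (cone_path p (s i) t) y < e"
    by (rule order_tendstoD(2)) (use z in simp)
  then show "\<forall>\<^sub>F i in sequentially. s i \<in> {z \<in> geodesic_compactification. dist (cone_path p z t) y < e}"
    by eventually_elim (use s(1) in auto)
qed auto

context proper_busemann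
begin

lemma segment_to_dist:
  assumes "0 \<le> s" "s \<le> dist x (y :: 'a)" "0 \<le> t" "t \<le> dist x y"
  shows "dist (segment_to x y s) (segment_to x y t) = \<bar>s - t\<bar>"
  using segment_between_segment_to[of x y] assms
  unfolding segment_between_def distance_preserving_on_def by auto

lemma segment_to_ends: "segment_to x y 0 = x" "segment_to x (y :: 'a) (dist x y) = y"
  using segment_between_segment_to[of x y] unfolding segment_between_def by auto

lemma cone_path_lipschitz:
  assumes z: "z \<in> geodesic_compactification" and st: "s \<ge> 0" "t \<ge> 0"
  shows "dist (cone_path p z s) (cone_path p z t :: 'a) \<le> dist s t"
proof (cases z)
  case (Inl x)
  have "\<bar>min s (dist p x) - min t (dist p x)\<bar> \<le> \<bar>s - t\<bar>" by linarith
  then show ?thesis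
    using segment_to_dist[of "min s (dist p x)" p x "min t (dist p x)"] st Inl
    by (simp add: dist_real_def)
next
  case (Inr \<xi>)
  then have "\<xi> \<in> geodesic_boundary" using z by (auto simp: geodesic_compactification_def)
  then show ?thesis
    using ray_dist[OF geodesic_boundary_ray_to(1) st] Inr by (simp add: dist_real_def)
qed

text \<open>Different radii separate points. With equal radii the paths differ somewhere: for points
  of the space at the common radius, for ideal points because coinciding rays would be
  asymptotic.\<close>

lemma Hausdorff_cone_topology: "Hausdorff_space (cone_topology (p :: 'a))"
  unfolding Hausdorff_space_def topspace_cone_topology
proof (intro allI impI, elim conjE)
  fix z w :: "'a + 'a ideal_point"
  assume z: "z \<in> geodesic_compactification" and w: "w \<in> geodesic_compactification" and ne: "z \<noteq> w"
  let ?goal = "\<lambda>z w. \<exists>U V. openin (cone_topology p) U \<and> openin (cone_topology p) V \<and> z \<in> U \<and> w \<in> V \<and> disjnt U V"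
  have by_radius: "?goal z w"
    if lt: "cone_radius p z < cone_radius p w" and zw: "z \<in> geodesic_compactification" "w \<in> geodesic_compactification" for z w
  proof -
    obtain r where r: "cone_radius p z < r" "r < cone_radius p w" using dense[OF lt] by blast
    show ?thesis
      by (rule exI[of _ "{z \<in> geodesic_compactification. cone_radius p z < r}"],
          rule exI[of _ "{z \<in> geodesic_compactification. r < cone_radius p z}"])
        (use openin_cone_topology_radius r zw in \<open>auto simp: disjnt_iff\<close>)
  qed
  have by_path: "?goal z w" if t: "t \<ge> 0" "cone_path p z t \<noteq> cone_path p w t" for t
  proof -
    let ?x = "cone_path p z t" and ?y = "cone_path p w t"
    let ?B = "\<lambda>x. {z \<in> geodesic_compactification. dist (cone_path p z t) x < dist ?x ?y / 2}"
    have "disjnt (?B ?x) (?B ?y)"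
      unfolding disjnt_iff
    proof (intro allI notI, elim conjE)
      fix v assume "v \<in> ?B ?x" "v \<in> ?B ?y"
      then show False using dist_triangle2[of ?x ?y "cone_path p v t"] by (simp add: dist_commute)
    qed
    moreover have "z \<in> ?B ?x" "w \<in> ?B ?y" using z w t(2) by auto
    ultimately show ?thesis using openin_cone_topology_path[OF t(1)] by blast
  qed
  show "?goal z w"
  proof (cases "cone_radius p z = cone_radius p w")
    case False
    then show ?thesis using by_radius[OF _ z w] by_radius[OF _ w z]
      by (metis disjnt_sym linorder_neqE)
  next
    case True
    show ?thesis
    proof (cases z)
      case (Inl x)
      then obtain y where y: "w = Inl y" using True by (cases w) auto
      then have "dist p x = dist p y" using True Inl by simp
      then show ?thesis using by_path[of "dist p x"] ne segment_to_ends(2)[of p] Inl y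
        by (metis cone_path.simps(1) min.idem zero_le_dist)
    next
      case (Inr \<xi>)
      then obtain \<eta> where \<eta>: "w = Inr \<eta>" using True by (cases w) auto
      have b: "\<xi> \<in> geodesic_boundary" "\<eta> \<in> geodesic_boundary"
        using z w Inr \<eta> by (auto simp: geodesic_compactification_def)
      have "\<exists>t\<ge>0. ray_to p \<xi> t \<noteq> ray_to p \<eta> t"
      proof (rule ccontr)
        assume "\<not> ?thesis"
        then have "asymptotic (ray_to p \<xi>) (ray_to p \<eta>)"
          using asymptotic_iff_bounded geodesic_boundary_ray_to(1)[OF b(1)] geodesic_boundary_ray_to(1)[OF b(2)]
          by (metis dist_self order_refl)
        then show False
          using ray_class_eq_iff geodesic_boundary_ray_to[OF b(1), of p] geodesic_boundary_ray_to[OF b(2), of p]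
            ne Inr \<eta> by metis
      qed
      then show ?thesis using by_path Inr \<eta> by auto
    qed
  qed
qed

section \<open>The continuous extension of the identity\<close>

text \<open>The graph of the intended extension, kept as a relation because \<open>K\<close>
  determines neither \<open>\<Phi>\<close> nor \<open>c\<close>. That \<open>z\<close> is unique
  emerges in \<open>horo_to_geodesic_represents\<close>.\<close>

definition represents :: "'a \<Rightarrow> ('a \<Rightarrow> real) set \<Rightarrow> 'a + 'a ideal_point \<Rightarrow> bool" where
  "represents p K z \<longleftrightarrow> (\<exists>x. z = Inl x \<and> K = distance_class x) \<or>
     (\<exists>\<Phi> c. horofunction \<Phi> \<and> K = mod_const \<Phi> \<and> gradient_ray \<Phi> c \<and> c 0 = p \<and> z = Inr (ray_class c))"

lemma represents_compactification: "represents p K z \<Longrightarrow> z \<in> geodesic_compactification"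
  unfolding represents_def geodesic_compactification_def
  using ray_class_in_boundary gradient_ray_ray by blast

lemma represents_exists:
  assumes "K \<in> horofunction_compactification"
  shows "\<exists>z. represents p K z"
proof (cases "K \<in> range distance_class")
  case True
  then show ?thesis unfolding represents_def by blast
next
  case False
  obtain \<Phi> where \<Phi>: "K = mod_const \<Phi>" using compactification_representative[OF assms] by blast
  then have h: "horofunction \<Phi>"
    using assms False unfolding horofunction_def horofunction_boundary_def by blast
  then obtain F and X :: "nat \<Rightarrow> 'a" where "horo_limit F X \<Phi>" using horofunction_horo_limit by blast
  then obtain c where "gradient_ray \<Phi> c" "c 0 = p" using gradient_ray_exists by blast
  then show ?thesis unfolding represents_def using h \<Phi> by blast
qed

lemma represents_distance_class:
  assumes "represents p (distance_class x) z"
  shows "z = Inl x"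
proof -
  have "distance_class x \<noteq> mod_const \<Phi>" if "horofunction \<Phi>" for \<Phi>
    using that unfolding horofunction_def horofunction_boundary_def by (metis DiffD2 rangeI)
  then show ?thesis using assms distance_class_inject unfolding represents_def by blast
qed

lemma represents_Inr_horofunction:
  assumes "represents p (mod_const \<Phi>) (Inr \<xi>)"
  shows "horofunction \<Phi>"
  using assms unfolding represents_def horofunction_def by auto

text \<open>How far from \<open>p\<close> the path of \<open>z\<close> has come at time
  \<open>t \<ge> 0\<close>. The minimum is finite in the extended reals, so the conversion loses
  nothing.\<close>

definition reach :: "'a \<Rightarrow> 'a + 'a ideal_point \<Rightarrow> real \<Rightarrow> real" where
  "reach p z t = real_of_ereal (min (ereal t) (cone_radius p z))"

lemma reach_simps [simp]: "reach p (Inl x) t = min t (dist p x)" "reach p (Inr \<xi>) t = t"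
  unfolding reach_def by (simp_all add: min_def)

text \<open>The path of \<open>z\<close> descends \<open>\<Phi>\<close> at unit speed; by strict convexity of balls this determines it.\<close>

lemma represents_path:
  assumes rep: "represents p (mod_const \<Phi>) z" and t: "t \<ge> 0"
  shows "dist p (cone_path p z t) = reach p z t" "\<Phi> (cone_path p z t) = \<Phi> p - reach p z t"
proof -
  have "dist p (cone_path p z t) = reach p z t \<and> \<Phi> (cone_path p z t) = \<Phi> p - reach p z t"
  proof (cases z)
    case (Inl x)
    then have "mod_const \<Phi> = distance_class x" using rep unfolding represents_def by blast
    then have \<Phi>: "\<Phi> y - \<Phi> p = dist x y - dist x p" for y unfolding distance_class_eq_iff by blast
    let ?s = "min t (dist p x)"
    have s: "0 \<le> ?s" "?s \<le> dist p x" using t by auto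
    have "dist p (segment_to p x ?s) = ?s" "dist (segment_to p x ?s) x = dist p x - ?s"
      using segment_to_dist[of 0 p x ?s] segment_to_dist[of ?s p x "dist p x"] s
      by (simp_all add: segment_to_ends)
    then show ?thesis using \<Phi>[of "segment_to p x ?s"] Inl by (simp add: dist_commute)
  next
    case (Inr \<xi>)
    then obtain \<Psi> c where c: "mod_const \<Phi> = mod_const \<Psi>" "gradient_ray \<Psi> c" "c 0 = p" "\<xi> = ray_class c"
      using rep unfolding represents_def by blast
    obtain k where "\<Psi> = (\<lambda>x. \<Phi> x + k)" using c(1) unfolding mod_const_eq_iff by blast
    moreover have "ray_to p \<xi> t = c t" using ray_to_ray_class[OF gradient_ray_ray[OF c(2)] t] c(3,4) by simp
    ultimately show ?thesis
      using gradient_rayD[OF c(2) t] ray_dist_0[OF gradient_ray_ray[OF c(2)] t] c(3) Inr by simp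
  qed
  then show "dist p (cone_path p z t) = reach p z t" "\<Phi> (cone_path p z t) = \<Phi> p - reach p z t" by auto
qed

lemma represents_descent_unique:
  assumes rep: "represents p (mod_const \<Phi>) z" and t: "t \<ge> 0"
    and w: "dist p w \<le> reach p z t" "\<Phi> w \<le> \<Phi> p - reach p z t"
  shows "w = cone_path p z t"
proof (cases z)
  case (Inl x)
  then have "mod_const \<Phi> = distance_class x" using rep unfolding represents_def by blast
  then have \<Phi>: "\<Phi> y - \<Phi> p = dist x y - dist x p" for y unfolding distance_class_eq_iff by blast
  let ?s = "min t (dist p x)"
  have eq: "v = point_at p x (?s / dist p x)" if v: "dist p v \<le> ?s" "\<Phi> v \<le> \<Phi> p - ?s" for v
  proof (rule point_at_unique)
    show "0 \<le> ?s / dist p x" "?s / dist p x \<le> 1" using t by (auto simp: divide_le_eq)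
    show "dist p v \<le> ?s / dist p x * dist p x" using v t by (cases "p = x") auto
    have "dist v x \<le> dist p x - ?s" using v(2) \<Phi>[of v] by (simp add: dist_commute)
    then show "dist v x \<le> (1 - ?s / dist p x) * dist p x" using t by (cases "p = x") (auto simp: algebra_simps)
  qed
  show ?thesis using eq[of w] eq[of "cone_path p z t"] w represents_path[OF rep t] Inl by simp
next
  case (Inr \<xi>)
  then obtain F and X :: "nat \<Rightarrow> 'a" where \<Phi>: "horo_limit F X \<Phi>"
    using horofunction_horo_limit represents_Inr_horofunction rep by blast
  show ?thesis
    by (rule horo_limit_descent_unique[OF \<Phi>, of p _ "reach p z t"]) (use w represents_path[OF rep t] in auto)
qed

text \<open>Sequential continuity of the extension. Any ultrafilter limit \<open>v\<close> of path
  points satisfies \<open>\<Phi> v = \<Phi> p - dist p v\<close>; once the radii converge,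
  \<open>dist p v\<close> is the reach of \<open>w\<close>, and
  \<open>represents_descent_unique\<close> identifies \<open>v\<close>.\<close>

lemma represents_limit:
  assumes Kn: "\<And>n. represents p (mod_const (g n)) (z n)" and K: "represents p (mod_const \<Phi>) w"
    and lim: "\<And>r. uniform_limit (cball p r) g \<Phi> sequentially" and \<Phi>: "\<Phi> \<in> continuous_functions"
  shows "cone_converges p z w"
proof -
  have g_lim: "((\<lambda>n. g n y) \<longlongrightarrow> \<Phi> y) F" if "F \<le> sequentially" for y F
    using that by (rule tendsto_mono) (rule tendsto_uniform_limitI[OF lim[of "dist p y"]], simp)
  \<comment> \<open>The arguments move with \<open>n\<close>, so uniform convergence on a ball is
    combined with continuity of \<open>\<Phi>\<close>.\<close>
  have g_along: "((\<lambda>n. g n (v n)) \<longlongrightarrow> \<Phi> v') F"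
    if F: "F \<le> sequentially" and v: "(v \<longlongrightarrow> v') F" "\<And>n. dist p (v n) \<le> r" for v v' r F
  proof -
    have "(\<lambda>n. dist (g n (v n)) (\<Phi> (v n))) \<longlonglongrightarrow> 0"
      unfolding tendsto_iff
    proof (intro allI impI)
      fix e :: real assume "e > 0"
      then have "\<forall>\<^sub>F n in sequentially. \<forall>y\<in>cball p r. dist (g n y) (\<Phi> y) < e" by (rule uniform_limitD[OF lim])
      then show "\<forall>\<^sub>F n in sequentially. dist (dist (g n (v n)) (\<Phi> (v n))) 0 < e"
        by eventually_elim (use v(2) in simp)
    qed
    then have "((\<lambda>n. dist (g n (v n)) (\<Phi> (v n))) \<longlongrightarrow> 0) F" using F by (rule tendsto_mono[rotated])
    then have 0: "((\<lambda>n. g n (v n) - \<Phi> (v n)) \<longlongrightarrow> 0) F"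
      by (simp add: dist_real_def tendsto_rabs_zero_iff)
    have "isCont \<Phi> v'" using \<Phi> unfolding continuous_functions_def continuous_on_eq_continuous_at[OF open_UNIV] by simp
    then have "((\<lambda>n. \<Phi> (v n)) \<longlongrightarrow> \<Phi> v') F" using v(1) by (rule isCont_tendsto_compose)
    from tendsto_add[OF 0 this] show ?thesis by simp
  qed
  have bounded_case: "\<exists>x. w = Inl x \<and> ((\<lambda>n. cone_radius p (z n)) \<longlongrightarrow> ereal (dist p x)) F"
    if F: "F \<le> sequentially" "ultrafilter F" and bd: "\<forall>\<^sub>F n in F. cone_radius p (z n) \<le> ereal R" for F R
  proof -
    define x where "x n = projl (z n)" for n
    have ev: "\<forall>\<^sub>F n in F. z n = Inl (x n) \<and> dist p (x n) \<le> R"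
      using bd
    proof eventually_elim
      case (elim n)
      then show ?case by (cases "z n") (auto simp: x_def)
    qed
    have "((\<lambda>n. dist u (x n) - dist v (x n)) \<longlongrightarrow> \<Phi> u - \<Phi> v) F" for u v
    proof (rule Lim_transform_eventually[OF tendsto_diff[OF g_lim[OF F(1), of u] g_lim[OF F(1), of v]]])
      show "\<forall>\<^sub>F n in F. g n u - g n v = dist u (x n) - dist v (x n)"
        using ev
      proof eventually_elim
        case (elim n)
        then have "mod_const (g n) = distance_class (x n)" using Kn[of n] unfolding represents_def by auto
        then show ?case unfolding distance_class_eq_iff by (simp add: dist_commute)
      qed
    qed
    moreover have "\<forall>\<^sub>F n in F. dist p (x n) \<le> R" using ev by eventually_elim blast
    ultimately obtain y where y: "(x \<longlongrightarrow> y) F" "mod_const \<Phi> = distance_class y"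
      using bounded_distance_limit[OF F(2)] by blast
    have "w = Inl y" using represents_distance_class K y(2) by simp
    moreover have "((\<lambda>n. cone_radius p (z n)) \<longlongrightarrow> ereal (dist p y)) F"
    proof (rule Lim_transform_eventually)
      show "((\<lambda>n. ereal (dist p (x n))) \<longlongrightarrow> ereal (dist p y)) F" by (intro tendsto_intros y(1))
      show "\<forall>\<^sub>F n in F. ereal (dist p (x n)) = cone_radius p (z n)" using ev by eventually_elim simp
    qed
    ultimately show ?thesis by blast
  qed
  have path_limit: "\<exists>v. ((\<lambda>n. cone_path p (z n) t) \<longlongrightarrow> v) F \<and> ((\<lambda>n. reach p (z n) t) \<longlongrightarrow> dist p v) F \<and> \<Phi> v = \<Phi> p - dist p v"
    if F: "F \<le> sequentially" "ultrafilter F" and t: "t \<ge> 0" for t F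
  proof -
    note d = represents_path(1)[OF Kn t]
    have reach_le: "reach p (z n) t \<le> t" for n by (cases "z n") auto
    obtain v where v: "((\<lambda>n. cone_path p (z n) t) \<longlongrightarrow> v) F"
      using ultrafilter_limit[OF F(2), of p "\<lambda>n. cone_path p (z n) t" t] reach_le d by auto
    have r: "((\<lambda>n. reach p (z n) t) \<longlongrightarrow> dist p v) F"
      using tendsto_dist[OF tendsto_const[of p] v] by (simp add: d)
    have "((\<lambda>n. g n (cone_path p (z n) t)) \<longlongrightarrow> \<Phi> v) F"
      by (rule g_along[OF F(1) v, of t]) (simp add: d reach_le)
    moreover have "((\<lambda>n. g n (cone_path p (z n) t)) \<longlongrightarrow> \<Phi> p - dist p v) F"
      using tendsto_diff[OF g_lim[OF F(1), of p] r] by (simp add: represents_path(2)[OF Kn t])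
    ultimately show ?thesis using v r tendsto_unique[OF ultrafilter_nontrivial[OF F(2)]] by blast
  qed
  have radius: "(\<lambda>n. cone_radius p (z n)) \<longlonglongrightarrow> cone_radius p w"
  proof (rule tendsto_if_ultrafilters)
    fix F assume F: "F \<le> sequentially" "ultrafilter F"
    show "((\<lambda>n. cone_radius p (z n)) \<longlongrightarrow> cone_radius p w) F"
    proof (cases "\<exists>R. \<forall>\<^sub>F n in F. cone_radius p (z n) \<le> ereal R")
      case True
      then obtain R where "\<forall>\<^sub>F n in F. cone_radius p (z n) \<le> ereal R" ..
      from bounded_case[OF F this] show ?thesis by auto
    next
      case False
      have ev: "\<forall>\<^sub>F n in F. ereal R < cone_radius p (z n)" for R
      proof -
        have "\<forall>\<^sub>F n in F. \<not> cone_radius p (z n) \<le> ereal R" using False F(2) unfolding ultrafilter_def by blast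
        then show ?thesis by eventually_elim simp
      qed
      have "w \<noteq> Inl x" for x
      proof
        assume w: "w = Inl x"
        \<comment> \<open>One unit beyond \<open>x\<close>: the path limit at time \<open>R\<close>
          would lie at distance \<open>- 1\<close> from \<open>x\<close>.\<close>
        define R where "R = dist p x + 1"
        have R: "R \<ge> 0" unfolding R_def by (simp add: add_nonneg_nonneg)
        obtain v where v: "((\<lambda>n. reach p (z n) R) \<longlongrightarrow> dist p v) F" "\<Phi> v = \<Phi> p - dist p v"
          using path_limit[OF F R] by blast
        have "\<forall>\<^sub>F n in F. R = reach p (z n) R"
          using ev[of R] by eventually_elim (simp add: reach_def min_absorb1 less_imp_le)
        then have "((\<lambda>n. reach p (z n) R) \<longlongrightarrow> R) F" by (rule Lim_transform_eventually[OF tendsto_const])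
        then have "dist p v = R" using v(1) tendsto_unique[OF ultrafilter_nontrivial[OF F(2)]] by blast
        moreover have "mod_const \<Phi> = distance_class x" using K w unfolding represents_def by blast
        then have "\<Phi> v - \<Phi> p = dist x v - dist x p" unfolding distance_class_eq_iff by blast
        ultimately have "dist x v = - 1" using v(2) dist_commute[of p x] unfolding R_def by linarith
        then show False using zero_le_dist[of x v] by linarith
      qed
      then obtain \<xi> where "w = Inr \<xi>" by (cases w) auto
      then show ?thesis using ev by (simp add: tendsto_PInfty)
    qed
  qed
  have path: "(\<lambda>n. cone_path p (z n) t) \<longlonglongrightarrow> cone_path p w t" if t: "t \<ge> 0" for t
  proof (rule tendsto_if_ultrafilters)
    fix F assume F: "F \<le> sequentially" "ultrafilter F"
    obtain v where v: "((\<lambda>n. cone_path p (z n) t) \<longlongrightarrow> v) F" "((\<lambda>n. reach p (z n) t) \<longlongrightarrow> dist p v) F"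
      "\<Phi> v = \<Phi> p - dist p v" using path_limit[OF F t] by blast
    have rad: "((\<lambda>n. cone_radius p (z n)) \<longlongrightarrow> cone_radius p w) F" using F(1) radius by (rule tendsto_mono)
    have "((\<lambda>n. min (ereal t) (cone_radius p (z n))) \<longlongrightarrow> min (ereal t) (cone_radius p w)) F"
      by (intro tendsto_min tendsto_const rad)
    moreover have "min (ereal t) (cone_radius p w) = ereal (reach p w t)" by (cases w) (auto simp: min_def)
    ultimately have "((\<lambda>n. reach p (z n) t) \<longlongrightarrow> reach p w t) F"
      unfolding reach_def[of p "z _"] by (intro lim_real_of_ereal) simp
    then have "dist p v = reach p w t" using v(2) tendsto_unique[OF ultrafilter_nontrivial[OF F(2)]] by blast
    then have "v = cone_path p w t" using represents_descent_unique[OF K t, of v] v(3) by simp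
    then show "((\<lambda>n. cone_path p (z n) t) \<longlongrightarrow> cone_path p w t) F" using v(1) by simp
  qed
  have "uniform_limit {0..R} (\<lambda>n. cone_path p (z n)) (cone_path p w) sequentially" for R
  proof (rule lipschitz_uniform_limit[OF compact_Icc])
    fix s t :: real assume "s \<in> {0..R}" "t \<in> {0..R}"
    then have "0 \<le> s" "0 \<le> t" by auto
    then show "dist (cone_path p (z n) s) (cone_path p (z n) t) \<le> dist s t"
        "dist (cone_path p w s) (cone_path p w t) \<le> dist s t" for n
      using cone_path_lipschitz[OF represents_compactification] Kn K by blast+
  qed (use path in simp)
  then show ?thesis unfolding cone_converges_def using radius by blast
qed

text \<open>The chosen map agrees with \<open>h\<close>: both are continuous, they coincide on the
  dense image of the space, and the target is Hausdorff.\<close>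

lemma horo_to_geodesic_represents:
  assumes "K \<in> horofunction_compactification" "represents p K z"
  shows "horo_to_geodesic p K = z"
proof -
  let ?X = "subtopology function_classes_topology (horofunction_compactification :: ('a \<Rightarrow> real) set set)"
  let ?Y = "cone_topology p"
  define h where "h K = (SOME z. represents p K z)" for K
  have h: "represents p K (h K)" if "K \<in> horofunction_compactification" for K
    unfolding h_def by (rule someI_ex[OF represents_exists[OF that]])
  have comp_top: "horofunction_compactification \<subseteq> topspace (function_classes_topology :: ('a \<Rightarrow> real) set topology)"
    unfolding horofunction_compactification_def by (rule closure_of_subset_topspace)
  then have top: "topspace ?X = horofunction_compactification" by auto
  have range_comp: "range distance_class \<subseteq> (horofunction_compactification :: ('a \<Rightarrow> real) set set)"
    unfolding horofunction_compactification_def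
  proof (rule closure_of_subset)
    have "(\<lambda>y. dist x y) \<in> continuous_functions" for x :: 'a
      unfolding continuous_functions_def by (auto intro: continuous_intros)
    then show "range distance_class \<subseteq> topspace (function_classes_topology :: ('a \<Rightarrow> real) set topology)"
      unfolding topspace_function_classes_topology distance_class_def by blast
  qed
  have h_dist: "h (distance_class x) = Inl x" for x
    using represents_distance_class h range_comp by blast
  have limit: "\<forall>\<^sub>F n in sequentially. s n \<in> U"
    if z: "represents p (mod_const \<Phi>) z" "z \<in> U" and \<Phi>: "\<Phi> \<in> continuous_functions"
      and U: "openin ?Y U" and s: "\<And>n. represents p (K n) (s n)" "\<And>n. K n \<in> class_nbhd p \<Phi> n"
    for \<Phi> z U K s
  proof -
    obtain g where g: "\<And>n. K n = mod_const (g n)" "\<And>r. uniform_limit (cball p r) g \<Phi> sequentially"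
      using class_nbhd_sequence[OF s(2)] by blast
    have "cone_converges p s z"
      by (rule represents_limit[OF _ z(1) g(2) \<Phi>]) (use s(1) g(1) in simp)
    then show ?thesis
      using U z(2) represents_compactification[OF s(1)] unfolding openin_cone_topology by blast
  qed
  have cont: "continuous_map ?X ?Y h"
    unfolding continuous_map_def top topspace_cone_topology
  proof (intro conjI allI impI)
    show "h \<in> horofunction_compactification \<rightarrow> geodesic_compactification"
      using h represents_compactification by blast
    fix U assume U: "openin ?Y U"
    show "openin ?X {K \<in> horofunction_compactification. h K \<in> U}"
    proof (subst openin_subopen, intro ballI)
      fix K assume K: "K \<in> {K \<in> horofunction_compactification. h K \<in> U}"
      then obtain \<Phi> where \<Phi>: "K = mod_const \<Phi>" "\<Phi> \<in> continuous_functions"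
        using compactification_representative by blast
      have "\<exists>n. class_nbhd p \<Phi> n \<inter> horofunction_compactification \<subseteq> {K \<in> horofunction_compactification. h K \<in> U}"
      proof (rule ccontr)
        assume "\<not> ?thesis"
        then have "\<forall>n. \<exists>K. K \<in> class_nbhd p \<Phi> n \<and> K \<in> horofunction_compactification \<and> h K \<notin> U" by blast
        then obtain L where L: "\<And>n. L n \<in> class_nbhd p \<Phi> n" "\<And>n. L n \<in> horofunction_compactification"
          "\<And>n. h (L n) \<notin> U" by metis
        have "\<forall>\<^sub>F n in sequentially. h (L n) \<in> U"
          by (rule limit[OF _ _ \<Phi>(2) U h[OF L(2)] L(1)]) (use h K \<Phi>(1) in auto)
        then show False using L(3) by simp
      qed
      then obtain n where n: "class_nbhd p \<Phi> n \<inter> horofunction_compactification \<subseteq> {K \<in> horofunction_compactification. h K \<in> U}"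
        by blast
      have "openin ?X (class_nbhd p \<Phi> n \<inter> horofunction_compactification)"
        using openin_class_nbhd by (auto simp: openin_subtopology)
      moreover have "K \<in> class_nbhd p \<Phi> n \<inter> horofunction_compactification"
        using K \<Phi> mod_const_in_class_nbhd by blast
      ultimately show "\<exists>T. openin ?X T \<and> K \<in> T \<and> T \<subseteq> {K \<in> horofunction_compactification. h K \<in> U}"
        using n by blast
    qed
  qed
  have unique: "f K = f' K"
    if "continuous_map ?X ?Y f" "continuous_map ?X ?Y f'" "\<And>x. f (distance_class x) = f' (distance_class x)"
      "K \<in> horofunction_compactification" for f f' K
  proof (rule forall_in_closure_of_eq[OF _ Hausdorff_cone_topology that(1,2)])
    have "?X closure_of range distance_class = horofunction_compactification \<inter>
        (function_classes_topology closure_of (horofunction_compactification \<inter> range distance_class))"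
      by (rule closure_of_subtopology)
    also have "horofunction_compactification \<inter> range distance_class = (range distance_class :: ('a \<Rightarrow> real) set set)"
      using range_comp by blast
    also have "horofunction_compactification \<inter> (function_classes_topology closure_of range distance_class) =
      (horofunction_compactification :: ('a \<Rightarrow> real) set set)"
      unfolding horofunction_compactification_def by (rule Int_absorb)
    finally show "K \<in> ?X closure_of range distance_class" using that(4) by blast
  qed (use that(3) in auto)
  have "continuous_map ?X ?Y (horo_to_geodesic p) \<and> (\<forall>x. horo_to_geodesic p (distance_class x) = Inl x)"
    unfolding horo_to_geodesic_def by (rule someI[of _ h]) (use cont h_dist in blast)
  then have eq: "horo_to_geodesic p K = h K" if "K \<in> horofunction_compactification" for K
    using unique[of "horo_to_geodesic p" h] cont h_dist that by simp
  \<comment> \<open>The constant sequence \<open>K\<close> approximates itself, so its value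
    \<open>h K\<close> lies in every neighbourhood of \<open>z\<close>.\<close>
  have "h K = z"
  proof (rule ccontr)
    assume ne: "h K \<noteq> z"
    obtain \<Phi> where \<Phi>: "K = mod_const \<Phi>" "\<Phi> \<in> continuous_functions"
      using compactification_representative[OF assms(1)] by blast
    have zw: "h K \<in> topspace ?Y" "z \<in> topspace ?Y"
      unfolding topspace_cone_topology using represents_compactification h assms by blast+
    then obtain U V where UV: "openin ?Y U" "openin ?Y V" "h K \<in> U" "z \<in> V" "disjnt U V"
      using Hausdorff_cone_topology ne unfolding Hausdorff_space_def by meson
    have "\<forall>\<^sub>F n :: nat in sequentially. h K \<in> V"
      by (rule limit[OF assms(2)[unfolded \<Phi>(1)] UV(4) \<Phi>(2) UV(2), of "\<lambda>_. K"])
        (use h assms(1) \<Phi> mod_const_in_class_nbhd in auto)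
    then show False using UV(3,5) by (auto simp: disjnt_iff)
  qed
  then show ?thesis using eq assms(1) by simp
qed

lemma centered_in_iff:
  assumes "horofunction \<Phi>" "gradient_ray \<Phi> c" "c 0 = p"
  shows "centered_in p \<Phi> \<xi> \<longleftrightarrow> \<xi> = ray_class c"
proof -
  have "mod_const \<Phi> \<in> horofunction_compactification"
    using assms(1) unfolding horofunction_def horofunction_boundary_def by blast
  moreover have "represents p (mod_const \<Phi>) (Inr (ray_class c))"
    unfolding represents_def using assms by blast
  ultimately show ?thesis
    using horo_to_geodesic_represents unfolding centered_in_def by (metis sum.inject(2))
qed

end

section \<open>The relation Td and the equivalences\<close>

context proper_busemann
begin

lemma ray_divergence_eq:
  fixes c d :: "real \<Rightarrow> 'a"
  assumes "ray c" "ray d" "c 0 = p" "d 0 = p" and k: "\<And>t. t \<ge> 0 \<Longrightarrow> dist (c t) (d t) = 2 * k * t"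
  shows "ray_divergence p (ray_class c) (ray_class d) = k"
  unfolding ray_divergence_def
proof (rule tendsto_Lim)
  have "\<forall>\<^sub>F t in at_top. k = dist (ray_to p (ray_class c) t) (ray_to p (ray_class d) t) / (2 * t)"
    using eventually_gt_at_top[of 0]
  proof eventually_elim
    case (elim t)
    then show ?case
      using k[of t] ray_to_ray_class[OF assms(1), of t] ray_to_ray_class[OF assms(2), of t] assms(3,4) by simp
  qed
  then show "((\<lambda>t. dist (ray_to p (ray_class c) t) (ray_to p (ray_class d) t) / (2 * t)) \<longlongrightarrow> k) at_top"
    by (rule Lim_transform_eventually[OF tendsto_const])
qed simp

lemma rays_diverge_monotone:
  fixes c d :: "real \<Rightarrow> 'a"
  assumes "ray c" "ray d" "c 0 = d 0" "0 \<le> s" "s \<le> t" "0 < t"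
  shows "dist (c s) (d s) \<le> s / t * dist (c t) (d t)"
proof -
  have l: "0 \<le> s / t" "s / t \<le> 1" using assms by auto
  have "c s = point_at (c 0) (c t) (s / t)" "d s = point_at (d 0) (d t) (s / t)"
    using distance_preserving_point_at[OF assms(1)[unfolded ray_def], of 0 t "s / t"]
      distance_preserving_point_at[OF assms(2)[unfolded ray_def], of 0 t "s / t"] assms l by auto
  then show ?thesis using point_at_contract[OF l, of "c 0" "c t" "d 0" "d t"] assms(3) by simp
qed

text \<open>Contraction towards \<open>p\<close> makes the quotient non-decreasing, and it is at
  most 1. The limit is therefore a supremum and bounds every finite quotient.\<close>

lemma ray_divergence_upper:
  fixes \<xi> \<eta> :: "'a ideal_point"
  assumes "\<xi> \<in> geodesic_boundary" "\<eta> \<in> geodesic_boundary" "t \<ge> 0"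
  shows "dist (ray_to p \<xi> t) (ray_to p \<eta> t) \<le> ray_divergence p \<xi> \<eta> * (2 * t)"
proof (cases "t = 0")
  case True
  then show ?thesis using geodesic_boundary_ray_to(2) assms by simp
next
  case False
  define q where "q t = dist (ray_to p \<xi> t) (ray_to p \<eta> t) / (2 * t)" for t
  note c = geodesic_boundary_ray_to[OF assms(1), of p] and d = geodesic_boundary_ray_to[OF assms(2), of p]
  have mono: "q s \<le> q t" if "0 < s" "s \<le> t" for s t
    using rays_diverge_monotone[OF c(1) d(1), of s t] c(2) d(2) that by (simp add: q_def field_simps)
  have bd: "q t \<le> 1" if "t > 0" for t
    using dist_triangle[of "ray_to p \<xi> t" "ray_to p \<eta> t" p] ray_dist_0[OF c(1), of t] ray_dist_0[OF d(1), of t]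
      c(2) d(2) that by (simp add: q_def divide_le_eq dist_commute)
  define L where "L = (SUP t\<in>{0<..}. q t)"
  have bdd: "bdd_above (q ` {0<..})" using bd by (auto intro!: bdd_aboveI[of _ 1])
  have qL: "q t \<le> L" if "t > 0" for t unfolding L_def using that bdd by (intro cSUP_upper) auto
  have "(q \<longlongrightarrow> L) at_top"
  proof (rule order_tendstoI)
    fix x assume "x < L"
    then obtain s where s: "s > 0" "x < q s"
      using less_cSUP_iff[of "{0 :: real<..}" q x] bdd unfolding L_def by auto
    show "\<forall>\<^sub>F t in at_top. x < q t"
      using eventually_ge_at_top[of s] by eventually_elim (use s mono in \<open>force intro: less_le_trans\<close>)
  next
    fix x assume "L < x"
    show "\<forall>\<^sub>F t in at_top. q t < x"
      using eventually_gt_at_top[of 0] by eventually_elim (use qL \<open>L < x\<close> in \<open>force intro: le_less_trans\<close>)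
  qed
  then have "ray_divergence p \<xi> \<eta> = L"
    unfolding ray_divergence_def q_def by (intro tendsto_Lim) auto
  then show ?thesis using qL[of t] assms(3) False by (simp add: q_def divide_le_eq)
qed

text \<open>The ball around \<open>X n\<close> through \<open>b 0\<close> is convex and contains
  \<open>m n\<close>, hence the segment between them; the horoball receives the limits of these
  segments.\<close>

lemma limit_ray_in_horoball:
  assumes \<Phi>: "horo_limit F X \<Phi>" and m: "filterlim (\<lambda>n. dist (b 0) (m n)) at_top F" "ray_limit F m b"
    and near: "\<And>n. dist (m n) (X n) \<le> dist (b 0) (X n)" and s: "s \<ge> 0"
  shows "\<Phi> (b s) \<le> \<Phi> (b 0)"
proof -
  have F: "F \<noteq> bot" and lim: "((\<lambda>n. dist (b s) (X n) - dist (b 0) (X n)) \<longlongrightarrow> \<Phi> (b s) - \<Phi> (b 0)) F"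
    using \<Phi> ultrafilter_nontrivial unfolding horo_limit_def by blast+
  let ?q = "\<lambda>n. point_at (b 0) (m n) (s / dist (b 0) (m n))"
  have "(?q \<longlongrightarrow> b s) F" using m(2) s unfolding ray_limit_def by blast
  then have "((\<lambda>n. dist (b s) (?q n)) \<longlongrightarrow> dist (b s) (b s)) F" by (intro tendsto_intros)
  moreover have "\<forall>\<^sub>F n in F. max 0 s < dist (b 0) (m n)" using m(1) unfolding filterlim_at_top_dense by blast
  then have "\<forall>\<^sub>F n in F. dist (b s) (X n) - dist (b 0) (X n) \<le> dist (b s) (?q n)"
  proof eventually_elim
    case (elim n)
    let ?l = "s / dist (b 0) (m n)"
    have l: "0 \<le> ?l" "?l \<le> 1"
      using elim s by (simp_all only: divide_le_eq_1_pos divide_nonneg_pos max_less_iff_conj less_imp_le)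
    have "dist (?q n) (X n) \<le> (1 - ?l) * dist (b 0) (X n) + ?l * dist (m n) (X n)"
      by (rule dist_point_at_convex[OF l])
    also have "\<dots> \<le> (1 - ?l) * dist (b 0) (X n) + ?l * dist (b 0) (X n)"
      by (intro add_left_mono mult_left_mono near l)
    also have "\<dots> = dist (b 0) (X n)" by (simp add: algebra_simps)
    finally show ?case using dist_triangle[of "b s" "X n" "?q n"] by linarith
  qed
  ultimately have "\<Phi> (b s) - \<Phi> (b 0) \<le> dist (b s) (b s)" using tendsto_le[OF F _ lim] by blast
  then show ?thesis by simp
qed

text \<open>\<open>X n\<close> lies on \<open>c n\<close>, eventually beyond parameter
  \<open>s\<close>, so passing through \<open>c n s\<close> shows that \<open>a s\<close> is nearer
  to \<open>X n\<close> than \<open>a 0\<close> by \<open>s\<close>, up to an error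
  \<open>dist (a s) (c n s)\<close> that vanishes.\<close>

lemma gradient_ray_of_approximation:
  assumes \<Phi>: "horo_limit F X \<Phi>" and a: "ray a" and c: "\<And>n. ray (c n)" "\<And>n. c n 0 = a 0"
    and X: "\<And>n. t n \<ge> 0" "\<And>n. X n = c n (t n)" and lim: "\<And>s. s \<ge> 0 \<Longrightarrow> ((\<lambda>n. c n s) \<longlongrightarrow> a s) F"
  shows "gradient_ray \<Phi> a"
  unfolding gradient_ray_def
proof (intro conjI allI impI a)
  fix s :: real assume s: "s \<ge> 0"
  have F: "F \<noteq> bot" and lim\<Phi>: "((\<lambda>n. dist (a s) (X n) - dist (a 0) (X n)) \<longlongrightarrow> \<Phi> (a s) - \<Phi> (a 0)) F"
    and far: "filterlim (\<lambda>n. dist (a 0) (X n)) at_top F"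
    using \<Phi> ultrafilter_nontrivial unfolding horo_limit_def by blast+
  have X0: "dist (a 0) (X n) = t n" for n using ray_dist_0[OF c(1) X(1), of n n] c(2)[of n] X(2) by simp
  have "((\<lambda>n. dist (a s) (c n s) - s) \<longlongrightarrow> dist (a s) (a s) - s) F" by (intro tendsto_intros lim s)
  moreover have "\<forall>\<^sub>F n in F. s < dist (a 0) (X n)" using far unfolding filterlim_at_top_dense by blast
  then have "\<forall>\<^sub>F n in F. dist (a s) (X n) - dist (a 0) (X n) \<le> dist (a s) (c n s) - s"
  proof eventually_elim
    case (elim n)
    then show ?case
      using dist_triangle[of "a s" "X n" "c n s"] ray_dist[OF c(1) s X(1), of n n] X(2)[of n] X0[of n] by simp
  qed
  ultimately have "\<Phi> (a s) - \<Phi> (a 0) \<le> - s" using tendsto_le[OF F _ lim\<Phi>] by force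
  moreover have "\<Phi> (a 0) - \<Phi> (a s) \<le> s"
    using horo_limit_lipschitz[OF \<Phi>, of "a 0" "a s"] ray_dist_0[OF a s] by simp
  ultimately show "\<Phi> (a s) = \<Phi> (a 0) - s" by simp
qed

text \<open>Distance below 1 at parameter \<open>Suc n\<close> contracts towards \<open>p\<close> to
  at most \<open>s / Suc n\<close> at parameter \<open>s\<close>.\<close>

lemma cone_neighbourhood_sequence:
  assumes a: "ray a" "a 0 = (p :: 'a)"
  obtains U where "\<And>n :: nat. openin (cone_topology p) (U n)" "\<And>n. Inr (ray_class a) \<in> U n"
    "\<And>\<xi>. (\<And>n. Inr (\<xi> n) \<in> U n) \<Longrightarrow> (\<forall>n. \<xi> n \<in> geodesic_boundary) \<and>
      (\<forall>s\<ge>0. (\<lambda>n. ray_to p (\<xi> n) s) \<longlonglongrightarrow> a s)"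
proof
  define U where "U n = {z \<in> geodesic_compactification. dist (cone_path p z (real (Suc n))) (a (real (Suc n))) < 1}" for n
  show "openin (cone_topology p) (U n)" for n unfolding U_def by (rule openin_cone_topology_path) simp
  have "ray_to p (ray_class a) (real (Suc n)) = a (real (Suc n))" for n
    using ray_to_ray_class[OF a(1), of "real (Suc n)"] a(2) by simp
  then show "Inr (ray_class a) \<in> U n" for n
    unfolding U_def geodesic_compactification_def using ray_class_in_boundary[OF a(1)] by simp
  fix \<xi> assume \<xi>: "\<And>n. Inr (\<xi> n) \<in> U n"
  have b: "\<xi> n \<in> geodesic_boundary" for n using \<xi>[of n] unfolding U_def geodesic_compactification_def by auto
  have "(\<lambda>n. ray_to p (\<xi> n) s) \<longlonglongrightarrow> a s" if s: "s \<ge> 0" for s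
  proof (rule tendsto_dist_iff[THEN iffD2], rule tendsto_sandwich[OF _ _ tendsto_const])
    show "\<forall>\<^sub>F n in sequentially. 0 \<le> dist (ray_to p (\<xi> n) s) (a s)" by simp
    have "(\<lambda>n. s * (1 / real (Suc n))) \<longlonglongrightarrow> s * 0" by (intro tendsto_intros LIMSEQ_Suc[OF lim_1_over_n])
    then show "(\<lambda>n. s / real (Suc n)) \<longlonglongrightarrow> 0" by simp
    obtain N where N: "s \<le> real N" using real_arch_simple by blast
    show "\<forall>\<^sub>F n in sequentially. dist (ray_to p (\<xi> n) s) (a s) \<le> s / real (Suc n)"
      using eventually_ge_at_top[of N]
    proof eventually_elim
      case (elim n)
      then have "s \<le> real (Suc n)" using N by linarith
      then have "dist (ray_to p (\<xi> n) s) (a s) \<le> s / real (Suc n) * dist (ray_to p (\<xi> n) (real (Suc n))) (a (real (Suc n)))"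
        using s geodesic_boundary_ray_to[OF b[of n], of p] a by (intro rays_diverge_monotone) auto
      also have "\<dots> \<le> s / real (Suc n) * 1"
        using \<xi>[of n] s unfolding U_def by (intro mult_left_mono) auto
      finally show ?case by simp
    qed
  qed
  then show "(\<forall>n. \<xi> n \<in> geodesic_boundary) \<and> (\<forall>s\<ge>0. (\<lambda>n. ray_to p (\<xi> n) s) \<longlonglongrightarrow> a s)" using b by blast
qed

lemma horoballs_if_Td_le_pi:
  fixes a a' :: "real \<Rightarrow> 'a"
  assumes a: "ray a" "a 0 = p" and a': "ray a'" "a' 0 = p" and Td: "Td_le_pi p (ray_class a) (ray_class a')"
  shows "\<exists>\<Phi> \<Psi>. horofunction \<Phi> \<and> centered_in p \<Phi> (ray_class a) \<and> horofunction \<Psi> \<and> centered_in p \<Psi> (ray_class a') \<and>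
    \<not> bounded (horoball \<Phi> p \<inter> horoball \<Psi> p)"
proof -
  obtain U where U: "\<And>n. openin (cone_topology p) (U n)" "\<And>n. Inr (ray_class a) \<in> U n"
    "\<And>\<xi>. (\<And>n. Inr (\<xi> n) \<in> U n) \<Longrightarrow> (\<forall>n. \<xi> n \<in> geodesic_boundary) \<and> (\<forall>s\<ge>0. (\<lambda>n. ray_to p (\<xi> n) s) \<longlonglongrightarrow> a s)"
    using cone_neighbourhood_sequence[OF a] by blast
  obtain V where V: "\<And>n. openin (cone_topology p) (V n)" "\<And>n. Inr (ray_class a') \<in> V n"
    "\<And>\<xi>. (\<And>n. Inr (\<xi> n) \<in> V n) \<Longrightarrow> (\<forall>n. \<xi> n \<in> geodesic_boundary) \<and> (\<forall>s\<ge>0. (\<lambda>n. ray_to p (\<xi> n) s) \<longlonglongrightarrow> a' s)"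
    using cone_neighbourhood_sequence[OF a'] by blast
  have "\<forall>n. \<exists>\<xi> \<eta>. Inr \<xi> \<in> U n \<and> Inr \<eta> \<in> V n \<and> Td_less_pi p \<xi> \<eta>"
    using Td[unfolded Td_le_pi_def, rule_format, OF U(1) V(1) U(2) V(2)] by blast
  then obtain \<xi> \<eta> where in_UV: "\<And>n. Inr (\<xi> n) \<in> U n" "\<And>n. Inr (\<eta> n) \<in> V n" and less: "\<And>n. Td_less_pi p (\<xi> n) (\<eta> n)"
    by metis
  have b: "\<xi> n \<in> geodesic_boundary" "\<eta> n \<in> geodesic_boundary" for n
    using U(3)[of \<xi>] V(3)[of \<eta>] in_UV by blast+
  define c where "c n = ray_to p (\<xi> n)" for n
  define d where "d n = ray_to p (\<eta> n)" for n
  have c: "\<And>n. ray (c n)" "\<And>n. c n 0 = p" and d: "\<And>n. ray (d n)" "\<And>n. d n 0 = p"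
    using geodesic_boundary_ray_to b unfolding c_def d_def by blast+
  have c_lim: "(\<lambda>n. c n s) \<longlonglongrightarrow> a s" and d_lim: "(\<lambda>n. d n s) \<longlonglongrightarrow> a' s" if "s \<ge> 0" for s
    using U(3)[of \<xi>] V(3)[of \<eta>] in_UV that unfolding c_def d_def by blast+
  define mid where "mid n t = point_at (c n t) (d n t) (1/2)" for n t
  have "\<exists>t\<ge>real n. real n \<le> dist p (mid n t)" for n
  proof -
    define L where "L = ray_divergence p (\<xi> n) (\<eta> n)"
    have L: "L < 1" using less unfolding Td_less_pi_def L_def by blast
    \<comment> \<open>The first entry lets the endpoints escape. The triangle inequality puts the
      midpoint at distance at least \<open>(1 - L) * t\<close> from \<open>p\<close>, which the
      second entry makes at least \<open>n\<close>.\<close>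
    define t where "t = max (real n) (real n / (1 - L))"
    have t: "t \<ge> real n" "t \<ge> real n / (1 - L)" by (simp_all add: t_def)
    have t0: "t \<ge> 0" using t(1) of_nat_0_le_iff order_trans by blast
    have "real n \<le> (1 - L) * t" using t(2) L by (simp add: field_simps)
    moreover have "t \<le> dist p (mid n t) + dist (c n t) (d n t) / 2"
      using dist_triangle[of p "c n t" "mid n t"] ray_dist_0[OF c(1) t0, of n] c(2)
        dist_point_at_left[of "1/2" "c n t" "d n t"] by (simp add: mid_def dist_commute)
    moreover have "dist (c n t) (d n t) \<le> L * (2 * t)"
      unfolding c_def d_def L_def by (rule ray_divergence_upper[OF b t0])
    ultimately have "real n \<le> dist p (mid n t)" by (simp add: algebra_simps)
    then show ?thesis using t(1) by blast
  qed
  then obtain t where t: "\<And>n. real n \<le> t n" "\<And>n. real n \<le> dist p (mid n (t n))" by metis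
  have t0: "t n \<ge> 0" for n using t(1)[of n] of_nat_0_le_iff order_trans by blast
  define X where "X n = c n (t n)" for n
  define Y where "Y n = d n (t n)" for n
  define m where "m n = mid n (t n)" for n
  have dX: "dist p (X n) = t n" and dY: "dist p (Y n) = t n" for n
    using ray_dist_0[OF c(1) t0, of n n] ray_dist_0[OF d(1) t0, of n n] c(2)[of n] d(2)[of n]
    by (simp_all add: X_def Y_def)
  have XY: "dist (X n) (Y n) \<le> 2 * t n" for n
    using dist_triangle[of "X n" "Y n" p] dX dY by (simp add: dist_commute)
  have near: "dist (m n) (X n) \<le> dist p (X n)" "dist (m n) (Y n) \<le> dist p (Y n)" for n
    using dist_point_at_left[of "1/2" "X n" "Y n"] dist_point_at_right[of "1/2" "X n" "Y n"] XY[of n] dX dY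
    by (simp_all add: m_def mid_def X_def Y_def dist_commute)
  obtain F where F: "F \<le> sequentially" "ultrafilter F" using ultrafilter_below[of sequentially] by auto
  have top: "filterlim r at_top F" if "\<And>n. real n \<le> r n" for r :: "nat \<Rightarrow> real"
  proof -
    have "filterlim r at_top sequentially"
      using that by (intro filterlim_at_top_mono[OF filterlim_real_sequentially]) auto
    then show ?thesis using F(1) by (rule filterlim_mono[OF _ order_refl])
  qed
  obtain \<Phi> where \<Phi>: "horo_limit F X \<Phi>" using horo_limit_exists[OF F(2) top, of p X] t(1) dX by auto
  obtain \<Psi> where \<Psi>: "horo_limit F Y \<Psi>" using horo_limit_exists[OF F(2) top, of p Y] t(1) dY by auto
  have m_top: "filterlim (\<lambda>n. dist p (m n)) at_top F" using t(2) by (intro top) (simp add: m_def)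
  obtain b where b: "ray b" "b 0 = p" "ray_limit F m b" using ray_limit_exists[OF F(2) m_top] by blast
  have in_horoballs: "b s \<in> horoball \<Phi> p \<inter> horoball \<Psi> p" if "s \<ge> 0" for s
    using limit_ray_in_horoball[OF \<Phi> _ b(3) _ that] limit_ray_in_horoball[OF \<Psi> _ b(3) _ that]
      m_top near b(2) by (simp add: horoball_def)
  have "\<not> bounded (horoball \<Phi> p \<inter> horoball \<Psi> p)"
  proof
    assume "bounded (horoball \<Phi> p \<inter> horoball \<Psi> p)"
    then obtain r where r: "\<And>x. x \<in> horoball \<Phi> p \<inter> horoball \<Psi> p \<Longrightarrow> dist p x \<le> r"
      unfolding bounded_any_center[where a = p] by blast
    have "dist p (b (\<bar>r\<bar> + 1)) = \<bar>r\<bar> + 1" using ray_dist_0[OF b(1), of "\<bar>r\<bar> + 1"] b(2) by simp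
    then show False using r[OF in_horoballs[of "\<bar>r\<bar> + 1"]] by simp
  qed
  moreover have "gradient_ray \<Phi> a"
    by (rule gradient_ray_of_approximation[OF \<Phi> a(1) c(1) _ t0 X_def tendsto_mono[OF F(1) c_lim]])
      (use c(2) a(2) in simp_all)
  moreover have "gradient_ray \<Psi> a'"
    by (rule gradient_ray_of_approximation[OF \<Psi> a'(1) d(1) _ t0 Y_def tendsto_mono[OF F(1) d_lim]])
      (use d(2) a'(2) in simp_all)
  ultimately show ?thesis
    using horo_limit_horofunction \<Phi> \<Psi> centered_in_iff a(2) a'(2) by metis
qed

text \<open>The gradient ray from \<open>p\<close> is asymptotic to \<open>a\<close> and has the
  same origin, so \<open>a\<close> itself is that ray.\<close>

lemma centered_gradient_ray:
  assumes "horofunction \<Phi>" "centered_in p \<Phi> (ray_class a)" "ray a" "a 0 = p"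
  shows "\<exists>F (X :: nat \<Rightarrow> 'a). horo_limit F X (\<lambda>x. \<Phi> x - \<Phi> p)" "t \<ge> 0 \<Longrightarrow> \<Phi> (a t) = \<Phi> p - t"
proof -
  obtain F and X :: "nat \<Rightarrow> 'a" where \<Phi>: "horo_limit F X \<Phi>" using horofunction_horo_limit[OF assms(1)] by blast
  then have "horo_limit F X (\<lambda>x. \<Phi> x - \<Phi> p)" unfolding horo_limit_def by simp
  then show "\<exists>F (X :: nat \<Rightarrow> 'a). horo_limit F X (\<lambda>x. \<Phi> x - \<Phi> p)" by blast
  assume t: "t \<ge> 0"
  obtain c where c: "gradient_ray \<Phi> c" "c 0 = p" using gradient_ray_exists[OF \<Phi>] by blast
  then have "ray_class a = ray_class c" using centered_in_iff assms(1,2) by blast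
  then have "asymptotic a c" using ray_class_eq_iff assms(3) gradient_ray_ray[OF c(1)] by blast
  then have "a t = c t" using asymptotic_rays_unique[OF assms(3) gradient_ray_ray[OF c(1)]] assms(4) c(2) t by simp
  then show "\<Phi> (a t) = \<Phi> p - t" using gradient_rayD[OF c(1) t] c(2) by simp
qed

lemma half_plane_if_centered_horoballs:
  fixes a :: "real \<Rightarrow> 'a"
  assumes a: "geodesic_line a" "a 0 = p"
    and "horofunction \<Phi>" "centered_in p \<Phi> (end_plus a)" "horofunction \<Psi>" "centered_in p \<Psi> (end_minus a)"
    and unb: "\<not> bounded (horoball \<Phi> p \<inter> horoball \<Psi> p)"
  shows "\<exists>S. normed_semiplane S \<and> bounds_normed_semiplane a S"
proof -
  note r = geodesic_line_ray[OF a(1)] geodesic_line_ray[OF geodesic_line_reverse[OF a(1)]]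
  note \<Phi> = centered_gradient_ray[OF assms(3) assms(4)[unfolded end_plus_def] r(1) a(2)]
  have "a (- 0) = p" using a(2) by simp
  note \<Psi> = centered_gradient_ray[OF assms(5) assms(6)[unfolded end_minus_def] r(2) this]
  obtain F and X :: "nat \<Rightarrow> 'a" where F: "horo_limit F X (\<lambda>x. \<Phi> x - \<Phi> p)" using \<Phi>(1) by blast
  obtain G and Y :: "nat \<Rightarrow> 'a" where G: "horo_limit G Y (\<lambda>x. \<Psi> x - \<Psi> p)" using \<Psi>(1) by blast
  show ?thesis
    by (rule half_plane_if_horoballs_meet_unboundedly[OF F _ G _ a])
      (use \<Phi>(2) \<Psi>(2) unb in \<open>simp_all add: horoball_def Int_def\<close>)
qed

end

section \<open>Half-planes with a norm\<close>

lemma is_normD: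
  assumes "is_norm N"
  shows "N v \<ge> 0" "N v = 0 \<longleftrightarrow> v = 0" "N (r *\<^sub>R v) = \<bar>r\<bar> * N v" "N (v + w) \<le> N v + N w"
  using assms unfolding is_norm_def by blast+

lemma is_norm_minus: "is_norm N \<Longrightarrow> N (- v) = N v"
  using is_normD(3)[of N "- 1" v] by simp

text \<open>Replacing \<open>e\<close> by \<open>x\<close> costs \<open>N (x - e)\<close>, and so
  does rescaling \<open>x\<close>, because \<open>N x\<close> differs from 1 by no more than
  that.\<close>

lemma is_norm_normalize:
  assumes N: "is_norm N" and "x \<noteq> 0" "N e = 1"
  shows "N ((1 / N x) *\<^sub>R x) = 1" "N ((1 / N x) *\<^sub>R x - e) \<le> 2 * N (x - e)"
proof -
  have pos: "N x > 0" using is_normD(1,2)[OF N, of x] assms(2) by linarith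
  then show "N ((1 / N x) *\<^sub>R x) = 1" by (simp add: is_normD(3)[OF N])
  have "N x \<le> N e + N (x - e)" using is_normD(4)[OF N, of e "x - e"] by simp
  moreover have "N e \<le> N x + N (- (x - e))" using is_normD(4)[OF N, of x "- (x - e)"] by simp
  then have "N e \<le> N x + N (x - e)" by (simp only: is_norm_minus[OF N])
  ultimately have *: "\<bar>1 - N x\<bar> \<le> N (x - e)" using assms(3) by simp
  have "(1 / N x) *\<^sub>R x - e = ((1 - N x) / N x) *\<^sub>R x + (x - e)"
    using pos by (simp add: diff_divide_distrib scaleR_diff_left)
  then have "N ((1 / N x) *\<^sub>R x - e) \<le> \<bar>(1 - N x) / N x\<bar> * N x + N (x - e)"
    using is_normD(4)[OF N, of "((1 - N x) / N x) *\<^sub>R x" "x - e"] by (simp only: is_normD(3)[OF N])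
  then show "N ((1 / N x) *\<^sub>R x - e) \<le> 2 * N (x - e)" using * pos by (simp add: abs_divide)
qed

lemma real2_orthogonal_collinear:
  fixes u e x :: "real^2"
  assumes "u \<noteq> 0" "e \<noteq> 0" "u \<bullet> e = 0" "u \<bullet> x = 0"
  shows "\<exists>r. x = r *\<^sub>R e"
proof -
  have ue: "u $ 1 * e $ 1 + u $ 2 * e $ 2 = 0" "u $ 1 * x $ 1 + u $ 2 * x $ 2 = 0"
    using assms(3,4) by (simp_all add: inner_vec_def sum_2)
  have "u $ 1 * (x $ 1 * e $ 2 - x $ 2 * e $ 1) = 0" "u $ 2 * (x $ 1 * e $ 2 - x $ 2 * e $ 1) = 0"
    using ue by algebra+
  moreover have "u $ 1 \<noteq> 0 \<or> u $ 2 \<noteq> 0" using assms(1) by (auto simp: vec_eq_iff forall_2)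
  ultimately have cross: "x $ 1 * e $ 2 = x $ 2 * e $ 1" by auto
  have "e $ 1 \<noteq> 0 \<or> e $ 2 \<noteq> 0" using assms(2) by (auto simp: vec_eq_iff forall_2)
  then show ?thesis
  proof
    assume "e $ 1 \<noteq> 0"
    then have "x = (x $ 1 / e $ 1) *\<^sub>R e" using cross by (simp add: vec_eq_iff forall_2 field_simps)
    then show ?thesis ..
  next
    assume "e $ 2 \<noteq> 0"
    then have "x = (x $ 2 / e $ 2) *\<^sub>R e" using cross by (simp add: vec_eq_iff forall_2 field_simps)
    then show ?thesis ..
  qed
qed

lemma semiplane_isometryD:
  assumes "semiplane_isometry N u b f S"
  shows "is_norm N" "u \<noteq> 0" "\<And>v w. b \<le> u \<bullet> v \<Longrightarrow> b \<le> u \<bullet> w \<Longrightarrow> dist (f v) (f w) = N (v - w)"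
  using assms unfolding semiplane_isometry_def by blast+

text \<open>Preimages of \<open>a t\<close> lie on the boundary line, where the distances to two of
  them, \<open>w 0\<close> and \<open>w 1\<close>, fix the position; a single one would leave a
  reflection possible.\<close>

lemma boundary_line_parametrization:
  assumes iso: "semiplane_isometry N u b f S" and a: "geodesic_line a" "range a = f ` {v. u \<bullet> v = b}"
  obtains x e where "u \<bullet> x = b" "u \<bullet> e = 0" "N e = 1" "\<And>t. a t = f (x + t *\<^sub>R e)"
proof -
  note N = semiplane_isometryD(1)[OF iso]
  have "\<forall>t. \<exists>v. u \<bullet> v = b \<and> a t = f v"
  proof
    fix t have "a t \<in> f ` {v. u \<bullet> v = b}" using a(2) by blast
    then show "\<exists>v. u \<bullet> v = b \<and> a t = f v" by auto
  qed
  then obtain w where w: "\<And>t. u \<bullet> w t = b" "\<And>t. a t = f (w t)" by metis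
  have Nw: "N (w s - w t) = \<bar>s - t\<bar>" for s t
    using semiplane_isometryD(3)[OF iso, of "w s" "w t"] w geodesic_line_dist[OF a(1), of s t] by simp
  define e where "e = w 1 - w 0"
  have e: "u \<bullet> e = 0" "N e = 1" using w(1) Nw[of 1 0] by (simp_all add: e_def inner_diff_right)
  then have "e \<noteq> 0" using is_normD(2)[OF N, of e] by auto
  have "w t = w 0 + t *\<^sub>R e" for t
  proof -
    have "u \<bullet> (w t - w 0) = 0" using w(1) by (simp add: inner_diff_right)
    then obtain r where r: "w t - w 0 = r *\<^sub>R e"
      using real2_orthogonal_collinear[OF semiplane_isometryD(2)[OF iso] \<open>e \<noteq> 0\<close> e(1)] by blast
    have "\<bar>r\<bar> = \<bar>t\<bar>" using Nw[of t 0] r is_normD(3)[OF N, of r e] e(2) by simp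
    moreover have "w t - w 1 = (r - 1) *\<^sub>R e" using r by (simp add: e_def algebra_simps)
    then have "\<bar>r - 1\<bar> = \<bar>t - 1\<bar>" using Nw[of t 1] is_normD(3)[OF N, of "r - 1" e] e(2) by simp
    ultimately have "r = t" by linarith
    then show ?thesis using r by (simp add: algebra_simps)
  qed
  then show ?thesis using that[of "w 0" e] w e by metis
qed

context proper_busemann
begin

text \<open>If \<open>N (v - w) = 2\<close>, then \<open>f x\<close> and \<open>f m\<close> are both
  midpoints of \<open>f (x + v)\<close> and \<open>f (x + w)\<close>. Uniqueness of midpoints gives
  \<open>v + w = 0\<close>, which is impossible for two inward vectors.\<close>

lemma semiplane_strictly_convex:
  fixes f :: "real^2 \<Rightarrow> 'a"
  assumes iso: "semiplane_isometry N u b f S" and x: "u \<bullet> x = b"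
    and v: "N v = 1" "u \<bullet> v > 0" and w: "N w = 1" "u \<bullet> w > 0"
  shows "N (v - w) < 2"
proof (rule ccontr)
  note N = semiplane_isometryD(1)[OF iso]
  assume "\<not> N (v - w) < 2"
  moreover have "N (v - w) \<le> 2"
    using is_normD(4)[OF N, of v "- w"] is_norm_minus[OF N, of w] v(1) w(1) by simp
  ultimately have vw: "N (v - w) = 2" by simp
  have half: "N ((1/2) *\<^sub>R z) = N z / 2" for z using is_normD(3)[OF N, of "1/2" z] by simp
  define m where "m = x + (1/2) *\<^sub>R (v + w)"
  have in_plane: "b \<le> u \<bullet> x" "b \<le> u \<bullet> (x + v)" "b \<le> u \<bullet> (x + w)" "b \<le> u \<bullet> m"
    using x v(2) w(2) by (simp_all add: m_def inner_add_right)
  note d = semiplane_isometryD(3)[OF iso]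
  have PQ: "dist (f (x + v)) (f (x + w)) = 2" using d[OF in_plane(2,3)] vw by simp
  have "x + v - m = (1/2) *\<^sub>R (v - w)" "m - (x + w) = (1/2) *\<^sub>R (v - w)"
    by (simp_all add: m_def algebra_simps scaleR_add_left[symmetric])
  then have "dist (f (x + v)) (f m) = 1" "dist (f m) (f (x + w)) = 1"
    using d[OF in_plane(2,4)] d[OF in_plane(4,3)] half vw by simp_all
  then have "f m = point_at (f (x + v)) (f (x + w)) (1/2)" by (intro point_at_unique) (simp_all add: PQ)
  moreover have "dist (f (x + v)) (f x) = 1" "dist (f x) (f (x + w)) = 1"
    using d[OF in_plane(2,1)] d[OF in_plane(1,3)] v(1) w(1) is_norm_minus[OF N, of w] by simp_all
  then have "f x = point_at (f (x + v)) (f (x + w)) (1/2)" by (intro point_at_unique) (simp_all add: PQ)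
  ultimately have "N (x - m) = 0" using d[OF in_plane(1,4)] by simp
  then have "v + w = 0" using is_normD(2)[OF N] by (simp add: m_def)
  then have "u \<bullet> (v + w) = 0" by simp
  then show False using v(2) w(2) by (simp add: inner_add_right)
qed

lemma semiplane_ray:
  fixes f :: "real^2 \<Rightarrow> 'a"
  assumes iso: "semiplane_isometry N u b f S" and "u \<bullet> x = b"
    and v: "N v = 1" "u \<bullet> v \<ge> 0" and w: "N w = 1" "u \<bullet> w \<ge> 0"
  shows "ray (\<lambda>t. f (x + t *\<^sub>R v))"
    and "t \<ge> 0 \<Longrightarrow> dist (f (x + t *\<^sub>R v)) (f (x + t *\<^sub>R w)) = t * N (v - w)"
proof -
  note N = semiplane_isometryD(1)[OF iso]
  have in_plane: "b \<le> u \<bullet> (x + s *\<^sub>R z)" if "s \<ge> 0" "u \<bullet> z \<ge> 0" for s z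
    using that assms(2) by (simp add: inner_add_right)
  have "x + s *\<^sub>R v - (x + t *\<^sub>R v) = (s - t) *\<^sub>R v" for s t by (simp add: algebra_simps)
  then show "ray (\<lambda>t. f (x + t *\<^sub>R v))"
    unfolding ray_def distance_preserving_on_def
    using semiplane_isometryD(3)[OF iso in_plane in_plane] v is_normD(3)[OF N] by simp
  have "x + t *\<^sub>R v - (x + t *\<^sub>R w) = t *\<^sub>R (v - w)" by (simp add: algebra_simps)
  then show "t \<ge> 0 \<Longrightarrow> dist (f (x + t *\<^sub>R v)) (f (x + t *\<^sub>R w)) = t * N (v - w)"
    using semiplane_isometryD(3)[OF iso in_plane in_plane] v w is_normD(3)[OF N] by simp
qed

lemma cone_converges_rays:
  fixes c :: "nat \<Rightarrow> real \<Rightarrow> 'a"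
  assumes c: "\<And>n. ray (c n)" "\<And>n. c n 0 = p" and a: "ray a" "a 0 = p"
    and d: "\<And>n t. t \<ge> 0 \<Longrightarrow> dist (c n t) (a t) \<le> t * r n" and r: "r \<longlonglongrightarrow> 0"
  shows "cone_converges p (\<lambda>n. Inr (ray_class (c n))) (Inr (ray_class a))"
proof -
  have path: "ray_to p (ray_class (c n)) t = c n t" "ray_to p (ray_class a) t = a t" if "t \<ge> 0" for n t
    using ray_to_ray_class[OF c(1) that, of n] ray_to_ray_class[OF a(1) that] c(2) a(2) by simp_all
  have "uniform_limit {0..R} (\<lambda>n. ray_to p (ray_class (c n))) (ray_to p (ray_class a)) sequentially" for R
  proof (rule uniform_limitI)
    fix e :: real assume "e > 0"
    have "(\<lambda>n. R * r n) \<longlonglongrightarrow> R * 0" by (intro tendsto_intros r)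
    then have "\<forall>\<^sub>F n in sequentially. R * r n < e" using \<open>e > 0\<close> by (intro order_tendstoD(2)) auto
    then show "\<forall>\<^sub>F n in sequentially. \<forall>t\<in>{0..R}. dist (ray_to p (ray_class (c n)) t) (ray_to p (ray_class a) t) < e"
    proof eventually_elim
      case (elim n)
      have "dist (c n 1) (a 1) \<le> r n" using d[of 1 n] by simp
      then have "r n \<ge> 0" using zero_le_dist order_trans by blast
      show ?case
      proof
        fix t assume t: "t \<in> {0..R}"
        then have "dist (c n t) (a t) \<le> t * r n" using d by simp
        also have "\<dots> \<le> R * r n" using t \<open>r n \<ge> 0\<close> by (intro mult_right_mono) auto
        finally show "dist (ray_to p (ray_class (c n)) t) (ray_to p (ray_class a) t) < e" using path elim t by simp
      qed
    qed
  qed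
  moreover have "cone_path p (Inr \<zeta>) = ray_to p \<zeta>" for \<zeta> by (rule ext) simp
  ultimately show ?thesis unfolding cone_converges_def by simp
qed

lemma Td_ge_pi_ends:
  fixes a :: "real \<Rightarrow> 'a"
  assumes "geodesic_line a" "a 0 = p"
  shows "Td_ge_pi p (end_plus a) (end_minus a)"
proof -
  have "ray_divergence p (ray_class a) (ray_class (\<lambda>t. a (- t))) = 1"
    by (rule ray_divergence_eq)
      (use assms geodesic_line_ray geodesic_line_reverse geodesic_line_dist[OF assms(1)] in auto)
  then show ?thesis unfolding Td_ge_pi_def Td_less_pi_def end_plus_def end_minus_def by simp
qed

lemma Td_le_pi_if_half_plane:
  fixes a :: "real \<Rightarrow> 'a"
  assumes a: "geodesic_line a" "a 0 = p" and S: "bounds_normed_semiplane a S"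
  shows "Td_le_pi p (end_plus a) (end_minus a)"
proof -
  obtain N u b f where iso: "semiplane_isometry N u b f S" and range: "range a = f ` {v. u \<bullet> v = b}"
    using S unfolding bounds_normed_semiplane_def by blast
  obtain x e where x: "u \<bullet> x = b" and e: "u \<bullet> e = 0" "N e = 1" and af: "\<And>t. a t = f (x + t *\<^sub>R e)"
    using boundary_line_parametrization[OF iso a(1) range] by blast
  note N = semiplane_isometryD(1)[OF iso]
  have p: "f x = p" using af[of 0] a(2) by simp
  have uu: "u \<bullet> u > 0" using semiplane_isometryD(2)[OF iso] by simp
  \<comment> \<open>As \<open>u \<bullet> u > 0\<close>, adding a multiple of \<open>u\<close> tilts
    the boundary direction strictly into the half-plane, and the tilt tends to 0.\<close>
  define dir where "dir e' n = e' + (1 / real (Suc n)) *\<^sub>R u" for e' n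
  define v where "v e' n = (1 / N (dir e' n)) *\<^sub>R dir e' n" for e' n
  have conv: "N (v e' n) = 1 \<and> u \<bullet> v e' n > 0 \<and> N (v e' n - e') \<le> 2 * N u * (1 / real (Suc n))"
    if e': "u \<bullet> e' = 0" "N e' = 1" for e' n
  proof -
    have ud: "u \<bullet> dir e' n > 0" using e'(1) uu by (simp add: dir_def inner_add_right)
    then have ne: "dir e' n \<noteq> 0" by auto
    then have "N (dir e' n) > 0" using is_normD(1,2)[OF N, of "dir e' n"] by linarith
    then have "u \<bullet> v e' n > 0" using ud by (simp add: v_def)
    moreover have "N (v e' n - e') \<le> 2 * N (dir e' n - e')"
      unfolding v_def by (rule is_norm_normalize(2)[OF N ne e'(2)])
    moreover have "dir e' n - e' = (1 / real (Suc n)) *\<^sub>R u" by (simp add: dir_def)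
    ultimately show ?thesis
      using is_norm_normalize(1)[OF N ne e'(2)] is_normD(3)[OF N, of "1 / real (Suc n)" u] by (simp add: v_def)
  qed
  define c where "c e' n t = f (x + t *\<^sub>R v e' n)" for e' n and t :: real
  have me: "u \<bullet> (- e) = 0" "N (- e) = 1" using e is_norm_minus[OF N, of e] by simp_all
  have conv_rays: "(\<forall>n. ray (c e' n) \<and> c e' n 0 = p) \<and>
      cone_converges p (\<lambda>n. Inr (ray_class (c e' n))) (Inr (ray_class a'))"
    if e': "u \<bullet> e' = 0" "N e' = 1" and a': "a' = (\<lambda>t. f (x + t *\<^sub>R e'))" for e' a'
  proof -
    note v = conv[OF e']
    have ue': "u \<bullet> e' \<ge> 0" using e' by simp
    have r: "ray (c e' n)" "c e' n 0 = p" for n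
      using semiplane_ray(1)[OF iso x _ _ e'(2) ue', of "v e' n"] v[of n] p
      by (simp_all add: c_def[abs_def] less_imp_le)
    have ra: "ray a'" "a' 0 = p" unfolding a' using semiplane_ray(1)[OF iso x e'(2) ue' e'(2) ue'] p by simp_all
    have "(\<lambda>n. 2 * N u * (1 / real (Suc n))) \<longlonglongrightarrow> 2 * N u * 0"
      by (intro tendsto_intros LIMSEQ_Suc[OF lim_1_over_n])
    then have lim: "(\<lambda>n. 2 * N u * (1 / real (Suc n))) \<longlonglongrightarrow> 0" by simp
    have "dist (c e' n t) (a' t) \<le> t * (2 * N u * (1 / real (Suc n)))" if "t \<ge> 0" for n t
    proof -
      have "dist (c e' n t) (a' t) = t * N (v e' n - e')"
        unfolding c_def a' using semiplane_ray(2)[OF iso x _ _ e'(2) ue' that, of "v e' n"] v[of n] by simp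
      also have "\<dots> \<le> t * (2 * N u * (1 / real (Suc n)))" using v[of n] that by (intro mult_left_mono) auto
      finally show ?thesis .
    qed
    from cone_converges_rays[OF r ra this lim] show ?thesis using r by blast
  qed
  have "a = (\<lambda>t. f (x + t *\<^sub>R e))" using af by blast
  note plus = conv_rays[OF e this]
  have "(\<lambda>t. a (- t)) = (\<lambda>t. f (x + t *\<^sub>R (- e)))" using af by simp
  note minus = conv_rays[OF me this]
  have less: "Td_less_pi p (ray_class (c e n)) (ray_class (c (- e) n))" for n
  proof -
    note v = conv[OF e, of n] and w = conv[OF me, of n]
    have "ray_divergence p (ray_class (c e n)) (ray_class (c (- e) n)) = N (v e n - v (- e) n) / 2"
    proof (rule ray_divergence_eq)
      fix t :: real assume "t \<ge> 0"
      then show "dist (c e n t) (c (- e) n t) = 2 * (N (v e n - v (- e) n) / 2) * t"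
        unfolding c_def using semiplane_ray(2)[OF iso x, of "v e n" "v (- e) n"] v w by simp
    qed (use plus minus in auto)
    also have "\<dots> < 1" using semiplane_strictly_convex[OF iso x, of "v e n" "v (- e) n"] v w by simp
    finally show ?thesis unfolding Td_less_pi_def .
  qed
  show ?thesis
    unfolding Td_le_pi_def end_plus_def end_minus_def
  proof (intro allI impI)
    fix U V assume U: "openin (cone_topology p) U" "Inr (ray_class a) \<in> U"
      and V: "openin (cone_topology p) V" "Inr (ray_class (\<lambda>t. a (- t))) \<in> V"
    have boundary: "range (\<lambda>n. Inr (ray_class (c e' n))) \<subseteq> geodesic_compactification"
      if "\<forall>n. ray (c e' n) \<and> c e' n 0 = p" for e'
      using that ray_class_in_boundary unfolding geodesic_compactification_def by blast
    have "\<forall>\<^sub>F n in sequentially. Inr (ray_class (c e n)) \<in> U"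
      using U plus boundary[of e] unfolding openin_cone_topology by blast
    moreover have "\<forall>\<^sub>F n in sequentially. Inr (ray_class (c (- e) n)) \<in> V"
      using V minus boundary[of "- e"] unfolding openin_cone_topology by blast
    ultimately have "\<forall>\<^sub>F n in sequentially. Inr (ray_class (c e n)) \<in> U \<and> Inr (ray_class (c (- e) n)) \<in> V"
      by (rule eventually_conj)
    then obtain n where "Inr (ray_class (c e n)) \<in> U" "Inr (ray_class (c (- e) n)) \<in> V"
      using eventually_happens'[OF sequentially_bot] by blast
    then show "\<exists>\<xi>' \<eta>'. Inr \<xi>' \<in> U \<and> Inr \<eta>' \<in> V \<and> Td_less_pi p \<xi>' \<eta>'" using less by blast
  qed
qed

end

theorem theorem3p2:
  fixes a :: "real \<Rightarrow> 'a::metric_space" and p :: 'a and \<xi> \<eta> :: "'a ideal_point"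
  assumes "proper_space TYPE('a)" and "busemann_space TYPE('a)"
    and "geodesic_line a" and "a 0 = p"
    and "\<xi> = end_plus a" and "\<eta> = end_minus a"
  shows "(Td_eq_pi p \<xi> \<eta> \<longleftrightarrow>
      (\<exists>\<Phi> \<Psi>. horofunction \<Phi> \<and> centered_in p \<Phi> \<xi> \<and> horofunction \<Psi> \<and> centered_in p \<Psi> \<eta> \<and>
        \<not> bounded (horoball \<Phi> p \<inter> horoball \<Psi> p)))
    \<and> ((\<exists>\<Phi> \<Psi>. horofunction \<Phi> \<and> centered_in p \<Phi> \<xi> \<and> horofunction \<Psi> \<and> centered_in p \<Psi> \<eta> \<and>
        \<not> bounded (horoball \<Phi> p \<inter> horoball \<Psi> p)) \<longleftrightarrow>
      (\<exists>S. normed_semiplane S \<and> bounds_normed_semiplane a S))"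
    (is "(?td \<longleftrightarrow> ?horo) \<and> (?horo \<longleftrightarrow> ?plane)")
proof -
  interpret proper_busemann "TYPE('a)" using assms(1,2) by unfold_locales
  have "?horo" if ?td
  proof -
    have "Td_le_pi p (ray_class a) (ray_class (\<lambda>t. a (- t)))"
      using that assms(5,6) unfolding Td_eq_pi_def end_plus_def end_minus_def by blast
    then show ?thesis
      using horoballs_if_Td_le_pi[of a p "\<lambda>t. a (- t)"] geodesic_line_ray[OF assms(3)]
        geodesic_line_ray[OF geodesic_line_reverse[OF assms(3)]] assms(4-6)
      unfolding end_plus_def end_minus_def by simp
  qed
  moreover have ?plane if ?horo
    using half_plane_if_centered_horoballs[OF assms(3,4)] that assms(5,6) by blast
  moreover have ?td if ?plane
    using that Td_ge_pi_ends[OF assms(3,4)] Td_le_pi_if_half_plane[OF assms(3,4)] assms(5,6)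
    unfolding Td_eq_pi_def by blast
  ultimately show ?thesis by blast
qed

end
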